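(* Let $W=\mathfrak{S}_n$ with simple reflections $s_1,\dots,s_{n-1}$, let $\mathbf{c}$ be a Coxeter word (an ordering of $\{s_1,\dots,s_{n-1}\}$), and let $p$ be a positive integer coprime to $n$. Then \begin{align*} R_{e,\mathbf{c}^p}(q)&=(q-1)^{n-1}\,\frac{1}{[n+p]_q}\begin{bmatrix} n+p \\ n \end{bmatrix}_q \qquad\text{and}\\ \sum_{v\in\mathfrak{S}_n} R^{(v)}_{e,\mathbf{c}^p}(q)&=(q-1)^{n-1}\,[p]_q^{\,n-1}. \end{align*}
   Context: Here $[a]_q=1+q+\cdots+q^{a-1}$, $[m]_q!=[1]_q[2]_q\cdots[m]_q$, and $\begin{bmatrix} a+b \\ a \end{bmatrix}_q=\frac{[a+b]_q!}{[a]_q!\,[b]_q!}$. $\mathbf{c}^p$ is the concatenation of $p$ copies of $\mathbf{c}$, a word $(s_1,\dots,s_m)$ of length $m=p(n-1)$. For a word $\mathbf{w}=(s_1,\dots,s_m)$ and $u,v\in W$: a subword is $\mathbf{u}=(u_1,\dots,u_m)$ with $u_i\in\{s_i,e\}$, and $U_{(i)}=u_1\cdots u_i$ (with $U_{(0)}=e$); $\mathbf{u}$ is a $u$-subword if $U_{(m)}=u$, and is $v$-distinguished if $vU_{(i)}\le vU_{(i-1)}s_i$ in weak order for all $i$. With $e_{\mathbf{u}}=|\{i: u_i=e\}|$ and $d^{(v)}_{\mathbf{u}}=|\{i: vU_{(i)}<vU_{(i-1)}\}|$, one sets $R^{(v)}_{u,\mathbf{w}}(q)=\sum_{\mathbf{u}}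 (q-1)^{e_{\mathbf{u}}}q^{d^{(v)}_{\mathbf{u}}}$, summing over $v$-distinguished $u$-subwords $\mathbf{u}$ of $\mathbf{w}$, and $R_{u,\mathbf{w}}=R^{(e)}_{u,\mathbf{w}}$. (Equivalently, $R^{(v)}_{u,\emptyset}=\delta_{u,e}$ and $R^{(v)}_{u,\mathbf{w}s}=R^{(v)}_{us,\mathbf{w}}$ if $vus<vu$, and $=qR^{(v)}_{us,\mathbf{w}}+(q-1)R^{(v)}_{u,\mathbf{w}}$ if $vus>vu$.) *)

theory Defs
  imports
    "HOL-Combinatorics.Permutations"
    "HOL-Computational_Algebra.Polynomial_Factorial"
begin

definition simple_reflections :: "nat \<Rightarrow> (nat \<Rightarrow> nat) set" where
  "simple_reflections n = (\<lambda>i. transpose i (Suc i)) ` {1..<n}"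

definition word_prod :: "(nat \<Rightarrow> nat) list \<Rightarrow> nat \<Rightarrow> nat" where
  "word_prod us = foldr (\<circ>) us id"

definition coxeter_length :: "nat \<Rightarrow> (nat \<Rightarrow> nat) \<Rightarrow> nat" where
  "coxeter_length n w =
     (LEAST k. \<exists>us. length us = k \<and> set us \<subseteq> simple_reflections n \<and> word_prod us = w)"

text \<open>
  This is the right weak order: its covers are the pairs $u < us$ with $s$ a simple reflection.
\<close>

definition weak_le :: "nat \<Rightarrow> (nat \<Rightarrow> nat) \<Rightarrow> (nat \<Rightarrow> nat) \<Rightarrow> bool" where
  "weak_le n u w \<longleftrightarrow>
     coxeter_length n w = coxeter_length n u + coxeter_length n (inv u \<circ> w)"

definition weak_less :: "nat \<Rightarrow> (nat \<Rightarrow> nat) \<Rightarrow> (nat \<Rightarrow> nat) \<Rightarrow> bool" where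
  "weak_less n u w \<longleftrightarrow> weak_le n u w \<and> u \<noteq> w"

definition coxeter_word :: "nat \<Rightarrow> (nat \<Rightarrow> nat) list \<Rightarrow> bool" where
  "coxeter_word n c \<longleftrightarrow> distinct c \<and> set c = simple_reflections n"

definition word_power :: "'a list \<Rightarrow> nat \<Rightarrow> 'a list" where
  "word_power c p = concat (replicate p c)"

definition subwords :: "(nat \<Rightarrow> nat) list \<Rightarrow> (nat \<Rightarrow> nat) list set" where
  "subwords w = {us. length us = length w \<and> (\<forall>i<length w. us ! i = w ! i \<or> us ! i = id)}"

definition partial_prod :: "(nat \<Rightarrow> nat) list \<Rightarrow> nat \<Rightarrow> nat \<Rightarrow> nat" where
  "partial_prod us i = word_prod (take i us)"

text \<open>
  List positions start at 0: the letter \<open>us ! i\<close> leads from \<open>partial_prod us i\<close>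
  to \<open>partial_prod us (Suc i)\<close>.
\<close>

definition distinguished ::
    "nat \<Rightarrow> (nat \<Rightarrow> nat) \<Rightarrow> (nat \<Rightarrow> nat) list \<Rightarrow> (nat \<Rightarrow> nat) list \<Rightarrow> bool" where
  "distinguished n v w us \<longleftrightarrow>
     (\<forall>i<length w. weak_le n (v \<circ> partial_prod us (Suc i)) (v \<circ> partial_prod us i \<circ> w ! i))"

definition skip_count :: "(nat \<Rightarrow> nat) list \<Rightarrow> nat" where
  "skip_count us = card {i. i < length us \<and> us ! i = id}"

definition descent_count :: "nat \<Rightarrow> (nat \<Rightarrow> nat) \<Rightarrow> (nat \<Rightarrow> nat) list \<Rightarrow> nat" where
  "descent_count n v us =
     card {i. i < length us \<and>
       weak_less n (v \<circ> partial_prod us (Suc i)) (v \<circ> partial_prod us i)}"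

definition distinguished_subwords ::
    "nat \<Rightarrow> (nat \<Rightarrow> nat) \<Rightarrow> (nat \<Rightarrow> nat) \<Rightarrow> (nat \<Rightarrow> nat) list \<Rightarrow> (nat \<Rightarrow> nat) list set" where
  "distinguished_subwords n v u w =
     {us \<in> subwords w. word_prod us = u \<and> distinguished n v w us}"

text \<open>
  \<open>R_poly n v u w\<close> is $R^{(v)}_{u,\mathbf{w}}(q)$; the indeterminate $q$ is \<open>[:0, 1:]\<close>.
\<close>

definition R_poly ::
    "nat \<Rightarrow> (nat \<Rightarrow> nat) \<Rightarrow> (nat \<Rightarrow> nat) \<Rightarrow> (nat \<Rightarrow> nat) list \<Rightarrow> int poly" where
  "R_poly n v u w =
     (\<Sum>us\<in>distinguished_subwords n v u w.
        ([:0, 1:] - 1) ^ skip_count us * [:0, 1:] ^ descent_count n v us)"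

text \<open>
  Quotients of \<open>q\<close>-numbers live in the field of fractions of the polynomial ring, where
  \<open>q_int\<close> and \<open>q_fact\<close> at \<open>qvar\<close> are nonzero (for positive index, resp. any index).
\<close>

definition qvar :: "int poly fract" where
  "qvar = to_fract [:0, 1:]"

definition q_int :: "'a::comm_semiring_1 \<Rightarrow> nat \<Rightarrow> 'a" where
  "q_int q a = (\<Sum>i<a. q ^ i)"

definition q_fact :: "'a::comm_semiring_1 \<Rightarrow> nat \<Rightarrow> 'a" where
  "q_fact q m = (\<Prod>i=1..m. q_int q i)"

definition q_binomial :: "'a::field \<Rightarrow> nat \<Rightarrow> nat \<Rightarrow> 'a" where
  "q_binomial q m k = q_fact q m / (q_fact q k * q_fact q (m - k))"

end

theory Submission
  imports Defs "Jordan_Normal_Form.Schur_Decomposition"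
begin

text \<open>
  Let the Hecke algebra act on functions on words over the natural numbers, the generator \<open>T\<^sub>i\<close> exchanging
  the letters at the places \<open>i\<close> and \<open>i + 1\<close>. On permutations, the matrix entries of a product of
  generators are the polynomials $R^{(v)}_{u,\mathbf{w}}$, so the second sum is the trace of
  \<open>T\<^sub>c\<^sup>p\<close> on the words that are permutations.

  On any finite set of words that is stable under the exchanges, the trace of \<open>T\<^sub>c\<^sup>p\<close> at \<open>q\<close> is the trace of
  \<open>T\<^sub>c\<close> at \<open>q\<^sup>p\<close>. Indeed the trace does not depend on the order of the generators in \<open>c\<close>, and for the
  standard order \<open>T\<^sub>c\<^sup>n\<close> is the product of the Jucys--Murphy elements, whose eigenvalues are powers of \<open>q\<close>.
  So for \<open>q = x\<^sup>n\<close> the eigenvalues of \<open>T\<^sub>c\<close> have the form \<open>\<zeta> x\<^sup>k\<close> with \<open>\<zeta>\<^sup>n = 1\<close>, and since \<open>p\<close> is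
  prime to \<open>n\<close> the sum of \<open>\<zeta>\<^sup>p\<close> over the eigenvalues with a given \<open>k\<close> is that of \<open>\<zeta>\<close>; this follows
  from the congruence \<open>tr A\<^sup>l \<equiv> \<Sum> A\<^sub>a\<^sub>a\<^sup>l\<close> modulo primes \<open>l\<close>. The trace of \<open>T\<^sub>c\<close> itself is elementary, for
  all diagonal entries are products over adjacent letters that vanish unless the word increases weakly.
  On permutations only the identity contributes, and this gives the second formula.

  For the first formula, weight the words of length \<open>n\<close> over \<open>{0..<N}\<close> by \<open>q\<close> to the sum of their
  letters. The weighted trace has the Markov property, by which its normalised limit for \<open>N \<rightarrow> \<infinity>\<close> is the
  entry at the identity permutation, that is $R_{e,\mathbf{w}}$. For $\mathbf{w} = \mathbf{c}^p$
  it is a sum over weakly increasing words, whose limit satisfies a first-order recursion in \<open>n\<close>.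
\<close>

section \<open>Hecke relations and Jucys--Murphy elements\<close>

lemma prod_list_commute:
  fixes A :: "'r::ring_1"
  assumes "\<And>x. x \<in> set xs \<Longrightarrow> A * x = x * A"
  shows "A * prod_list xs = prod_list xs * A"
  using assms
proof (induction xs)
  case (Cons x xs)
  then show ?case by (metis list.set_intros mult.assoc prod_list.Cons)
qed simp

section \<open>Elements annihilated by products of factors \<open>A - q ^ k\<close>\<close>

locale central_element =
  fixes q :: "'r::ring_1"
  assumes central: "q * x = x * q"
begin

text \<open>A ring-level form of "all eigenvalues are powers of \<open>q\<close>": it needs neither
  a field nor eigenvectors, and it survives specialisation of \<open>q\<close>.\<close>

definition q_split :: "'r \<Rightarrow> bool" where
  "q_split A \<longleftrightarrow> (\<exists>ks. (\<Prod>k\<leftarrow>ks. A - q ^ k) = 0)"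

lemma central_power: "q ^ k * x = x * q ^ k"
  by (metis central power_commuting_commutes)

lemma central_power_left: "x * (q ^ k * y) = q ^ k * (x * y)"
  by (metis central_power mult.assoc)

lemma central_left: "x * (q * y) = q * (x * y)"
  by (metis central mult.assoc)

lemma diff_power_commute: "A * B = B * A \<Longrightarrow> (A - q ^ k) * (B - q ^ l) = (B - q ^ l) * (A - q ^ k)"
  by (simp add: algebra_simps central_power[of _ A] central_power[of _ B] flip: power_add)

text \<open>Replaces an argument by joint eigenspaces: a left multiple of \<open>A - q ^ k\<close>
  vanishes where \<open>A\<close> is \<open>q ^ k\<close>, so the product of the \<open>Y k\<close>
  over all roots of \<open>A\<close> vanishes altogether. The factors can be regrouped because the
  \<open>Y k\<close> commute with \<open>A\<close>.\<close>

lemma prod_list_left_multiples: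
  assumes "\<And>k. \<exists>X. Y k = X * (A - q ^ k)"
    and "\<And>k. Y k * A = A * Y k"
  shows "\<exists>Z. (\<Prod>k\<leftarrow>ks. Y k) = Z * (\<Prod>k\<leftarrow>ks. A - q ^ k)"
proof (induction ks)
  case (Cons k ks)
  then obtain Z where Z: "(\<Prod>k\<leftarrow>ks. Y k) = Z * (\<Prod>k\<leftarrow>ks. A - q ^ k)" by auto
  obtain X where X: "Y k = X * (A - q ^ k)" using assms(1) by auto
  let ?P = "\<Prod>k\<leftarrow>ks. A - q ^ k"
  have 1: "(A - q ^ k) * (\<Prod>k\<leftarrow>ks. Y k) = (\<Prod>k\<leftarrow>ks. Y k) * (A - q ^ k)"
    by (rule prod_list_commute) (auto simp: left_diff_distrib right_diff_distrib assms(2) central_power[symmetric])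
  have 2: "(A - q ^ k) * ?P = ?P * (A - q ^ k)"
    by (rule prod_list_commute) (auto intro: diff_power_commute)
  have "Y k * (\<Prod>k\<leftarrow>ks. Y k) = X * (\<Prod>k\<leftarrow>ks. Y k) * (A - q ^ k)"
    by (simp add: X 1 mult.assoc)
  also have "\<dots> = X * Z * ((A - q ^ k) * ?P)" by (simp add: Z 2 mult.assoc)
  finally show ?case by auto
qed auto

lemma prod_list_concat_map: "(\<Prod>x\<leftarrow>concat (map g ks). f x) = (\<Prod>k\<leftarrow>ks. \<Prod>x\<leftarrow>g k. (f x :: 'r))"
  by (induction ks) auto

text \<open>Where \<open>A\<close> is \<open>q ^ k\<close> and \<open>B\<close> is
  \<open>q ^ l\<close>, the product is \<open>q ^ (k + l)\<close>; so the sums of the exponents of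
  both factors serve for \<open>A * B\<close>.\<close>

lemma q_split_mult:
  assumes "q_split A" "q_split B" and AB: "A * B = B * A"
  shows "q_split (A * B)"
proof -
  obtain as bs where as: "(\<Prod>k\<leftarrow>as. A - q ^ k) = 0" and bs: "(\<Prod>k\<leftarrow>bs. B - q ^ k) = 0"
    using assms by (auto simp: q_split_def)
  let ?Y = "\<lambda>k. \<Prod>l\<leftarrow>map ((+) k) bs. A * B - q ^ l"
  have Y: "\<exists>X. ?Y k = X * (A - q ^ k)" for k
  proof -
    \<comment> \<open>Modulo left multiples of \<open>A - q ^ k\<close>, the product
      \<open>A * B\<close> may be replaced by \<open>q ^ k * B\<close>, and each factor releases one
      \<open>q ^ k\<close>.\<close>
    have "\<exists>X. (\<Prod>l\<leftarrow>map ((+) k) ls. A * B - q ^ l) = X * (A - q ^ k) + q ^ (k * length ls) * (\<Prod>l\<leftarrow>ls. B - q ^ l)"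
      for ls
    proof (induction ls)
      case (Cons l ls)
      then obtain X where X: "(\<Prod>l\<leftarrow>map ((+) k) ls. A * B - q ^ l)
        = X * (A - q ^ k) + q ^ (k * length ls) * (\<Prod>l\<leftarrow>ls. B - q ^ l)" by auto
      let ?P = "\<Prod>l\<leftarrow>ls. B - q ^ l"
      have PA: "(A - q ^ k) * ?P = ?P * (A - q ^ k)"
        by (rule prod_list_commute) (auto intro: diff_power_commute AB)
      have e: "A * B - q ^ (k + l) = B * (A - q ^ k) + q ^ k * (B - q ^ l)"
        by (simp add: left_diff_distrib right_diff_distrib AB power_add central_power[of _ B] mult.assoc)
      have "(A * B - q ^ (k + l)) * (X * (A - q ^ k) + q ^ (k * length ls) * ?P)
        = ((A * B - q ^ (k + l)) * X + B * q ^ (k * length ls) * ?P) * (A - q ^ k)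
          + q ^ k * (B - q ^ l) * q ^ (k * length ls) * ?P"
      proof -
        have "B * (A - q ^ k) * (q ^ (k * length ls) * ?P) = B * q ^ (k * length ls) * ((A - q ^ k) * ?P)"
          by (simp add: mult.assoc central_power_left[of "A - q ^ k"])
        then have "(A * B - q ^ (k + l)) * (q ^ (k * length ls) * ?P)
          = B * q ^ (k * length ls) * (?P * (A - q ^ k)) + q ^ k * (B - q ^ l) * q ^ (k * length ls) * ?P"
          unfolding e PA by (simp add: distrib_right mult.assoc)
        then show ?thesis by (simp add: distrib_left distrib_right mult.assoc)
      qed
      also have "q ^ k * (B - q ^ l) * q ^ (k * length ls) * ?P
        = q ^ (k * length (l # ls)) * (\<Prod>l\<leftarrow>l # ls. B - q ^ l)"
        by (simp add: power_add mult.assoc central_power_left[of "B - q ^ l"])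
      finally show ?case using X by auto
    qed (auto intro: exI[of _ 0])
    from this[of bs] show ?thesis using bs by auto
  qed
  have "A * (A * B - q ^ l) = (A * B - q ^ l) * A" for l
    by (simp add: right_diff_distrib left_diff_distrib central_power[of _ A] mult.assoc) (metis AB mult.assoc)
  then have YA: "?Y k * A = A * ?Y k" for k
    by (intro prod_list_commute[symmetric]) auto
  obtain Z where "(\<Prod>k\<leftarrow>as. ?Y k) = Z * (\<Prod>k\<leftarrow>as. A - q ^ k)"
    using prod_list_left_multiples[of ?Y A as, OF Y YA] by blast
  then have "(\<Prod>l\<leftarrow>concat (map (\<lambda>k. map ((+) k) bs) as). A * B - q ^ l) = 0"
    unfolding prod_list_concat_map by (simp add: as)
  then show ?thesis unfolding q_split_def by blast
qed

lemma q_split_1: "q_split 1"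
  unfolding q_split_def by (rule exI[of _ "[0]"]) simp

text \<open>
  For a joint eigenvector of \<open>J\<close> and \<open>K\<close>, either the intertwiner \<open>\<Phi>\<close> maps it to an eigenvector of
  \<open>J\<close>, or \<open>\<Phi>\<^sup>2\<close> kills it and the two eigenvalues differ by a factor 1 or \<open>q\<^sup>2\<close>.
\<close>

lemma q_split_conjugate:
  assumes quad: "t * t = (q - 1) * t + q"
    and K: "K = t * J * t" and KJ: "J * K = K * J"
    and cancel: "\<And>x. q * x = 0 \<Longrightarrow> x = 0"
    and "q_split J"
  shows "q_split K"
proof -
  obtain ks where ks: "(\<Prod>k\<leftarrow>ks. J - q ^ k) = 0" using assms by (auto simp: q_split_def)
  \<comment> \<open>An intertwiner free of denominators: up to factors \<open>q\<close> it exchanges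
    \<open>J\<close> and \<open>K\<close>.\<close>
  define \<Phi> where "\<Phi> = t * (q * J - K) + (q - 1) * K"
  note cs = central[of t, symmetric] central[of J, symmetric] central[of K, symmetric]
    central[of \<Phi>, symmetric] central_left[of t] central_left[of J] central_left[of K] central_left[of \<Phi>]
  note ds = left_diff_distrib right_diff_distrib distrib_left distrib_right mult.assoc
  have KJ': "J * (K * y) = K * (J * y)" for y by (metis KJ mult.assoc)
  have tt: "t * (t * y) = q * (t * y) - t * y + q * y" for y
    by (simp flip: mult.assoc) (simp add: quad ds)
  have Kt: "K * t = q * (t * J) + q * K - K"
    by (simp add: K ds quad cs)
  have Kt': "K * (t * y) = q * (t * (J * y)) + q * (K * y) - K * y" for y
    by (simp flip: mult.assoc add: Kt) (simp add: ds)
  have tK: "t * K = q * (J * t) + q * K - K"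
    by (simp add: K ds tt cs)
  have Jt': "q * (J * (t * y)) = t * (K * y) - q * (K * y) + K * y" for y
  proof -
    have "t * K * y = (q * (J * t) + q * K - K) * y" by (simp add: tK)
    then show ?thesis by (simp add: ds)
  qed
  have K\<Phi>: "K * \<Phi> = q * (\<Phi> * J)"
    by (simp add: \<Phi>_def ds cs KJ KJ' Kt' algebra_simps)
  have J\<Phi>: "q * (J * \<Phi>) = \<Phi> * K"
    by (simp add: \<Phi>_def ds cs KJ KJ' Jt' algebra_simps)
  have t\<Phi>: "t * \<Phi> = q * (q * (t * J)) - q * (t * J) + q * (q * J) - q * K"
    by (simp add: \<Phi>_def ds cs tt algebra_simps)
  have "\<Phi> * \<Phi> = t * (q * (J * \<Phi>) - K * \<Phi>) + (q - 1) * (K * \<Phi>)"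
    by (subst (1) \<Phi>_def) (simp add: ds cs)
  also have "\<dots> = t * \<Phi> * K - q * (t * \<Phi> * J) + (q - 1) * q * (\<Phi> * J)"
    by (simp add: K\<Phi> J\<Phi> ds cs)
  also have "\<dots> = - (q * ((K - J) * (K - q * q * J)))"
    unfolding t\<Phi> by (simp add: \<Phi>_def ds cs KJ KJ' algebra_simps)
  finally have \<Phi>2: "\<Phi> * \<Phi> = - (q * ((K - J) * (K - q * q * J)))" .
  define P where "P = (\<Prod>k\<leftarrow>ks. K - q ^ Suc k)"
  have "\<exists>c. (\<Prod>k\<leftarrow>ks. K - q ^ Suc k) * \<Phi> = q ^ c * (\<Phi> * (\<Prod>k\<leftarrow>ks. J - q ^ k))"
  proof (induction ks)
    case (Cons k ks)
    then obtain c where c: "(\<Prod>k\<leftarrow>ks. K - q ^ Suc k) * \<Phi> = q ^ c * (\<Phi> * (\<Prod>k\<leftarrow>ks. J - q ^ k))" by auto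
    have "(K - q ^ Suc k) * \<Phi> = q * (\<Phi> * (J - q ^ k))"
      by (simp add: left_diff_distrib right_diff_distrib K\<Phi> central_power[of _ \<Phi>] mult.assoc)
    then have "(K - q ^ Suc k) * (q ^ c * (\<Phi> * y)) = q ^ Suc c * (\<Phi> * ((J - q ^ k) * y))" for y
      by (metis central_power_left mult.assoc power_Suc2)
    then show ?case using c by (auto simp: mult.assoc intro!: exI[of _ "Suc c"])
  qed (auto intro: exI[of _ 0])
  \<comment> \<open>Moving \<open>\<Phi>\<close> to the left turns \<open>K - q ^ Suc k\<close> into
    \<open>q\<close> times \<open>J - q ^ k\<close>, which is why the exponents in \<open>P\<close>
    are shifted by one.\<close>
  then have "P * \<Phi> = 0" by (auto simp: P_def ks)
  then have "P * (\<Phi> * \<Phi>) = 0" by (metis mult.assoc mult_zero_left)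
  then have "q * (P * ((K - J) * (K - q * q * J))) = 0"
    by (simp add: \<Phi>2 central_left)
  then have P0: "P * ((K - J) * (K - q * q * J)) = 0" by (rule cancel)
  \<comment> \<open>At \<open>J = q ^ k\<close> the relation \<open>P0\<close> reads
    \<open>P * ((K - q ^ k) * (K - q ^ (k + 2))) = 0\<close>, so \<open>?Y k\<close> vanishes
    there.\<close>
  let ?Y = "\<lambda>k. \<Prod>l\<leftarrow>map Suc ks @ [k, k + 2]. K - q ^ l"
  have Jcomm: "J * (K - q ^ l) = (K - q ^ l) * J" for l
    by (simp add: left_diff_distrib right_diff_distrib KJ central_power[of _ J])
  have PJ: "P * J = J * P"
    unfolding P_def by (rule prod_list_commute[symmetric]) (auto simp: Jcomm Jcomm[of "Suc _", unfolded power_Suc2] Jcomm[of "Suc (Suc _)", unfolded power_Suc2] simp del: power_Suc)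
  have Y: "\<exists>X. ?Y k = X * (J - q ^ k)" for k
  proof -
    define a where "a = q ^ k"
    have a: "x * a = a * x" "x * (a * y) = a * (x * y)" for x y
      unfolding a_def by (rule central_power[symmetric], rule central_power_left)
    have "?Y k = P * ((K - a) * (K - q * (q * a)))"
      by (simp add: P_def a_def mult.assoc o_def)
    also have "\<dots> = P * ((K - a) * (K - q * (q * a)) - (K - J) * (K - q * q * J))"
      unfolding right_diff_distrib[of P] P0 by simp
    also have "(K - a) * (K - q * (q * a)) - (K - J) * (K - q * q * J)
        = (K + q * (q * K) - q * (q * J) - q * (q * a)) * (J - a)"
      by (simp add: ds cs KJ KJ' a(1)[of K] a(1)[of J] a(1)[of q] a(2)[of K] a(2)[of J] a(2)[of q])
    finally show ?thesis unfolding a_def by (auto simp flip: mult.assoc)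
  qed
  have YJ: "?Y k * J = J * ?Y k" for k
    by (rule prod_list_commute[symmetric]) (auto simp: Jcomm Jcomm[of "Suc _", unfolded power_Suc2] Jcomm[of "Suc (Suc _)", unfolded power_Suc2] simp del: power_Suc)
  obtain Z where "(\<Prod>k\<leftarrow>ks. ?Y k) = Z * (\<Prod>k\<leftarrow>ks. J - q ^ k)"
    using prod_list_left_multiples[of ?Y J ks, OF Y YJ] by blast
  then have "(\<Prod>l\<leftarrow>concat (map (\<lambda>k. map Suc ks @ [k, k + 2]) ks). K - q ^ l) = 0"
    unfolding prod_list_concat_map by (simp add: ks)
  then show ?thesis unfolding q_split_def by blast
qed
end

section \<open>The full twist as a product of Jucys--Murphy elements\<close>

locale hecke_relations = central_element q for q :: "'r::ring_1" +
  fixes T :: "nat \<Rightarrow> 'r"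
  assumes quadratic: "T i * T i = (q - 1) * T i + q"
    and braid: "T i * T (Suc i) * T i = T (Suc i) * T i * T (Suc i)"
    and far: "Suc i < j \<Longrightarrow> T i * T j = T j * T i"
begin

text \<open>Multiplicative form without powers of \<open>q\<close>:
  \<open>T i * ... * T 1 * T 1 * ... * T i\<close>.\<close>

primrec jucys_murphy :: "nat \<Rightarrow> 'r" where
  "jucys_murphy 0 = 1"
| "jucys_murphy (Suc i) = T (Suc i) * jucys_murphy i * T (Suc i)"

primrec coxeter_prod :: "nat \<Rightarrow> 'r" where
  "coxeter_prod 0 = 1"
| "coxeter_prod (Suc i) = coxeter_prod i * T (Suc i)"

lemma commute_jucys_murphy:
  "(\<And>j. 1 \<le> j \<Longrightarrow> j \<le> i \<Longrightarrow> x * T j = T j * x) \<Longrightarrow> x * jucys_murphy i = jucys_murphy i * x"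
proof (induction i)
  case (Suc i)
  then have "x * jucys_murphy i = jucys_murphy i * x" "x * T (Suc i) = T (Suc i) * x" by auto
  then show ?case by simp (metis mult.assoc)
qed simp

lemma commute_coxeter_prod:
  "(\<And>j. 1 \<le> j \<Longrightarrow> j \<le> i \<Longrightarrow> x * T j = T j * x) \<Longrightarrow> x * coxeter_prod i = coxeter_prod i * x"
proof (induction i)
  case (Suc i)
  then have "x * coxeter_prod i = coxeter_prod i * x" "x * T (Suc i) = T (Suc i) * x" by auto
  then show ?case by simp (metis mult.assoc)
qed simp

text \<open>In the critical case, \<open>T j\<close> next to the outermost generator, two braid
  moves carry \<open>T j\<close> through the outer factors on both sides, and the outermost
  generator commutes with the inner Jucys--Murphy element.\<close>

lemma T_jucys_murphy:
  "1 \<le> j \<Longrightarrow> j < i \<Longrightarrow> T j * jucys_murphy i = jucys_murphy i * T j"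
proof (induction i arbitrary: j)
  case (Suc i)
  show ?case
  proof (cases "j < i")
    case True
    then have "T j * jucys_murphy i = jucys_murphy i * T j" "T j * T (Suc i) = T (Suc i) * T j"
      using Suc far[of j "Suc i"] by auto
    then show ?thesis by simp (metis mult.assoc)
  next
    case False
    then have "j = i" using Suc.prems by simp
    then obtain k where k: "i = Suc k" "j = Suc k" using Suc.prems by (cases j) auto
    let ?J = "jucys_murphy k" and ?s = "T (Suc k)" and ?t = "T (Suc (Suc k))"
    have tJ: "?t * ?J = ?J * ?t"
      by (rule commute_jucys_murphy) (simp add: far[symmetric])
    have sts: "?s * (?t * (?s * y)) = ?t * (?s * (?t * y))" for y
      by (metis braid mult.assoc)
    have "?s * (?t * (?s * (?J * (?s * ?t)))) = ?t * (?s * (?t * (?J * (?s * ?t))))"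
      by (rule sts)
    also have "?t * (?J * (?s * ?t)) = ?J * (?t * ?s * ?t)" by (metis tJ mult.assoc)
    also have "\<dots> = ?J * (?s * ?t * ?s)" by (simp add: braid)
    finally show ?thesis by (simp add: k mult.assoc)
  qed
qed simp

lemma jucys_murphy_commute: "jucys_murphy i * jucys_murphy k = jucys_murphy k * jucys_murphy i"
proof -
  have "jucys_murphy i * jucys_murphy k = jucys_murphy k * jucys_murphy i" if "i < k" for i k
    by (rule commute_jucys_murphy[symmetric]) (use T_jucys_murphy that in force)
  then show ?thesis by (metis linorder_neqE_nat)
qed

lemma q_split_jucys_murphy:
  assumes "\<And>x. q * x = 0 \<Longrightarrow> x = 0"
  shows "q_split (jucys_murphy i)"
proof (induction i)
  case (Suc i)
  show ?case
    by (rule q_split_conjugate[of "T (Suc i)" _ "jucys_murphy i"])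
      (use quadratic jucys_murphy_commute[of i "Suc i"] assms Suc in auto)
qed (simp add: q_split_1)

text \<open>A braid relation at \<open>T i * T (Suc i)\<close> turns \<open>T (Suc i)\<close> into
  \<open>T i\<close>; the remaining factors commute with what passes them.\<close>

lemma T_coxeter_prod: "1 \<le> i \<Longrightarrow> i < m \<Longrightarrow> T (Suc i) * coxeter_prod m = coxeter_prod m * T i"
proof (induction m)
  case (Suc m)
  show ?case
  proof (cases "i < m")
    case True
    then show ?thesis using Suc far[of i "Suc m"] by simp (metis mult.assoc)
  next
    case False
    then have "i = m" using Suc.prems by simp
    then obtain k where k: "i = Suc k" "m = Suc k" using Suc.prems by (cases i) auto
    have "T (Suc (Suc k)) * coxeter_prod k = coxeter_prod k * T (Suc (Suc k))"
      by (rule commute_coxeter_prod) (simp add: far[symmetric])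
    then show ?thesis unfolding k by simp (metis braid mult.assoc)
  qed
qed simp

primrec descending_prod :: "nat \<Rightarrow> nat \<Rightarrow> 'r" where
  "descending_prod m 0 = 1"
| "descending_prod m (Suc k) = descending_prod m k * T (m - k)"

lemma descending_coxeter_prod:
  "k < m \<Longrightarrow> descending_prod m k * coxeter_prod m = coxeter_prod m * descending_prod (m - 1) k"
proof (induction k)
  case (Suc k)
  have e: "m - k = Suc (m - Suc k)" using Suc.prems by simp
  have "descending_prod m (Suc k) * coxeter_prod m = descending_prod m k * coxeter_prod m * T (m - Suc k)"
    using Suc.prems T_coxeter_prod[of "m - Suc k" m] by (simp add: e mult.assoc)
  then show ?case using Suc by (simp add: mult.assoc)
qed simp

lemma descending_prod_Suc: "T (Suc m) * descending_prod m k = descending_prod (Suc m) (Suc k)"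
  by (induction k) (simp_all add: mult.assoc[symmetric])

text \<open>By the shift under conjugation each further factor \<open>T (Suc m)\<close> is collected
  on the right, where it lengthens the descending product. At \<open>k = Suc m\<close> one more
  Coxeter element completes this product to \<open>jucys_murphy (Suc m)\<close>.\<close>

lemma coxeter_prod_power:
  "k \<le> Suc m \<Longrightarrow> coxeter_prod (Suc m) ^ k = coxeter_prod m ^ k * descending_prod (Suc m) k"
proof (induction k)
  case (Suc k)
  have "coxeter_prod (Suc m) ^ Suc k = coxeter_prod m ^ k * (descending_prod (Suc m) k * coxeter_prod (Suc m))"
    using Suc by (simp add: power_Suc2 mult.assoc del: power_Suc)
  also have "\<dots> = coxeter_prod m ^ k * (coxeter_prod m * (T (Suc m) * descending_prod m k))"
    using Suc.prems descending_coxeter_prod[of k "Suc m"] by (simp add: mult.assoc)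
  also have "\<dots> = coxeter_prod m ^ Suc k * descending_prod (Suc m) (Suc k)"
    unfolding descending_prod_Suc by (simp add: power_Suc2 mult.assoc del: power_Suc)
  finally show ?case .
qed simp

lemma jucys_murphy_eq: "jucys_murphy m = descending_prod m m * coxeter_prod m"
proof (induction m)
  case (Suc m)
  then show ?case unfolding descending_prod_Suc[symmetric] by (simp add: mult.assoc)
qed simp

text \<open>The power is the full twist, the product of the Jucys--Murphy elements up to index
  \<open>m\<close>; these commute and each of them is split.\<close>

lemma q_split_coxeter_prod:
  assumes "\<And>x. q * x = 0 \<Longrightarrow> x = 0"
  shows "q_split (coxeter_prod m ^ Suc m)"
proof -
  \<comment> \<open>The second conjunct provides the commutation that \<open>q_split_mult\<close>
    demands for the next factor.\<close>
  have "q_split (coxeter_prod m ^ Suc m) \<and>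
     (\<forall>k>m. jucys_murphy k * coxeter_prod m ^ Suc m = coxeter_prod m ^ Suc m * jucys_murphy k)"
  proof (induction m)
    case (Suc m)
    have e: "coxeter_prod (Suc m) ^ Suc (Suc m) = coxeter_prod m ^ Suc m * jucys_murphy (Suc m)"
      using coxeter_prod_power[of "Suc m" m] unfolding jucys_murphy_eq
      by (simp add: power_Suc2 mult.assoc del: power_Suc coxeter_prod.simps)
    have "jucys_murphy k * (coxeter_prod m ^ Suc m * jucys_murphy (Suc m))
       = coxeter_prod m ^ Suc m * jucys_murphy (Suc m) * jucys_murphy k" if "k > Suc m" for k
      using Suc jucys_murphy_commute[of k "Suc m"] that by (metis Suc_lessD mult.assoc)
    then show ?case unfolding e using Suc q_split_mult q_split_jucys_murphy assms by (metis lessI)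
  qed (simp add: q_split_1)
  then show ?thesis by blast
qed

end

section \<open>The Hecke algebra acting on functions on words\<close>

definition hop :: "'k::comm_ring_1 \<Rightarrow> nat \<Rightarrow> ((nat \<Rightarrow> nat) \<Rightarrow> 'k) \<Rightarrow> (nat \<Rightarrow> nat) \<Rightarrow> 'k" where
  "hop q i f a = (if a i = a (Suc i) then q * f a
     else if a i < a (Suc i) then (q - 1) * f a + f (a \<circ> transpose i (Suc i))
     else q * f (a \<circ> transpose i (Suc i)))"

text \<open>Linear operators on all functions form one ring in the sense of \<open>ring_1\<close>,
  in which the abstract Hecke relations can be interpreted; finite stable sets of words enter later,
  through \<open>restricts\<close>.\<close>

typedef (overloaded) 'k lin_op =
  "{A :: ((nat \<Rightarrow> nat) \<Rightarrow> 'k::comm_ring_1) \<Rightarrow> (nat \<Rightarrow> nat) \<Rightarrow> 'k.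
     (\<forall>f g. A (\<lambda>x. f x + g x) = (\<lambda>x. A f x + A g x)) \<and> (\<forall>c f. A (\<lambda>x. c * f x) = (\<lambda>x. c * A f x))}"
  morphisms app Lin
  by (rule exI[of _ id]) simp

lemma app_Lin:
  assumes "\<And>f g x. A (\<lambda>x. f x + g x) x = A f x + A g x" "\<And>c f x. A (\<lambda>x. c * f x) x = c * A f x"
  shows "app (Lin A) = A"
  using assms by (intro Lin_inverse) auto

lemma app_plus: "app A (\<lambda>x. f x + g x) x = app A f x + app A g x"
  and app_scale: "app A (\<lambda>x. c * f x) x = c * app A f x"
  using app[of A] by auto

lemma lin_op_eqI: "(\<And>f x. app A f x = app B f x) \<Longrightarrow> A = B"
  by (metis app_inject ext)

instantiation lin_op :: (comm_ring_1) ring_1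
begin

definition "0 = Lin (\<lambda>f x. 0)"
definition "1 = Lin (\<lambda>f. f)"
definition "A + B = Lin (\<lambda>f x. app A f x + app B f x)"
definition "A - B = Lin (\<lambda>f x. app A f x - app B f x)"
definition "- A = Lin (\<lambda>f x. - app A f x)"
definition "A * B = Lin (\<lambda>f. app A (app B f))"

lemma app_zero [simp]: "app 0 f = (\<lambda>x. 0)"
  unfolding zero_lin_op_def by (subst app_Lin) auto

lemma app_one [simp]: "app 1 f = f"
  unfolding one_lin_op_def by (subst app_Lin) auto

lemma app_add [simp]: "app (A + B) f = (\<lambda>x. app A f x + app B f x)"
  unfolding plus_lin_op_def by (subst app_Lin) (auto simp: app_plus app_scale algebra_simps)

lemma app_diff [simp]: "app (A - B) f = (\<lambda>x. app A f x - app B f x)"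
  unfolding minus_lin_op_def by (subst app_Lin) (auto simp: app_plus app_scale algebra_simps)

lemma app_uminus [simp]: "app (- A) f = (\<lambda>x. - app A f x)"
  unfolding uminus_lin_op_def by (subst app_Lin) (auto simp: app_plus app_scale)

lemma app_mult [simp]: "app (A * B) f = app A (app B f)"
  unfolding times_lin_op_def
proof (subst app_Lin)
  show "app A (app B (\<lambda>x. f x + g x)) x = app A (app B f) x + app A (app B g) x" for f g x
    by (simp add: app_plus app_plus[abs_def])
  show "app A (app B (\<lambda>x. c * f x)) x = c * app A (app B f) x" for c f x
    by (simp add: app_scale app_scale[abs_def])
qed simp

instance
proof
  have "app (0 :: 'a lin_op) (\<lambda>_. 1) \<noteq> app 1 (\<lambda>_. 1)" by (simp add: fun_eq_iff)
  then show "(0 :: 'a lin_op) \<noteq> 1" by metis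
qed (auto intro!: lin_op_eqI simp: algebra_simps app_plus)

end

definition scalar_op :: "'k::comm_ring_1 \<Rightarrow> 'k lin_op" where
  "scalar_op c = Lin (\<lambda>f x. c * f x)"

lemma app_scalar_op [simp]: "app (scalar_op c) f = (\<lambda>x. c * f x)"
  unfolding scalar_op_def by (subst app_Lin) (auto simp: algebra_simps)

lemma scalar_op_mult: "scalar_op (c * d) = scalar_op c * scalar_op d"
  by (rule lin_op_eqI) (simp add: mult.assoc)

lemma scalar_op_power: "scalar_op (c ^ k) = scalar_op c ^ k"
  by (induction k) (auto simp: scalar_op_mult intro!: lin_op_eqI)

lemma scalar_op_central: "scalar_op c * A = A * scalar_op c"
  by (rule lin_op_eqI) (simp add: app_scale)

definition hop_op :: "'k::comm_ring_1 \<Rightarrow> nat \<Rightarrow> 'k lin_op" where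
  "hop_op q i = Lin (hop q i)"

lemma app_hop_op [simp]: "app (hop_op q i) = hop q i"
  unfolding hop_op_def by (subst app_Lin) (auto simp: hop_def algebra_simps)

text \<open>On a pair \<open>a\<close>, \<open>a \<circ> transpose i (Suc i)\<close> with unequal
  letters the operator is a 2 by 2 matrix of trace \<open>q - 1\<close> and determinant
  \<open>- q\<close>; at equal letters it is the root \<open>q\<close> of the same
  quadratic.\<close>

lemma hop_quadratic: "hop q i (hop q i f) a = (q - 1) * hop q i f a + q * f a"
proof -
  have "a \<circ> transpose i (Suc i) \<circ> transpose i (Suc i) = a" by (simp add: comp_assoc)
  then show ?thesis by (auto simp: hop_def algebra_simps)
qed

lemma hop_far:
  assumes "Suc i < j"
  shows "hop q i (hop q j f) a = hop q j (hop q i f) a"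
proof -
  have "transpose i (Suc i) \<circ> transpose j (Suc j) = transpose j (Suc j) \<circ> transpose i (Suc i)"
    using assms by (auto simp: fun_eq_iff transpose_def)
  then have "a \<circ> transpose i (Suc i) \<circ> transpose j (Suc j) = a \<circ> transpose j (Suc j) \<circ> transpose i (Suc i)"
    by (simp add: comp_assoc)
  moreover have "transpose j (Suc j) i = i" "transpose j (Suc j) (Suc i) = Suc i"
    "transpose i (Suc i) j = j" "transpose i (Suc i) (Suc j) = Suc j"
    using assms by (auto simp: transpose_def)
  ultimately show ?thesis by (simp add: hop_def algebra_simps)
qed

text \<open>Both sides depend on the relative order of the three letters concerned, which leaves
  finitely many explicit cases.\<close>

lemma hop_braid:
  "hop q i (hop q (Suc i) (hop q i f)) a = hop q (Suc i) (hop q i (hop q (Suc i) f)) a"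
proof -
  define s t where "s = transpose i (Suc i)" and "t = transpose (Suc i) (Suc (Suc i))"
  have val: "s i = Suc i" "s (Suc i) = i" "s (Suc (Suc i)) = Suc (Suc i)"
    "t i = i" "t (Suc i) = Suc (Suc i)" "t (Suc (Suc i)) = Suc i"
    by (auto simp: s_def t_def transpose_def)
  have inv: "s (s x) = x" "t (t x) = x" for x by (auto simp: s_def t_def)
  have sts: "s (t (s x)) = t (s (t x))" for x
    by (auto simp: s_def t_def transpose_def)
  show ?thesis
    unfolding hop_def s_def[symmetric] t_def[symmetric] o_apply val
    by (cases "a i" "a (Suc i)" rule: linorder_cases;
        cases "a i" "a (Suc (Suc i))" rule: linorder_cases;
        cases "a (Suc i)" "a (Suc (Suc i))" rule: linorder_cases)
       (simp_all add: inv sts o_def algebra_simps)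
qed

interpretation hops: hecke_relations "scalar_op q" "hop_op q" for q :: "'k::comm_ring_1"
proof
  show "scalar_op q * x = x * scalar_op q" for x by (rule scalar_op_central)
  show "hop_op q i * hop_op q i = (scalar_op q - 1) * hop_op q i + scalar_op q" for i
    by (rule lin_op_eqI) (simp add: hop_quadratic left_diff_distrib)
  show "hop_op q i * hop_op q (Suc i) * hop_op q i = hop_op q (Suc i) * hop_op q i * hop_op q (Suc i)" for i
    by (rule lin_op_eqI) (simp add: hop_braid)
  show "hop_op q i * hop_op q j = hop_op q j * hop_op q i" if "Suc i < j" for i j
    by (rule lin_op_eqI) (simp add: hop_far[OF that])
qed

section \<open>Traces and eigenvalues\<close>

text \<open>Basis functions: \<open>app A (kron b) a\<close> is the matrix entry of \<open>A\<close>
  in row \<open>a\<close> and column \<open>b\<close>.\<close>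

definition kron :: "'a \<Rightarrow> 'a \<Rightarrow> 'k::zero_neq_one" where
  "kron b a = (if a = b then 1 else 0)"

definition op_trace :: "(nat \<Rightarrow> nat) set \<Rightarrow> 'k::comm_ring_1 lin_op \<Rightarrow> 'k" where
  "op_trace \<Omega> A = (\<Sum>a\<in>\<Omega>. app A (kron a) a)"

text \<open>Equivalently, \<open>A\<close> preserves the functions that vanish on
  \<open>\<Omega>\<close>; so it acts on functions on \<open>\<Omega>\<close>, by the block of its
  matrix with indices in \<open>\<Omega>\<close>.\<close>

definition restricts :: "(nat \<Rightarrow> nat) set \<Rightarrow> 'k::comm_ring_1 lin_op \<Rightarrow> bool" where
  "restricts \<Omega> A \<longleftrightarrow> (\<forall>f g. (\<forall>b\<in>\<Omega>. f b = g b) \<longrightarrow> (\<forall>a\<in>\<Omega>. app A f a = app A g a))"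

lemma restrictsD: "restricts \<Omega> A \<Longrightarrow> (\<And>b. b \<in> \<Omega> \<Longrightarrow> f b = g b) \<Longrightarrow> a \<in> \<Omega> \<Longrightarrow> app A f a = app A g a"
  unfolding restricts_def by blast

lemma restrictsI:
  "(\<And>f g a. (\<And>b. b \<in> \<Omega> \<Longrightarrow> f b = g b) \<Longrightarrow> a \<in> \<Omega> \<Longrightarrow> app A f a = app A g a) \<Longrightarrow> restricts \<Omega> A"
  unfolding restricts_def by blast

lemma restricts_mult [intro]:
  assumes "restricts \<Omega> A" "restricts \<Omega> B"
  shows "restricts \<Omega> (A * B)"
proof (rule restrictsI)
  fix f g :: "_ \<Rightarrow> 'a" and a assume "\<And>b. b \<in> \<Omega> \<Longrightarrow> f b = g b" "a \<in> \<Omega>"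
  then show "app (A * B) f a = app (A * B) g a"
    unfolding app_mult by (intro restrictsD[OF assms(1)] restrictsD[OF assms(2)])
qed

lemma restricts_add [intro]:
  assumes "restricts \<Omega> A" "restricts \<Omega> B"
  shows "restricts \<Omega> (A + B)"
proof (rule restrictsI)
  fix f g :: "_ \<Rightarrow> 'a" and a assume "\<And>b. b \<in> \<Omega> \<Longrightarrow> f b = g b" "a \<in> \<Omega>"
  then show "app (A + B) f a = app (A + B) g a"
    unfolding app_add by (intro arg_cong2[of _ _ _ _ "(+)"] restrictsD[OF assms(1)] restrictsD[OF assms(2)])
qed

lemma restricts_uminus [intro]:
  assumes "restricts \<Omega> A"
  shows "restricts \<Omega> (- A)"
proof (rule restrictsI)
  fix f g :: "_ \<Rightarrow> 'a" and a assume "\<And>b. b \<in> \<Omega> \<Longrightarrow> f b = g b" "a \<in> \<Omega>"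
  then show "app (- A) f a = app (- A) g a"
    unfolding app_uminus by (intro arg_cong[of _ _ uminus] restrictsD[OF assms])
qed

lemma restricts_diff [intro]: "restricts \<Omega> A \<Longrightarrow> restricts \<Omega> B \<Longrightarrow> restricts \<Omega> (A - B)"
  using restricts_add[of \<Omega> A "- B"] by auto

lemma restricts_scalar [intro, simp]: "restricts \<Omega> (scalar_op c)"
  by (rule restrictsI) simp

lemma restricts_one [intro, simp]: "restricts \<Omega> 1"
  by (rule restrictsI) simp

lemma restricts_power [intro]: "restricts \<Omega> A \<Longrightarrow> restricts \<Omega> (A ^ p)"
  by (induction p) auto

lemma restricts_hop:
  assumes "\<And>a. a \<in> \<Omega> \<Longrightarrow> a \<circ> transpose i (Suc i) \<in> \<Omega>"
  shows "restricts \<Omega> (hop_op q i)"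
  using assms by (auto simp: restricts_def hop_def)

lemma app_sum: "finite S \<Longrightarrow> app A (\<lambda>x. \<Sum>b\<in>S. f b * g b x) x = (\<Sum>b\<in>S. f b * app A (g b) x)"
proof (induction S rule: finite_induct)
  case empty
  then show ?case using app_scale[of A 0 "\<lambda>_. 0"] by simp
next
  case (insert b S)
  then show ?case by (simp add: app_plus app_scale)
qed

lemma app_kron_expand:
  assumes "finite \<Omega>" "restricts \<Omega> A" "a \<in> \<Omega>"
  shows "app A f a = (\<Sum>b\<in>\<Omega>. f b * app A (kron b) a)"
proof -
  have "app A f a = app A (\<lambda>x. \<Sum>b\<in>\<Omega>. f b * kron b x) a"
    by (rule restrictsD[OF assms(2) _ assms(3)])
       (use assms(1) in \<open>simp add: kron_def if_distrib[of "(*) _"] cong: if_cong\<close>)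
  then show ?thesis using assms(1) by (simp add: app_sum)
qed

lemma app_kron_mult:
  assumes "finite \<Omega>" "restricts \<Omega> A" "a \<in> \<Omega>"
  shows "app (A * B) f a = (\<Sum>b\<in>\<Omega>. app A (kron b) a * app B f b)"
  by (simp add: app_kron_expand[OF assms, of "app B f"] mult.commute)

lemma op_trace_commute:
  assumes "finite \<Omega>" "restricts \<Omega> A" "restricts \<Omega> B"
  shows "op_trace \<Omega> (A * B) = op_trace \<Omega> (B * A)"
proof -
  have "op_trace \<Omega> (A * B) = (\<Sum>a\<in>\<Omega>. \<Sum>b\<in>\<Omega>. app A (kron b) a * app B (kron a) b)"
    unfolding op_trace_def using assms by (intro sum.cong app_kron_mult) auto
  also have "\<dots> = (\<Sum>b\<in>\<Omega>. \<Sum>a\<in>\<Omega>. app B (kron a) b * app A (kron b) a)"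
    by (subst sum.swap) (simp add: mult.commute)
  also have "\<dots> = op_trace \<Omega> (B * A)"
    unfolding op_trace_def using assms by (intro sum.cong app_kron_mult[symmetric]) auto
  finally show ?thesis .
qed

lemma upper_triangular_mult:
  fixes A B :: "'a::semiring_0 mat"
  assumes "A \<in> carrier_mat n n" "B \<in> carrier_mat n n" "upper_triangular A" "upper_triangular B"
  shows "upper_triangular (A * B)" "i < n \<Longrightarrow> (A * B) $$ (i, i) = A $$ (i, i) * B $$ (i, i)"
proof -
  have e: "(A * B) $$ (i, j) = (\<Sum>k<n. A $$ (i, k) * B $$ (k, j))" if "i < n" "j < n" for i j
    using assms that by (simp add: scalar_prod_def lessThan_atLeast0)
  have z: "A $$ (i, k) = 0" "B $$ (i, k) = 0" if "k < i" "i < n" for i k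
    using assms that by (auto dest: upper_triangularD)
  have "(\<Sum>k<n. A $$ (i, k) * B $$ (k, j)) = 0" if "i < n" "j < i" for i j
  proof (rule sum.neutral, rule ballI)
    fix k assume "k \<in> {..<n}"
    then show "A $$ (i, k) * B $$ (k, j) = 0"
      using z(1)[of k i] z(2)[of j k] that by (cases "k < i") auto
  qed
  then show "upper_triangular (A * B)" using assms e by (intro upper_triangularI) auto
  assume i: "i < n"
  have "(\<Sum>k<n. A $$ (i, k) * B $$ (k, i)) = (\<Sum>k<n. if k = i then A $$ (i, i) * B $$ (i, i) else 0)"
  proof (intro sum.cong refl)
    fix k assume "k \<in> {..<n}"
    then show "A $$ (i, k) * B $$ (k, i) = (if k = i then A $$ (i, i) * B $$ (i, i) else 0)"
      using z(1)[of k i] z(2)[of i k] i by (cases "k < i"; cases "k = i") auto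
  qed
  then show "(A * B) $$ (i, i) = A $$ (i, i) * B $$ (i, i)" using e i by simp
qed

text \<open>The matrix of \<open>A\<close> on \<open>\<Omega>\<close> is triangularised by a Schur
  decomposition, and \<open>es\<close> is the diagonal. Diagonals of triangular matrices multiply
  and subtract entrywise, so one list serves all powers and every annihilating product.\<close>

lemma op_trace_eigenvalues:
  fixes A :: "complex lin_op"
  assumes "finite \<Omega>" and "restricts \<Omega> A"
  obtains es where "length es = card \<Omega>" and "\<And>p. op_trace \<Omega> (A ^ p) = (\<Sum>e\<leftarrow>es. e ^ p)"
    and "\<And>m cs. (\<And>a b. a \<in> \<Omega> \<Longrightarrow> b \<in> \<Omega> \<Longrightarrow> app (\<Prod>c\<leftarrow>cs. A ^ m - scalar_op c) (kron b) a = 0)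
      \<Longrightarrow> \<forall>e\<in>set es. (\<Prod>c\<leftarrow>cs. e ^ m - c) = 0"
proof -
  define n where "n = card \<Omega>"
  obtain xs where xs: "distinct xs" "set xs = \<Omega>"
    using finite_distinct_list[OF assms(1)] by auto
  have len: "length xs = n" using xs distinct_card n_def by fastforce
  have sum\<Omega>: "(\<Sum>b\<in>\<Omega>. f b) = (\<Sum>i<n. f (xs ! i))" for f :: "_ \<Rightarrow> complex"
    using sum.reindex_bij_betw[OF bij_betw_nth[OF xs(1) refl xs(2)[symmetric]], of f] len by simp
  define M where "M X = mat n n (\<lambda>(i, j). app X (kron (xs ! j)) (xs ! i))" for X :: "complex lin_op"
  have MC: "M X \<in> carrier_mat n n" for X by (simp add: M_def)
  have M_mult: "M (X * Y) = M X * M Y" if "restricts \<Omega> X" for X Y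
  proof (rule eq_matI)
    fix i j assume "i < dim_row (M X * M Y)" "j < dim_col (M X * M Y)"
    then have ij: "i < n" "j < n" by (auto simp: M_def)
    then have "xs ! i \<in> \<Omega>" using xs len by auto
    from app_kron_mult[OF assms(1) that this, of Y]
    show "M (X * Y) $$ (i, j) = (M X * M Y) $$ (i, j)"
      using ij by (simp add: M_def scalar_prod_def sum\<Omega> lessThan_atLeast0)
  qed (auto simp: M_def)
  have nth_eq: "xs ! i = xs ! j \<longleftrightarrow> i = j" if "i < n" "j < n" for i j
    using xs len that nth_eq_iff_index_eq by blast
  obtain es where es: "char_poly (M A) = (\<Prod>a\<leftarrow>es. [:- a, 1:])" "length es = n"
    using char_poly_factorized[OF MC] by blast
  obtain B P Q where "schur_decomposition (M A) es = (B, P, Q)" by (metis prod_cases3)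
  from schur_decomposition[OF MC es(1) this]
  have sim: "similar_mat_wit (M A) B P Q" and ut: "upper_triangular B" and diag: "diag_mat B = es" by auto
  note w = similar_mat_witD2[OF MC sim]
  \<comment> \<open>In the Schur basis \<open>X\<close> becomes upper triangular with diagonal
    \<open>y\<close>; this property is compatible with the ring operations.\<close>
  define rel where "rel X y \<longleftrightarrow> restricts \<Omega> X \<and> (\<exists>Y\<in>carrier_mat n n. upper_triangular Y \<and>
     (\<forall>i<n. Y $$ (i, i) = y i) \<and> M X = P * Y * Q)" for X y
  have QP: "Q * (P * X) = X" if "X \<in> carrier_mat n n" for X
    using assoc_mult_mat[OF w(7) w(6) that] w(2) that by simp
  note [simp] = assoc_mult_mat[of _ n n _ n _ n]
  have rel_mult: "rel (X * X') (\<lambda>i. y i * y' i)" if X: "rel X y" "rel X' y'" for X X' y y'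
  proof -
    obtain Y where Y: "Y \<in> carrier_mat n n" "upper_triangular Y" "\<forall>i<n. Y $$ (i, i) = y i" "M X = P * Y * Q"
      using X(1) unfolding rel_def by blast
    obtain Y' where Y': "Y' \<in> carrier_mat n n" "upper_triangular Y'" "\<forall>i<n. Y' $$ (i, i) = y' i" "M X' = P * Y' * Q"
      using X(2) unfolding rel_def by blast
    have "P * Y * Q * (P * Y' * Q) = P * (Y * Y') * Q"
      using w(4-7) Y(1) Y'(1) by (simp add: QP)
    then have "M (X * X') = P * (Y * Y') * Q" using M_mult X Y Y' by (simp add: rel_def)
    then show ?thesis unfolding rel_def using X Y Y' upper_triangular_mult[OF Y(1) Y'(1) Y(2) Y'(2)]
      by (intro conjI bexI[of _ "Y * Y'"]) (auto simp: rel_def)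
  qed
  have rel_scalar: "rel (scalar_op c) (\<lambda>i. c)" for c
  proof -
    have "M (scalar_op c) = c \<cdot>\<^sub>m 1\<^sub>m n"
      by (rule eq_matI) (auto simp: M_def kron_def nth_eq)
    also have "\<dots> = P * (c \<cdot>\<^sub>m 1\<^sub>m n) * Q"
      using w by (simp add: mult_smult_distrib[of _ n n _ n] mult_smult_assoc_mat[of _ n n _ n])
    finally show ?thesis unfolding rel_def
      by (intro conjI bexI[of _ "c \<cdot>\<^sub>m 1\<^sub>m n"]) auto
  qed
  have rel_diff: "rel (X - X') (\<lambda>i. y i - y' i)" if X: "rel X y" "rel X' y'" for X X' y y'
  proof -
    obtain Y where Y: "Y \<in> carrier_mat n n" "upper_triangular Y" "\<forall>i<n. Y $$ (i, i) = y i" "M X = P * Y * Q"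
      using X(1) unfolding rel_def by blast
    obtain Y' where Y': "Y' \<in> carrier_mat n n" "upper_triangular Y'" "\<forall>i<n. Y' $$ (i, i) = y' i" "M X' = P * Y' * Q"
      using X(2) unfolding rel_def by blast
    have "M (X - X') = M X - M X'" by (rule eq_matI) (auto simp: M_def)
    also have "\<dots> = P * (Y - Y') * Q"
      using w Y Y' by (simp add: mult_minus_distrib_mat[of _ n n _ n] minus_mult_distrib_mat[of _ n n _ _ n])
    finally have M: "M (X - X') = P * (Y - Y') * Q" .
    have "upper_triangular (Y - Y')"
    proof (rule upper_triangularI)
      fix i j assume "i < dim_row (Y - Y')" "j < i"
      then show "(Y - Y') $$ (i, j) = 0"
        using Y Y' upper_triangularD[of Y j i] upper_triangularD[of Y' j i] by auto
    qed
    moreover have "\<forall>i<n. (Y - Y') $$ (i, i) = y i - y' i" using Y Y' by simp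
    moreover have "Y - Y' \<in> carrier_mat n n" by (rule minus_carrier_mat[OF Y'(1)])
    moreover have "restricts \<Omega> (X - X')" using X by (auto simp: rel_def)
    ultimately show ?thesis unfolding rel_def using M by blast
  qed
  have rel_A: "rel A (\<lambda>i. es ! i)"
  proof -
    have "\<forall>i<n. B $$ (i, i) = es ! i" using diag w by (auto simp: diag_mat_def)
    then show ?thesis unfolding rel_def using assms w ut by (intro conjI bexI[of _ B]) auto
  qed
  have one: "scalar_op 1 = (1 :: complex lin_op)" by (rule lin_op_eqI) simp
  have rel_pow: "rel (A ^ p) (\<lambda>i. es ! i ^ p)" for p
    by (induction p) (use rel_scalar[of 1] one rel_mult[OF rel_A] in auto)
  have rel_trace: "op_trace \<Omega> X = (\<Sum>i<n. y i)" if X: "rel X y" for X y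
  proof -
    obtain Y where Y: "Y \<in> carrier_mat n n" "\<forall>i<n. Y $$ (i, i) = y i" "M X = P * Y * Q"
      using X unfolding rel_def by blast
    have tr: "(\<Sum>i<n. (C * D) $$ (i, i)) = (\<Sum>i<n. (D * C) $$ (i, i))"
      if "C \<in> carrier_mat n n" "D \<in> carrier_mat n n" for C D :: "complex mat"
    proof -
      have "(\<Sum>i<n. (C * D) $$ (i, i)) = (\<Sum>i<n. \<Sum>k<n. C $$ (i, k) * D $$ (k, i))"
        using that by (simp add: scalar_prod_def lessThan_atLeast0)
      also have "\<dots> = (\<Sum>k<n. \<Sum>i<n. D $$ (k, i) * C $$ (i, k))"
        by (subst sum.swap) (simp add: mult.commute)
      also have "\<dots> = (\<Sum>i<n. (D * C) $$ (i, i))"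
        using that by (simp add: scalar_prod_def lessThan_atLeast0)
      finally show ?thesis .
    qed
    note w = w(1,2,4-7)
    have "op_trace \<Omega> X = (\<Sum>i<n. (M X) $$ (i, i))" by (simp add: op_trace_def sum\<Omega> M_def)
    also have "\<dots> = (\<Sum>i<n. (P * (Y * Q)) $$ (i, i))" using Y w by simp
    also have "\<dots> = (\<Sum>i<n. (Y * (Q * P)) $$ (i, i))" using Y w by (subst tr) auto
    also have "\<dots> = (\<Sum>i<n. y i)" unfolding w(2) using Y by simp
    finally show ?thesis .
  qed
  have sum_es: "(\<Sum>e\<leftarrow>es. f e) = (\<Sum>i<n. f (es ! i))" for f :: "complex \<Rightarrow> complex"
    using es(2) by (simp add: sum_list_sum_nth lessThan_atLeast0)
  show thesis
  proof (rule that)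
    show "length es = card \<Omega>" using es n_def by simp
    show "op_trace \<Omega> (A ^ p) = (\<Sum>e\<leftarrow>es. e ^ p)" for p
      using rel_trace[OF rel_pow[of p]] by (simp add: sum_es)
    fix m cs
    assume z: "\<And>a b. a \<in> \<Omega> \<Longrightarrow> b \<in> \<Omega> \<Longrightarrow> app (\<Prod>c\<leftarrow>cs. A ^ m - scalar_op c) (kron b) a = 0"
    have "rel (\<Prod>c\<leftarrow>cs. A ^ m - scalar_op c) (\<lambda>i. \<Prod>c\<leftarrow>cs. es ! i ^ m - c)"
      by (induction cs) (use rel_scalar[of 1] one in \<open>auto intro!: rel_mult rel_diff rel_pow rel_scalar\<close>)
    then obtain Y where Y: "Y \<in> carrier_mat n n" "\<forall>i<n. Y $$ (i, i) = (\<Prod>c\<leftarrow>cs. es ! i ^ m - c)"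
      "M (\<Prod>c\<leftarrow>cs. A ^ m - scalar_op c) = P * Y * Q"
      unfolding rel_def by blast
    have "M (\<Prod>c\<leftarrow>cs. A ^ m - scalar_op c) = 0\<^sub>m n n"
      by (rule eq_matI) (use xs len in \<open>auto simp: M_def intro!: z\<close>)
    moreover have "Q * (P * Y * Q) * P = Y" using w(2,4-7) Y(1) by (simp add: QP)
    ultimately have "Y = 0\<^sub>m n n"
      using Y(3) left_mult_zero_mat[OF w(6), of n] right_mult_zero_mat[OF w(7), of n] by simp
    then show "\<forall>e\<in>set es. (\<Prod>c\<leftarrow>cs. e ^ m - c) = 0"
      using Y(2) es(2) by (auto simp: in_set_conv_nth)
  qed
qed

text \<open>Change of scalars: \<open>A\<close> specialises to \<open>B\<close> along
  \<open>\<phi>\<close>. The relation respects products, differences and the generators, so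
  identities over polynomials in \<open>q\<close> pass to every value of \<open>q\<close>.\<close>

definition transports :: "('a::comm_ring_1 \<Rightarrow> 'b::comm_ring_1) \<Rightarrow> 'a lin_op \<Rightarrow> 'b lin_op \<Rightarrow> bool" where
  "transports \<phi> A B \<longleftrightarrow> (\<forall>f a. \<phi> (app A f a) = app B (\<lambda>b. \<phi> (f b)) a)"

context comm_ring_hom
begin

lemma transports_mult: "transports hom A B \<Longrightarrow> transports hom A' B' \<Longrightarrow> transports hom (A * A') (B * B')"
  and transports_diff: "transports hom A B \<Longrightarrow> transports hom A' B' \<Longrightarrow> transports hom (A - A') (B - B')"
  and transports_one: "transports hom 1 1"
  and transports_scalar: "transports hom (scalar_op c) (scalar_op (hom c))"
  and transports_hop: "transports hom (hop_op c i) (hop_op (hom c) i)"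
  by (auto simp: transports_def hop_def hom_distribs)

lemma transports_power: "transports hom A B \<Longrightarrow> transports hom (A ^ p) (B ^ p)"
  by (induction p) (auto intro: transports_one transports_mult)

lemma transports_kron: "transports hom A B \<Longrightarrow> hom (app A (kron b) a) = app B (kron b) a"
  by (auto simp: transports_def kron_def fun_eq_iff intro!: arg_cong2[of _ _ _ _ "app B"])

lemma transports_op_trace: "transports hom A B \<Longrightarrow> hom (op_trace \<Omega> A) = op_trace \<Omega> B"
  by (simp add: op_trace_def hom_sum transports_kron)

lemma transports_prod_list:
  "(\<And>k. transports hom (f k) (g k)) \<Longrightarrow> transports hom (\<Prod>k\<leftarrow>ks. f k) (\<Prod>k\<leftarrow>ks. g k)"
  by (induction ks) (auto intro: transports_one transports_mult)

end

lemma comm_ring_hom_poly_of_int: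
  "comm_ring_hom (\<lambda>P. poly (of_int_poly P) x :: 'a::comm_ring_1)"
  by unfold_locales (simp_all add: hom_distribs)

abbreviation coxeter_op :: "'k::comm_ring_1 \<Rightarrow> nat \<Rightarrow> 'k lin_op" where
  "coxeter_op q \<equiv> hecke_relations.coxeter_prod (hop_op q)"

lemma (in comm_ring_hom) transports_coxeter_op: "transports hom (coxeter_op c m) (coxeter_op (hom c) m)"
  by (induction m) (auto intro: transports_one transports_mult transports_hop)

definition place_closed :: "nat \<Rightarrow> (nat \<Rightarrow> nat) set \<Rightarrow> bool" where
  "place_closed m \<Omega> \<longleftrightarrow> (\<forall>a\<in>\<Omega>. \<forall>i\<in>{1..m}. a \<circ> transpose i (Suc i) \<in> \<Omega>)"

lemma restricts_hop_closed: "place_closed m \<Omega> \<Longrightarrow> 1 \<le> i \<Longrightarrow> i \<le> m \<Longrightarrow> restricts \<Omega> (hop_op q i)"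
  by (rule restricts_hop) (auto simp: place_closed_def)

lemma place_closed_mono: "place_closed m \<Omega> \<Longrightarrow> k \<le> m \<Longrightarrow> place_closed k \<Omega>"
  by (auto simp: place_closed_def)

lemma restricts_coxeter_op: "place_closed m \<Omega> \<Longrightarrow> restricts \<Omega> (coxeter_op q m)"
proof (induction m)
  case (Suc m)
  then show ?case
    using restricts_hop_closed[OF Suc.prems, of "Suc m" q] place_closed_mono[OF Suc.prems, of m] by auto
qed simp

text \<open>With \<open>q\<close> an indeterminate the trace is an integer polynomial, which gives a
  meaning to congruences modulo primes and can be evaluated in every commutative ring.\<close>

definition coxeter_trace :: "nat \<Rightarrow> (nat \<Rightarrow> nat) set \<Rightarrow> nat \<Rightarrow> int poly" where
  "coxeter_trace m \<Omega> p = op_trace \<Omega> (coxeter_op [:0, 1:] m ^ p)"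

text \<open>The full twist has only powers of \<open>q\<close> as eigenvalues, so at
  \<open>q = x ^ n\<close> an eigenvalue of the Coxeter element is a root of unity times a power of
  \<open>x\<close>. Which ones occur could depend on \<open>x\<close>; by pigeonhole one list is
  valid for infinitely many integers \<open>x\<close>, hence as a polynomial identity.\<close>

lemma coxeter_trace_eigenvalues:
  assumes fin: "finite \<Omega>" and closed: "place_closed m \<Omega>"
  obtains zs :: "(complex \<times> nat) list" where "length zs = card \<Omega>"
    and "\<And>\<zeta> k. (\<zeta>, k) \<in> set zs \<Longrightarrow> \<zeta> ^ Suc m = 1"
    and "\<And>p. of_int_poly (coxeter_trace m \<Omega> p) \<circ>\<^sub>p monom 1 (Suc m)
               = (\<Sum>(\<zeta>, k)\<leftarrow>zs. monom (\<zeta> ^ p) (k * p))"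
proof -
  define n where "n = Suc m"
  define C where "C = coxeter_op [:0, 1 :: int:] m"
  have "central_element.q_split (scalar_op [:0, 1 :: int:]) (C ^ n)"
    unfolding C_def n_def
  proof (rule hops.q_split_coxeter_prod)
    fix A :: "int poly lin_op" assume "scalar_op [:0, 1:] * A = 0"
    then have "[:0, 1:] * app A f a = 0" for f a
      by (metis app_mult app_scalar_op app_zero)
    then show "A = 0" by (intro lin_op_eqI) simp
  qed
  then obtain ks where ks: "(\<Prod>k\<leftarrow>ks. C ^ n - scalar_op [:0, 1:] ^ k) = 0"
    unfolding hops.q_split_def by blast
  \<comment> \<open>Only finitely many candidate lists arise, since the exponents come from the
    fixed list \<open>ks\<close>.\<close>
  define S where "S = {zs. set zs \<subseteq> {\<zeta> :: complex. \<zeta> ^ n = 1} \<times> set ks \<and> length zs = card \<Omega>}"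
  define R where "R x zs \<longleftrightarrow> (\<forall>p. poly (of_int_poly (coxeter_trace m \<Omega> p)) (of_nat x ^ n)
     = (\<Sum>(\<zeta>, k)\<leftarrow>zs. \<zeta> ^ p * of_nat x ^ (k * p)))" for x :: nat and zs :: "(complex \<times> nat) list"
  have ex: "\<exists>zs\<in>S. R x zs" if "x \<ge> 1" for x
  proof -
    define y where "y = (of_nat x :: complex)"
    have y: "y \<noteq> 0" using that by (simp add: y_def)
    interpret \<phi>: comm_ring_hom "\<lambda>P. poly (of_int_poly P) (y ^ n) :: complex"
      by (rule comm_ring_hom_poly_of_int)
    define D where "D = coxeter_op (y ^ n) m"
    have CD: "transports (\<lambda>P. poly (of_int_poly P) (y ^ n)) C D"
      using \<phi>.transports_coxeter_op[of "[:0, 1:]" m] by (simp add: C_def D_def)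
    have "restricts \<Omega> D" unfolding D_def by (rule restricts_coxeter_op[OF closed])
    from op_trace_eigenvalues[OF fin this] obtain es where es: "length es = card \<Omega>"
      "\<And>p. op_trace \<Omega> (D ^ p) = (\<Sum>e\<leftarrow>es. e ^ p)"
      "\<And>m cs. (\<And>a b. a \<in> \<Omega> \<Longrightarrow> b \<in> \<Omega> \<Longrightarrow> app (\<Prod>c\<leftarrow>cs. D ^ m - scalar_op c) (kron b) a = 0)
      \<Longrightarrow> \<forall>e\<in>set es. (\<Prod>c\<leftarrow>cs. e ^ m - c) = 0" by blast
    have sc: "transports (\<lambda>P. poly (of_int_poly P) (y ^ n)) (scalar_op [:0, 1:] ^ k) (scalar_op ((y ^ n) ^ k))" for k
      using \<phi>.transports_power[OF \<phi>.transports_scalar[of "[:0, 1:]"], of k] by (simp add: scalar_op_power)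
    have "transports (\<lambda>P. poly (of_int_poly P) (y ^ n)) (\<Prod>k\<leftarrow>ks. C ^ n - scalar_op [:0, 1:] ^ k)
       (\<Prod>k\<leftarrow>ks. D ^ n - scalar_op ((y ^ n) ^ k))"
      by (intro \<phi>.transports_prod_list \<phi>.transports_diff \<phi>.transports_power CD sc)
    from \<phi>.transports_kron[OF this] have "app (\<Prod>k\<leftarrow>ks. D ^ n - scalar_op ((y ^ n) ^ k)) (kron b) a = 0" for a b
      by (simp add: ks)
    then have "\<forall>e\<in>set es. (\<Prod>c\<leftarrow>map (\<lambda>k. (y ^ n) ^ k) ks. e ^ n - c) = 0"
      by (intro es(3)) (simp add: o_def)
    then have "\<forall>e\<in>set es. \<exists>k\<in>set ks. e ^ n = (y ^ n) ^ k"
      by (force simp: prod_list_zero_iff o_def)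
    then obtain \<kappa> where \<kappa>: "\<And>e. e \<in> set es \<Longrightarrow> \<kappa> e \<in> set ks \<and> e ^ n = (y ^ n) ^ \<kappa> e" by metis
    \<comment> \<open>As \<open>e ^ n = (y ^ n) ^ \<kappa> e\<close>, dividing by
      \<open>y ^ \<kappa> e\<close> leaves an \<open>n\<close>-th root of unity.\<close>
    define zs where "zs = map (\<lambda>e. (e / y ^ \<kappa> e, \<kappa> e)) es"
    have "(e / y ^ \<kappa> e) ^ n = 1" if "e \<in> set es" for e
      using \<kappa>[OF that] y by (simp add: power_divide power_mult[symmetric] mult.commute)
    then have "zs \<in> S" using \<kappa> es(1) by (auto simp: S_def zs_def)
    moreover have "R x zs" unfolding R_def y_def[symmetric]
    proof
      fix p
      have "poly (of_int_poly (coxeter_trace m \<Omega> p)) (y ^ n) = op_trace \<Omega> (D ^ p)"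
        unfolding coxeter_trace_def C_def[symmetric] by (intro \<phi>.transports_op_trace \<phi>.transports_power CD)
      also have "\<dots> = (\<Sum>(\<zeta>, k)\<leftarrow>zs. \<zeta> ^ p * y ^ (k * p))"
        using y by (simp add: es zs_def o_def power_divide power_mult)
      finally show "poly (of_int_poly (coxeter_trace m \<Omega> p)) (y ^ n) = (\<Sum>(\<zeta>, k)\<leftarrow>zs. \<zeta> ^ p * y ^ (k * p))" .
    qed
    ultimately show ?thesis by blast
  qed
  have "finite {\<zeta> :: complex. \<zeta> ^ n = 1}"
    by (rule finite_roots_unity) (simp add: n_def)
  then have "finite S" unfolding S_def by (intro finite_lists_length_eq) auto
  from pigeonhole_infinite_rel[OF infinite_Ici[of "1::nat"] this, of R] ex
  obtain zs where zs: "zs \<in> S" and inf: "infinite {x \<in> {1..}. R x zs}" by auto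
  show thesis
  proof (rule that[of zs])
    show "length zs = card \<Omega>" "\<And>\<zeta> k. (\<zeta>, k) \<in> set zs \<Longrightarrow> \<zeta> ^ Suc m = 1"
      using zs by (auto simp: S_def n_def)
    fix p
    let ?L = "of_int_poly (coxeter_trace m \<Omega> p) \<circ>\<^sub>p monom 1 (Suc m) :: complex poly"
    let ?M = "\<Sum>(\<zeta>, k)\<leftarrow>zs. monom (\<zeta> ^ p) (k * p)"
    have M: "poly (\<Sum>(\<zeta>, k)\<leftarrow>xs. monom (\<zeta> ^ p) (k * p)) y = (\<Sum>(\<zeta>, k)\<leftarrow>xs. \<zeta> ^ p * y ^ (k * p))"
      for y :: complex and xs by (induction xs) (auto simp: poly_monom)
    have "of_nat ` {x \<in> {1..}. R x zs} \<subseteq> {y. poly (?L - ?M) y = 0}"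
      by (auto simp: R_def M poly_pcompose poly_monom n_def)
    moreover have "infinite (of_nat ` {x \<in> {1..}. R x zs} :: complex set)"
      using inf by (subst finite_image_iff) (auto simp: inj_on_def)
    ultimately have "infinite {y. poly (?L - ?M) y = 0}" using finite_subset by blast
    then have "?L - ?M = 0" using poly_roots_finite by blast
    then show "?L = ?M" by simp
  qed
qed

section \<open>Traces modulo primes\<close>

lemma dvd_diff_sum:
  fixes m :: "'a::comm_ring_1"
  shows "(\<And>x. x \<in> S \<Longrightarrow> m dvd f x - g x) \<Longrightarrow> m dvd sum f S - sum g S"
  by (simp add: dvd_sum flip: sum_subtractf)

text \<open>If two rotations agreed, the list would be fixed by rotation through
  \<open>j - i\<close> places, a number prime to the length, and by Bezout also by a single
  rotation.\<close>

lemma rotations_distinct: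
  assumes l: "prime (length xs)" and nc: "rotate1 xs \<noteq> xs"
  shows "inj_on (\<lambda>k. rotate k xs) {..<length xs}"
proof (rule linorder_inj_onI)
  fix i j assume ij: "i < j" "i \<in> {..<length xs}" "j \<in> {..<length xs}"
  show "rotate i xs \<noteq> rotate j xs"
  proof
    assume "rotate i xs = rotate j xs"
    then have "rotate (length xs - i) (rotate i xs) = rotate (length xs - i) (rotate j xs)" by simp
    moreover have "length xs - i + j = length xs + (j - i)" using ij by simp
    moreover have "rotate (length xs + (j - i)) xs = rotate (j - i) xs"
      by (subst (1 2) rotate_conv_mod) simp
    ultimately have fixed: "rotate (j - i) xs = xs" using ij by (simp add: rotate_rotate)
    have "rotate (t * (j - i)) xs = xs" for t
      by (induction t) (simp_all add: fixed flip: rotate_rotate)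
    moreover have "coprime (j - i) (length xs)"
      using ij l by (metis coprime_commute dvd_imp_le less_imp_diff_less lessThan_iff linorder_not_less
        prime_imp_coprime zero_less_diff)
    then obtain t u where "(j - i) * t = length xs * u + 1"
      using bezout_nat[of "j - i" "length xs"] ij by auto
    then have "rotate (t * (j - i)) xs = rotate 1 xs"
      using rotate_conv_mod[of "t * (j - i)" xs] rotate_conv_mod[of 1 xs] by (simp add: mult.commute)
    ultimately show False using nc by simp
  qed
qed auto

text \<open>The lists that are not fixed by rotation fall into orbits of exactly \<open>l\<close>
  lists of equal weight and vanish modulo \<open>l\<close>; the fixed lists are constant.\<close>

lemma sum_cyclic_lists_mod_prime:
  fixes W :: "'a list \<Rightarrow> 'k::comm_ring_1"
  assumes l: "prime l" and fin: "finite X" and rot: "\<And>xs. W (rotate1 xs) = W xs"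
  shows "of_nat l dvd (\<Sum>xs | set xs \<subseteq> X \<and> length xs = l. W xs) - (\<Sum>a\<in>X. W (replicate l a))"
proof -
  define L where "L = {xs. set xs \<subseteq> X \<and> length xs = l}"
  define N where "N = {xs \<in> L. rotate1 xs \<noteq> xs}"
  define orb where "orb xs = range (\<lambda>k. rotate k xs)" for xs :: "'a list"
  have finL: "finite L" unfolding L_def by (rule finite_lists_length_eq[OF fin])
  have lpos: "l > 0" using l by (rule prime_gt_0_nat)
  have const: "L - N = replicate l ` X"
  proof (intro equalityI subsetI)
    fix xs assume "xs \<in> L - N"
    then have *: "rotate1 xs = xs" "set xs \<subseteq> X" "length xs = l" by (auto simp: N_def L_def)
    with lpos have "card (set xs) = 1" using rotate1_fixpoint_card by fastforce
    then obtain a where "set xs = {a}" by (auto simp: card_1_singleton_iff)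
    with * have "xs = replicate l a" "a \<in> X" by (auto intro!: replicate_eqI)
    then show "xs \<in> replicate l ` X" by blast
  qed (auto simp: N_def L_def)
  have "inj_on (replicate l) X" using lpos by (auto simp: inj_on_def)
  then have "sum W L = (\<Sum>a\<in>X. W (replicate l a)) + sum W N"
    using sum.subset_diff[of N L W] finL const by (auto simp: N_def sum.reindex o_def)
  moreover have "of_nat l dvd sum W N"
  proof -
    have "of_nat l dvd (\<Sum>xs\<in>{xs \<in> N. orb xs = O'}. W xs)" if O': "O' \<in> orb ` N" for O'
    proof -
      obtain xs where xs: "xs \<in> N" "O' = orb xs" using O' by blast
      have len: "length xs = l" using xs by (simp add: N_def L_def)
      have orb_eq: "orb (rotate k xs) = orb xs" for k xs
      proof (cases "xs = []")
        case False
        have "rotate j xs = rotate (j + (length xs * k - k)) (rotate k xs)" for j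
        proof -
          have "k \<le> length xs * k" using False by (cases xs) auto
          then have "j + (length xs * k - k) + k = j + length xs * k"
            by (simp only: add.assoc le_add_diff_inverse2)
          then have "rotate (j + (length xs * k - k)) (rotate k xs) = rotate (j + length xs * k) xs"
            by (simp only: rotate_rotate)
          also have "\<dots> = rotate j xs" by (subst (1 2) rotate_conv_mod) simp
          finally show ?thesis by simp
        qed
        then show ?thesis unfolding orb_def by (auto simp: rotate_rotate)
      qed (simp add: orb_def)
      have inN: "rotate k xs \<in> N" for k
      proof -
        have "rotate1 (rotate k xs) \<noteq> rotate k xs"
        proof
          assume "rotate1 (rotate k xs) = rotate k xs"
          then have fix1: "rotate (Suc k) xs = rotate k xs" by simp
          have "rotate (k + j) xs = rotate k xs" for j
            by (induction j) (simp, metis fix1 rotate_Suc add_Suc_right)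
          from this[of "l * k - k"] this[of "l * k - k + 1"]
          have "rotate (l * k) xs = rotate (Suc (l * k)) xs" using lpos by simp
          then show False using xs len by (simp add: N_def rotate_conv_mod[of "l * k"])
        qed
        then show ?thesis using xs by (simp add: N_def L_def)
      qed
      have cls: "{ys \<in> N. orb ys = orb xs} = orb xs"
      proof (intro equalityI subsetI)
        fix ys assume "ys \<in> {ys \<in> N. orb ys = orb xs}"
        moreover have "ys \<in> orb ys" unfolding orb_def by (rule range_eqI[of _ _ 0]) simp
        ultimately show "ys \<in> orb xs" by simp
      next
        fix ys assume "ys \<in> orb xs"
        then obtain k where "ys = rotate k xs" by (auto simp: orb_def)
        then show "ys \<in> {ys \<in> N. orb ys = orb xs}" using inN orb_eq by simp
      qed
      have "orb xs = (\<lambda>k. rotate k xs) ` {..<length xs}"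
      proof (intro equalityI subsetI)
        fix ys assume "ys \<in> orb xs"
        then obtain k where "ys = rotate (k mod length xs) xs"
          unfolding orb_def using rotate_conv_mod by blast
        then show "ys \<in> (\<lambda>k. rotate k xs) ` {..<length xs}" using len lpos by auto
      qed (auto simp: orb_def)
      moreover have "inj_on (\<lambda>k. rotate k xs) {..<length xs}"
        using rotations_distinct[of xs] xs len l by (simp add: N_def)
      ultimately have "card (orb xs) = l" by (simp add: card_image len)
      moreover have "W (rotate k xs) = W xs" for k
        by (induction k) (simp_all add: rot)
      then have "sum W (orb xs) = (\<Sum>ys\<in>orb xs. W xs)"
        by (intro sum.cong) (auto simp: orb_def)
      ultimately show ?thesis using cls xs by simp
    qed
    then have "of_nat l dvd (\<Sum>O'\<in>orb ` N. \<Sum>xs\<in>{xs \<in> N. orb xs = O'}. W xs)" by (rule dvd_sum)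
    also have "(\<Sum>O'\<in>orb ` N. \<Sum>xs\<in>{xs \<in> N. orb xs = O'}. W xs) = sum W N"
      using finL by (intro sum.image_gen[symmetric]) (simp add: N_def)
    finally show ?thesis .
  qed
  ultimately show ?thesis by (simp add: L_def)
qed

primrec path_weight :: "('a \<Rightarrow> 'a \<Rightarrow> 'k::comm_ring_1) \<Rightarrow> 'a \<Rightarrow> 'a list \<Rightarrow> 'a \<Rightarrow> 'k" where
  "path_weight E a [] b = E a b"
| "path_weight E a (x # xs) b = E a x * path_weight E x xs b"

lemma path_weight_snoc: "path_weight E a (xs @ [y]) b = path_weight E a xs y * E y b"
  by (induction xs arbitrary: a) (simp_all add: mult.assoc)

lemma app_power_kron_paths:
  assumes "finite \<Omega>" "restricts \<Omega> A" "a \<in> \<Omega>"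
  shows "app (A ^ Suc m) (kron b) a
    = (\<Sum>xs | set xs \<subseteq> \<Omega> \<and> length xs = m. path_weight (\<lambda>a b. app A (kron b) a) a xs b)"
  using assms(3)
proof (induction m arbitrary: a)
  case (Suc m)
  let ?w = "path_weight (\<lambda>a b. app A (kron b) a)"
  have "app (A ^ Suc (Suc m)) (kron b) a = (\<Sum>x\<in>\<Omega>. app A (kron x) a * app (A ^ Suc m) (kron b) x)"
    unfolding power_Suc[of A "Suc m"] by (rule app_kron_mult[OF assms(1,2) Suc.prems])
  also have "\<dots> = (\<Sum>x\<in>\<Omega>. \<Sum>xs | set xs \<subseteq> \<Omega> \<and> length xs = m. ?w a (x # xs) b)"
    by (intro sum.cong refl) (simp only: Suc.IH sum_distrib_left path_weight.simps)
  also have "\<dots> = (\<Sum>(xs, x)\<in>{xs. set xs \<subseteq> \<Omega> \<and> length xs = m} \<times> \<Omega>. ?w a (x # xs) b)"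
    by (subst sum.swap) (simp add: sum.cartesian_product)
  also have "\<dots> = (\<Sum>xs | set xs \<subseteq> \<Omega> \<and> length xs = Suc m. ?w a xs b)"
    unfolding lists_length_Suc_eq by (subst sum.reindex) (auto simp: inj_on_def case_prod_beta intro!: sum.cong)
  finally show ?case .
qed (simp cong: conj_cong)

text \<open>The trace of a power is a sum over closed walks, that is, over cyclic lists of indices;
  modulo a prime length only the constant walks survive, and these give the powers of diagonal
  entries.\<close>

lemma op_trace_prime_power:
  fixes A :: "'k::comm_ring_1 lin_op"
  assumes "finite \<Omega>" "restricts \<Omega> A" and l: "prime l"
  shows "of_nat l dvd op_trace \<Omega> (A ^ l) - (\<Sum>a\<in>\<Omega>. app A (kron a) a ^ l)"
proof -
  obtain m where m: "l = Suc m" using l by (metis not0_implies_Suc not_prime_0)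
  let ?E = "\<lambda>a b. app A (kron b) a"
  \<comment> \<open>The value at the empty list is a default: the lists that are summed have prime
    length.\<close>
  define W where "W xs = (case xs of [] \<Rightarrow> 0 | x # ys \<Rightarrow> path_weight ?E x ys x)" for xs
  have "W (rotate1 xs) = W xs" for xs
    by (cases xs; cases "tl xs") (auto simp: W_def path_weight_snoc mult.commute)
  moreover have "W (replicate l a) = ?E a a ^ l" for a
  proof -
    have "path_weight ?E a (replicate m a) a = ?E a a ^ Suc m" by (induction m) auto
    then show ?thesis by (simp add: W_def m)
  qed
  moreover have "(\<Sum>xs | set xs \<subseteq> \<Omega> \<and> length xs = l. W xs) = op_trace \<Omega> (A ^ l)"
  proof -
    have "(\<Sum>xs | set xs \<subseteq> \<Omega> \<and> length xs = l. W xs)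
      = (\<Sum>(xs, x)\<in>{xs. set xs \<subseteq> \<Omega> \<and> length xs = m} \<times> \<Omega>. W (x # xs))"
      unfolding m lists_length_Suc_eq by (subst sum.reindex) (auto simp: inj_on_def case_prod_beta intro!: sum.cong)
    also have "\<dots> = (\<Sum>x\<in>\<Omega>. \<Sum>xs | set xs \<subseteq> \<Omega> \<and> length xs = m. W (x # xs))"
      by (subst sum.swap) (simp add: sum.cartesian_product)
    also have "\<dots> = op_trace \<Omega> (A ^ l)"
      unfolding op_trace_def m
      by (intro sum.cong refl) (simp only: app_power_kron_paths[OF assms(1,2)] W_def list.case)
    finally show ?thesis .
  qed
  ultimately show ?thesis using sum_cyclic_lists_mod_prime[OF l assms(1), of W] by simp
qed

lemma add_power_prime_dvd:
  fixes x y :: "'k::comm_ring_1"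
  assumes "prime l"
  shows "of_nat l dvd (x + y) ^ l - (x ^ l + y ^ l)"
proof -
  have l: "l > 1" using assms prime_gt_1_nat by blast
  have "(x + y) ^ l = (\<Sum>k\<le>l. of_nat (l choose k) * x ^ k * y ^ (l - k))" by (rule binomial_ring)
  also have "{..l} = insert 0 (insert l {0<..<l})" using l by auto
  also have "(\<Sum>k\<in>\<dots>. of_nat (l choose k) * x ^ k * y ^ (l - k))
    = y ^ l + x ^ l + (\<Sum>k\<in>{0<..<l}. of_nat (l choose k) * x ^ k * y ^ (l - k))"
    using l by (simp add: add.assoc)
  finally have e: "(x + y) ^ l - (x ^ l + y ^ l) = (\<Sum>k\<in>{0<..<l}. of_nat (l choose k) * x ^ k * y ^ (l - k))"
    by simp
  have "of_nat l dvd (of_nat (l choose k) :: 'k)" if "k \<in> {0<..<l}" for k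
  proof -
    have "l dvd (l choose k)" using that assms by (intro dvd_choose_prime) auto
    then obtain t where "l choose k = l * t" by blast
    then show ?thesis by simp
  qed
  then show ?thesis unfolding e by (intro dvd_sum dvd_mult2)
qed

lemma int_power_prime_dvd:
  assumes "prime l"
  shows "int l dvd a ^ l - a"
proof -
  have step: "int l dvd (b + 1) ^ l - (b + 1) \<longleftrightarrow> int l dvd b ^ l - b" for b
  proof -
    have "int l dvd (b + 1) ^ l - (b ^ l + 1)" using add_power_prime_dvd[OF assms, of b 1] by simp
    moreover have "(b + 1) ^ l - (b + 1) = (b + 1) ^ l - (b ^ l + 1) + (b ^ l - b)" by simp
    ultimately show ?thesis by (metis dvd_add_right_iff)
  qed
  show ?thesis
  proof (induction a rule: int_induct[where k = 0])
    case base
    show ?case using assms by (simp add: zero_power prime_gt_0_nat)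
  next
    case (step1 i)
    then show ?case using step[of i] by simp
  next
    case (step2 i)
    then show ?case using step[of "i - 1"] by simp
  qed
qed

text \<open>Modulo \<open>l\<close>, taking \<open>l\<close>-th powers is additive and, by Fermat,
  fixes the integer coefficients.\<close>

lemma poly_frobenius:
  fixes P :: "int poly"
  assumes "prime l"
  shows "of_nat l dvd P ^ l - P \<circ>\<^sub>p monom 1 l"
proof (induction P)
  case 0
  show ?case using assms by (simp add: zero_power prime_gt_0_nat)
next
  case (pCons a P)
  let ?l = "of_nat l :: int poly"
  have e: "pCons a P = [:a:] + [:0, 1:] * P" by simp
  have 1: "?l dvd pCons a P ^ l - ([:a:] ^ l + ([:0, 1:] * P) ^ l)"
    using add_power_prime_dvd[OF assms, of "[:a:]" "[:0, 1:] * P"] unfolding e .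
  obtain t where t: "a ^ l - a = int l * t" using int_power_prime_dvd[OF assms, of a] by blast
  have "[:a:] ^ l = [:a ^ l:]" by (simp add: poly_const_pow)
  then have "[:a:] ^ l - [:a:] = ?l * [:t:]" by (simp add: t of_nat_poly)
  then have 2: "?l dvd [:a:] ^ l - [:a:]" by (metis dvd_triv_left)
  have 3: "?l dvd monom 1 l * (P ^ l - P \<circ>\<^sub>p monom 1 l)" using pCons.IH by (rule dvd_mult)
  have "([:0, 1:] * P) ^ l = monom 1 l * P ^ l"
    by (simp only: power_mult_distrib monom_altdef smult_1_left)
  moreover have "pCons a P \<circ>\<^sub>p monom 1 l = [:a:] + monom 1 l * (P \<circ>\<^sub>p monom 1 l)"
    by (simp add: pcompose_pCons)
  ultimately have "pCons a P ^ l - pCons a P \<circ>\<^sub>p monom 1 l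
     = (pCons a P ^ l - ([:a:] ^ l + ([:0, 1:] * P) ^ l)) + ([:a:] ^ l - [:a:])
       + monom 1 l * (P ^ l - P \<circ>\<^sub>p monom 1 l)"
    by (simp only: right_diff_distrib)
  then show ?case using 1 2 3 by (simp only: dvd_add)
qed

text \<open>The trace reduces modulo \<open>l\<close> to \<open>l\<close>-th powers of the diagonal
  entries of the \<open>r\<close>-th power, and Frobenius turns these into substitutions of
  \<open>q ^ l\<close> for \<open>q\<close>.\<close>

lemma coxeter_trace_prime:
  assumes "finite \<Omega>" "place_closed m \<Omega>" "prime l"
  shows "of_nat l dvd coxeter_trace m \<Omega> (l * r) - coxeter_trace m \<Omega> r \<circ>\<^sub>p monom 1 l"
proof -
  let ?A = "coxeter_op [:0, 1 :: int:] m ^ r"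
  let ?d = "\<lambda>a. app ?A (kron a) a"
  have "restricts \<Omega> ?A" by (intro restricts_power restricts_coxeter_op assms)
  from op_trace_prime_power[OF assms(1) this assms(3)]
  have 1: "of_nat l dvd coxeter_trace m \<Omega> (l * r) - (\<Sum>a\<in>\<Omega>. ?d a ^ l)"
    by (simp add: coxeter_trace_def power_mult mult.commute flip: power_mult)
  have 2: "of_nat l dvd (\<Sum>a\<in>\<Omega>. ?d a ^ l) - (\<Sum>a\<in>\<Omega>. ?d a \<circ>\<^sub>p monom 1 l)"
    by (intro dvd_diff_sum poly_frobenius assms)
  have "(\<Sum>a\<in>\<Omega>. ?d a \<circ>\<^sub>p monom 1 l) = coxeter_trace m \<Omega> r \<circ>\<^sub>p monom 1 l"
    by (simp add: coxeter_trace_def op_trace_def pcompose_sum)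
  then show ?thesis using dvd_add[OF 1 2] by simp
qed

lemma pcompose_monom_cancel:
  fixes P Q :: "'a::idom poly"
  assumes "P \<circ>\<^sub>p monom 1 n = Q \<circ>\<^sub>p monom 1 n" "n > 0"
  shows "P = Q"
proof -
  have "(P - Q) \<circ>\<^sub>p monom 1 n = 0" using assms by (simp add: pcompose_diff)
  then have "P - Q = 0" by (rule pcompose_eq_0) (simp add: assms degree_monom_eq)
  then show ?thesis by simp
qed

lemma pcompose_monom_monom: "(P \<circ>\<^sub>p monom 1 m) \<circ>\<^sub>p monom 1 n = P \<circ>\<^sub>p monom (1 :: 'a::comm_ring_1) (m * n)"
proof -
  have "monom 1 m \<circ>\<^sub>p monom 1 n = monom (1 :: 'a) (m * n)"
    by (simp add: monom_altdef pcompose_hom.hom_power pcompose_pCons flip: power_mult) (simp add: mult.commute)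
  then show ?thesis by (simp flip: pcompose_assoc)
qed

text \<open>
  The coefficients of the traces are the integers \<open>M k r\<close>, the sums of \<open>\<zeta>\<^sup>r\<close> over the eigenvalues
  \<open>\<zeta> x\<^sup>k\<close>. They are bounded, periodic in \<open>r\<close> modulo the order of the \<open>\<zeta>\<close>, and invariant modulo a prime
  \<open>l\<close> under multiplication of \<open>r\<close> by \<open>l\<close>. So they do not change if \<open>r = 1\<close> is replaced by a product of
  large primes, and by periodicity by any \<open>r\<close> prime to the order.
\<close>

theorem coxeter_trace_power:
  assumes fin: "finite \<Omega>" and closed: "place_closed m \<Omega>"
    and p: "p \<ge> 1" "coprime p (Suc m)"
  shows "coxeter_trace m \<Omega> p = coxeter_trace m \<Omega> 1 \<circ>\<^sub>p monom 1 p"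
proof -
  define n where "n = Suc m"
  define F where "F = coxeter_trace m \<Omega>"
  obtain zs :: "(complex \<times> nat) list"
    where root: "\<And>\<zeta> k. (\<zeta>, k) \<in> set zs \<Longrightarrow> \<zeta> ^ n = 1"
    and eig: "\<And>p. of_int_poly (F p) \<circ>\<^sub>p monom 1 n = (\<Sum>(\<zeta>, k)\<leftarrow>zs. monom (\<zeta> ^ p) (k * p))"
    unfolding n_def F_def using coxeter_trace_eigenvalues[OF fin closed] by metis
  define M :: "nat \<Rightarrow> nat \<Rightarrow> int" where "M k r = coeff (F r \<circ>\<^sub>p monom 1 n) (k * r)" for k r
  have coeffs: "of_int (coeff (F r \<circ>\<^sub>p monom 1 (l * n)) j) = (\<Sum>(\<zeta>, k)\<leftarrow>zs. if k * r * l = j then \<zeta> ^ r else 0)"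
    for r l j
  proof -
    have c: "coeff (\<Sum>(\<zeta>, k)\<leftarrow>xs. monom (\<zeta> ^ r) (k * r * l)) j = (\<Sum>(\<zeta>, k)\<leftarrow>xs. if k * r * l = j then \<zeta> ^ r else 0)"
      for xs :: "(complex \<times> nat) list" by (induction xs) auto
    have "(\<Sum>(\<zeta>, k)\<leftarrow>xs. monom (\<zeta> ^ r) (k * r)) \<circ>\<^sub>p monom 1 l = (\<Sum>(\<zeta>, k)\<leftarrow>xs. monom (\<zeta> ^ r) (k * r * l))"
      for xs :: "(complex \<times> nat) list"
    proof (induction xs)
      case (Cons x xs)
      have "monom c a \<circ>\<^sub>p monom 1 l = monom c (a * l)" for c :: complex and a
        by (rule poly_ext) (simp add: poly_pcompose poly_monom mult.commute flip: power_mult)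
      then show ?case using Cons by (auto simp: pcompose_add split: prod.split)
    qed simp
    then have "of_int_poly (F r \<circ>\<^sub>p monom 1 (l * n)) = (\<Sum>(\<zeta>, k)\<leftarrow>zs. monom (\<zeta> ^ r) (k * r * l))"
      using eig[of r] by (simp add: of_int_hom.map_poly_pcompose flip: pcompose_monom_monom mult.commute[of n l])
    then show ?thesis by (metis c coeff_map_poly of_int_0)
  qed
  have M: "of_int (M k r) = (\<Sum>(\<zeta>, k')\<leftarrow>zs. if k' = k then \<zeta> ^ r else 0)" if "r \<ge> 1" for k r
    unfolding M_def using coeffs[of r 1 "k * r"] that by simp
  have bound: "\<bar>M k r\<bar> \<le> int (length zs)" if "r \<ge> 1" for k r
  proof -
    have "norm \<zeta> = 1" if "(\<zeta>, k) \<in> set zs" for \<zeta> k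
      using root[OF that] by (metis n_def norm_one norm_power power_eq_1_iff zero_less_Suc norm_ge_zero gr_implies_not_zero)
    then have "norm (\<Sum>(\<zeta>, k')\<leftarrow>zs. if k' = k then \<zeta> ^ r else 0) \<le> length zs"
    proof (induction zs)
      case (Cons x xs)
      obtain \<zeta> k' where x: "x = (\<zeta>, k')" by fastforce
      have "norm \<zeta> = 1" using Cons.prems x by auto
      then have "norm (if k' = k then \<zeta> ^ r else 0) \<le> 1" by (simp add: norm_power)
      moreover have "norm (\<Sum>(\<zeta>, k')\<leftarrow>xs. if k' = k then \<zeta> ^ r else 0) \<le> length xs"
        by (rule Cons.IH) (use Cons.prems in auto)
      ultimately show ?case unfolding x
        by (smt (verit) norm_triangle_ineq list.simps(9) sum_list.Cons case_prod_conv length_Cons of_nat_Suc)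
    qed simp
    then have "norm (of_int (M k r) :: complex) \<le> length zs" using M[OF that] by simp
    then show ?thesis by (simp add: norm_of_int)
  qed
  have periodic: "M k (r + n * t) = M k r" if "r \<ge> 1" for k r t
  proof -
    have "map (\<lambda>(\<zeta>, k'). if k' = k then \<zeta> ^ (r + n * t) else 0) zs
        = map (\<lambda>(\<zeta>, k'). if k' = k then \<zeta> ^ r else 0) zs"
      using root by (auto simp: power_add power_mult)
    then have "of_int (M k (r + n * t)) = (of_int (M k r) :: complex)"
      using M[OF that] M[of "r + n * t" k] that by (metis trans_le_add1)
    then show ?thesis by simp
  qed
  have congr: "int l dvd M k (l * r) - M k r" if "prime l" "r \<ge> 1" for k l r
  proof -
    have l: "l > 0" using that prime_gt_0_nat by blast
    have "of_nat l dvd F (l * r) - F r \<circ>\<^sub>p monom 1 l"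
      unfolding F_def by (rule coxeter_trace_prime[OF fin closed that(1)])
    then obtain P where "F (l * r) - F r \<circ>\<^sub>p monom 1 l = of_nat l * P" by blast
    then have "(F (l * r) - F r \<circ>\<^sub>p monom 1 l) \<circ>\<^sub>p monom 1 n = (of_nat l * P) \<circ>\<^sub>p monom 1 n"
      by simp
    then have "F (l * r) \<circ>\<^sub>p monom 1 n - F r \<circ>\<^sub>p monom 1 (l * n) = Polynomial.smult (int l) (P \<circ>\<^sub>p monom 1 n)"
      by (simp add: pcompose_diff pcompose_monom_monom pcompose_smult of_nat_poly)
    then have "coeff (F (l * r) \<circ>\<^sub>p monom 1 n) j - coeff (F r \<circ>\<^sub>p monom 1 (l * n)) j
        = int l * coeff (P \<circ>\<^sub>p monom 1 n) j" for j
      by (metis coeff_diff coeff_smult)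
    from this[of "k * (l * r)"]
    have "M k (l * r) - coeff (F r \<circ>\<^sub>p monom 1 (l * n)) (k * (l * r)) = int l * coeff (P \<circ>\<^sub>p monom 1 n) (k * (l * r))"
      by (simp add: M_def)
    moreover have "coeff (F r \<circ>\<^sub>p monom 1 (l * n)) (k * (l * r)) = M k r"
    proof -
      have "of_int (coeff (F r \<circ>\<^sub>p monom 1 (l * n)) (k * (l * r))) = (of_int (M k r) :: complex)"
        unfolding coeffs M[OF that(2)] using l that(2) by (simp add: mult.commute mult.left_commute)
      then show ?thesis by simp
    qed
    ultimately show ?thesis by simp
  qed
  have large: "M k r = M k 1" if "r \<ge> 1" "\<And>l. prime l \<Longrightarrow> l dvd r \<Longrightarrow> l > 2 * length zs" for k r
    using that
  proof (induction r rule: less_induct)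
    case (less r)
    show ?case
    proof (cases "r = 1")
      case False
      then obtain l s where l: "prime l" "r = l * s" using prime_factor_nat[of r] by (metis dvdE)
      with less.prems have s: "s \<ge> 1" by (cases s) auto
      have "s < r" using l s prime_gt_1_nat[OF l(1)] by simp
      then have IH: "M k s = M k 1" using less s l by (metis dvd_mult)
      have "2 * length zs < l" using less.prems l by simp
      moreover have "\<bar>M k r - M k s\<bar> \<le> 2 * int (length zs)"
        using bound[OF less.prems(1), of k] bound[OF s, of k] by linarith
      moreover have "int l dvd M k r - M k s" using congr[OF l(1) s] l by simp
      \<comment> \<open>A multiple of \<open>l\<close> of absolute value at most
        \<open>2 * length zs < l\<close> is zero.\<close>
      ultimately have "M k r - M k s = 0"
        using dvd_imp_le_int[of "M k r - M k s" "int l"] by linarith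
      then show ?thesis using IH by simp
    qed simp
  qed
  \<comment> \<open>With this \<open>t\<close> every prime factor of \<open>p + n * t\<close> is
    large: a small prime dividing \<open>p\<close> divides neither \<open>n\<close> nor
    \<open>t\<close>, and any other small prime divides \<open>t\<close> but not
    \<open>p\<close>.\<close>
  define t where "t = \<Prod>{l. prime l \<and> l \<le> 2 * length zs \<and> \<not> l dvd p}"
  have M1: "M k p = M k 1" for k
  proof -
    have "M k (p + n * t) = M k 1"
    proof (rule large)
      show "p + n * t \<ge> 1" using p by simp
      fix l assume l: "prime l" "l dvd p + n * t"
      show "2 * length zs < l"
      proof (rule ccontr)
        assume small: "\<not> 2 * length zs < l"
        have finl: "finite {l. prime l \<and> l \<le> 2 * length zs \<and> \<not> l dvd p}"
          by (rule finite_subset[of _ "{..2 * length zs}"]) auto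
        show False
        proof (cases "l dvd p")
          case True
          then have "\<not> l dvd n" using p(2) l(1) coprime_common_divisor_nat[of p n l] by (auto simp: n_def)
          moreover have "\<not> l dvd t"
          proof
            assume "l dvd t"
            then obtain l' where l': "prime l'" "\<not> l' dvd p" "l dvd l'"
              unfolding t_def using prime_dvd_prod_iff[OF finl l(1), of "\<lambda>x. x"] by auto
            then have "l = l'" using l(1) primes_dvd_imp_eq by blast
            then show False using l' True by simp
          qed
          ultimately have "\<not> l dvd n * t" using l(1) prime_dvd_mult_iff by blast
          then show False using l(2) True by (metis dvd_add_right_iff)
        next
          case False
          then have "l dvd t" unfolding t_def using finl l(1) small by (intro dvd_prodI) auto
          then show False using l(2) False by (metis dvd_add_left_iff dvd_mult)
        qed
      qed
    qed
    then show ?thesis using periodic[OF p(1)] by simp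
  qed
  have "coeff (F p \<circ>\<^sub>p monom 1 n) j = coeff (F 1 \<circ>\<^sub>p monom 1 (p * n)) j" for j
  proof -
    have "(\<Sum>(\<zeta>, k)\<leftarrow>zs. if k * p = j then \<zeta> ^ p else 0) = (\<Sum>(\<zeta>, k)\<leftarrow>zs. if k * p = j then \<zeta> else 0)"
    proof (cases "p dvd j")
      case True
      then obtain k where k: "j = k * p" by (metis dvdE mult.commute)
      have "(\<Sum>(\<zeta>, k')\<leftarrow>zs. if k' * p = j then \<zeta> ^ p else 0) = of_int (M k p)"
        unfolding M[OF p(1)] k using p by (simp cong: if_cong)
      also have "\<dots> = of_int (M k 1)" by (simp add: M1)
      also have "\<dots> = (\<Sum>(\<zeta>, k')\<leftarrow>zs. if k' * p = j then \<zeta> else 0)"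
        unfolding M[OF order_refl] k using p by (simp cong: if_cong)
      finally show ?thesis .
    next
      case False
      then have "k * p \<noteq> j" for k by auto
      then show ?thesis by simp
    qed
    then have "of_int (coeff (F p \<circ>\<^sub>p monom 1 n) j) = (of_int (coeff (F 1 \<circ>\<^sub>p monom 1 (p * n)) j) :: complex)"
      using coeffs[of p 1 j, unfolded mult_1_right] coeffs[of 1 p j, unfolded mult_1_right power_one_right] by simp
    then show ?thesis by simp
  qed
  then have "F p \<circ>\<^sub>p monom 1 n = (F 1 \<circ>\<^sub>p monom 1 p) \<circ>\<^sub>p monom 1 n"
    by (simp add: poly_eq_iff pcompose_monom_monom)
  then have "F p = F 1 \<circ>\<^sub>p monom 1 p" by (rule pcompose_monom_cancel) (simp add: n_def)
  then show ?thesis by (simp add: F_def)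
qed

section \<open>Coxeter words up to cyclic shifts\<close>

definition hop_word :: "'k::comm_ring_1 \<Rightarrow> nat list \<Rightarrow> 'k lin_op" where
  "hop_word q is = (\<Prod>i\<leftarrow>is. hop_op q i)"

lemma hop_word_simps [simp]:
  "hop_word q [] = 1" "hop_word q (i # is) = hop_op q i * hop_word q is"
  "hop_word q (is @ js) = hop_word q is * hop_word q js"
  by (simp_all add: hop_word_def)

lemma hop_word_upt: "hop_word q [1..<Suc m] = coxeter_op q m"
  by (induction m) simp_all

lemma restricts_hop_word: "place_closed m \<Omega> \<Longrightarrow> set is \<subseteq> {1..m} \<Longrightarrow> restricts \<Omega> (hop_word q is)"
proof (induction "is")
  case (Cons i "is")
  then show ?case using restricts_hop_closed[of m \<Omega> i q] by auto
qed simp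

text \<open>Moves that preserve the trace of every power of the word: exchanging commuting
  neighbours and rotating.\<close>

inductive cyclic_shift :: "nat list \<Rightarrow> nat list \<Rightarrow> bool" where
  same: "cyclic_shift is is"
| swap: "Suc i < j \<or> Suc j < i \<Longrightarrow> cyclic_shift (is @ i # j # js) (is @ j # i # js)"
| rotate: "cyclic_shift (i # is) (is @ [i])"
| compose: "cyclic_shift is js \<Longrightarrow> cyclic_shift js ks \<Longrightarrow> cyclic_shift is ks"

lemma cyclic_shift_mset: "cyclic_shift is js \<Longrightarrow> mset is = mset js"
  by (induction rule: cyclic_shift.induct) auto

lemma power_mult_rotate: "(A * B) ^ Suc k = A * (B * A) ^ k * (B :: 'r::ring_1)"
proof (induction k)
  case (Suc k)
  have "(A * B) ^ Suc (Suc k) = A * B * (A * B) ^ Suc k" by simp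
  also have "\<dots> = A * (B * A * (B * A) ^ k) * B" unfolding Suc by (simp add: mult.assoc)
  finally show ?case by (simp only: power_Suc)
qed simp

text \<open>A swap does not change the operator. A rotation is handled by cyclicity of the trace,
  after writing \<open>(A * B) ^ Suc k\<close> as \<open>A * (B * A) ^ k * B\<close>.\<close>

lemma cyclic_shift_op_trace:
  assumes fin: "finite \<Omega>" and closed: "place_closed m \<Omega>"
  shows "cyclic_shift is js \<Longrightarrow> set is \<subseteq> {1..m} \<Longrightarrow> op_trace \<Omega> (hop_word q is ^ p) = op_trace \<Omega> (hop_word q js ^ p)"
proof (induction rule: cyclic_shift.induct)
  case (swap i j "is" js)
  have "hop_op q i * hop_op q j = hop_op q j * hop_op q i"
    using swap(1) hops.far[of i j q] hops.far[of j i q] by auto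
  then have "hop_word q (is @ i # j # js) = hop_word q (is @ j # i # js)"
    by simp (metis mult.assoc)
  then show ?case by simp
next
  case (rotate i "is")
  let ?A = "hop_op q i" and ?B = "hop_word q is"
  have r: "restricts \<Omega> ?A" "restricts \<Omega> ?B"
    using rotate closed by (auto intro!: restricts_hop_closed restricts_hop_word)
  show ?case
  proof (cases p)
    case (Suc k)
    have "op_trace \<Omega> ((?A * ?B) ^ p) = op_trace \<Omega> ((?A * (?B * ?A) ^ k) * ?B)"
      unfolding Suc power_mult_rotate ..
    also have "\<dots> = op_trace \<Omega> (?B * (?A * (?B * ?A) ^ k))"
      using r by (intro op_trace_commute[OF fin]) auto
    also have "?B * (?A * (?B * ?A) ^ k) = (?B * ?A) ^ p" by (simp add: Suc mult.assoc power_Suc del: power_Suc2)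
    finally show ?thesis by simp
  qed simp
next
  case (compose "is" js ks)
  then show ?case using cyclic_shift_mset by (metis set_mset_mset)
qed simp

lemma cyclic_shift_bubble_right:
  assumes "\<And>x. x \<in> set v \<Longrightarrow> Suc x < m"
  shows "cyclic_shift (u @ m # v) (u @ v @ [m])"
  using assms
proof (induction v arbitrary: u)
  case (Cons x v)
  have "cyclic_shift (u @ m # x # v) (u @ x # m # v)" using Cons.prems by (intro cyclic_shift.swap) auto
  moreover have "cyclic_shift ((u @ [x]) @ m # v) ((u @ [x]) @ v @ [m])"
    using Cons.prems by (intro Cons.IH) auto
  ultimately show ?case by (auto intro: cyclic_shift.compose)
qed (simp add: cyclic_shift.same)

lemma cyclic_shift_bubble_left:
  assumes "\<And>x. x \<in> set u \<Longrightarrow> Suc x < m"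
  shows "cyclic_shift (u @ m # v) (m # u @ v)"
  using assms
proof (induction u arbitrary: v rule: rev_induct)
  case (snoc x u)
  have "cyclic_shift (u @ x # m # v) (u @ m # x # v)" using snoc.prems by (intro cyclic_shift.swap) auto
  moreover have "cyclic_shift (u @ m # (x # v)) (m # u @ x # v)" using snoc by auto
  ultimately show ?case by (auto intro: cyclic_shift.compose)
qed (simp add: cyclic_shift.same)

text \<open>The only letter below \<open>m\<close> that need not commute with \<open>m\<close> is
  \<open>m - 1\<close>, and it occurs on at most one side. Across the other side \<open>m\<close>
  passes freely: rightwards directly to the end, leftwards to the front and then around by a
  rotation.\<close>

lemma cyclic_shift_move_last:
  assumes d: "distinct (u @ v)" and s: "set (u @ v) \<subseteq> {..<m}"
  shows "cyclic_shift (u @ m # v) (u @ v @ [m])"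
proof (cases "m - 1 \<in> set v")
  case False
  then have "Suc x < m" if "x \<in> set v" for x
    using s that by (cases "Suc x = m") (auto simp: Suc_lessI)
  then show ?thesis by (rule cyclic_shift_bubble_right)
next
  case True
  with d have "m - 1 \<notin> set u" by auto
  then have "Suc x < m" if "x \<in> set u" for x
    using s that by (cases "Suc x = m") (auto simp: Suc_lessI)
  then have "cyclic_shift (u @ m # v) (m # u @ v)" by (rule cyclic_shift_bubble_left)
  moreover have "cyclic_shift (m # u @ v) ((u @ v) @ [m])" by (rule cyclic_shift.rotate)
  ultimately show ?thesis by (auto intro: cyclic_shift.compose)
qed

text \<open>Only a rotation needs an argument: the rotated letter lands behind \<open>m\<close>, and
  moving \<open>m\<close> to the end restores the shape.\<close>

lemma cyclic_shift_snoc: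
  "cyclic_shift is js \<Longrightarrow> distinct is \<Longrightarrow> set is \<subseteq> {..<m} \<Longrightarrow> cyclic_shift (is @ [m]) (js @ [m])"
proof (induction rule: cyclic_shift.induct)
  case (swap i j "is" js)
  then show ?case using cyclic_shift.swap[of i j "is" "js @ [m]"] by simp
next
  case (rotate i "is")
  have "cyclic_shift (i # is @ [m]) ((is @ [m]) @ [i])" by (rule cyclic_shift.rotate)
  moreover have "cyclic_shift (is @ m # [i]) (is @ [i] @ [m])"
    using rotate by (intro cyclic_shift_move_last) auto
  ultimately show ?case by (auto intro: cyclic_shift.compose)
next
  case (compose "is" js ks)
  then show ?case using cyclic_shift_mset by (metis cyclic_shift.compose mset_eq_imp_distinct_iff set_mset_mset)
qed (rule cyclic_shift.same)

text \<open>The largest letter is moved to the end, and the rest is brought into the standard order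
  by induction.\<close>

lemma cyclic_shift_coxeter:
  "distinct is \<Longrightarrow> set is = {1..m} \<Longrightarrow> cyclic_shift is [1..<Suc m]"
proof (induction m arbitrary: "is")
  case 0
  then show ?case by (simp add: cyclic_shift.same)
next
  case (Suc m)
  then have "Suc m \<in> set is" by simp
  then obtain u v where uv: "is = u @ Suc m # v" by (meson split_list)
  have d: "distinct (u @ v)" and nin: "Suc m \<notin> set (u @ v)" using Suc.prems(1) unfolding uv by simp_all
  have "insert (Suc m) (set (u @ v)) = {1..Suc m}" using Suc.prems(2) unfolding uv by simp
  then have "set (u @ v) = {1..Suc m} - {Suc m}" using nin by (metis Diff_insert_absorb)
  also have "\<dots> = {1..m}" by auto
  finally have s: "set (u @ v) = {1..m}" .
  have "set (u @ v) \<subseteq> {..<Suc m}" unfolding s by auto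
  from cyclic_shift_move_last[OF d this] have "cyclic_shift is ((u @ v) @ [Suc m])"
    unfolding uv by simp
  moreover have "cyclic_shift ((u @ v) @ [Suc m]) ([1..<Suc m] @ [Suc m])"
    by (rule cyclic_shift_snoc[OF Suc.IH[OF d s] d]) (use s in auto)
  ultimately show ?case by (auto intro: cyclic_shift.compose)
qed

section \<open>Diagonal entries of a Coxeter element and the trace formula\<close>

definition step_weight :: "'k::comm_ring_1 \<Rightarrow> nat \<Rightarrow> nat \<Rightarrow> 'k" where
  "step_weight q x y = (if x = y then q else if x < y then q - 1 else 0)"

text \<open>\<open>step_weight\<close> is the diagonal entry of a single generator. The generators
  of index above \<open>k\<close> do not involve place \<open>k\<close>, so they cannot undo an
  exchange of distinct letters made by the \<open>k\<close>-th one; hence only diagonal entries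
  multiply up.\<close>

lemma coxeter_op_diagonal:
  "app (coxeter_op q m) (kron a) a = (\<Prod>i\<in>{1..m}. step_weight q (a i) (a (Suc i)))"
proof -
  \<comment> \<open>The second conjunct says that the generators from \<open>k\<close> on leave the
    places below \<open>k\<close> alone; it kills the exchanged term in the induction step.\<close>
  have "app (hop_word q [k..<Suc m]) (kron a) a = (\<Prod>i\<in>{k..m}. step_weight q (a i) (a (Suc i))) \<and>
      (\<forall>b j. j < k \<longrightarrow> b j \<noteq> a j \<longrightarrow> app (hop_word q [k..<Suc m]) (kron a) b = 0)"
    if "k \<le> Suc m" for k
    using that
  proof (induction rule: inc_induct)
    case base
    then show ?case by (auto simp: kron_def)
  next
    case (step k)
    let ?g = "app (hop_word q [Suc k..<Suc m]) (kron a)"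
    have e: "app (hop_word q [k..<Suc m]) (kron a) = hop q k ?g"
      using step by (simp add: upt_conv_Cons del: upt_Suc)
    have "hop q k ?g b = 0" if "j < k" "b j \<noteq> a j" for b j
    proof -
      have z: "?g b' = 0" if "b' j \<noteq> a j" for b'
        by (rule step(3)[THEN conjunct2, rule_format, of j b']) (use \<open>j < k\<close> that in simp_all)
      have "(b \<circ> transpose k (Suc k)) j = b j" using that by simp
      with that have "?g b = 0" "?g (b \<circ> transpose k (Suc k)) = 0" by (intro z; simp)+
      then show ?thesis by (simp add: hop_def)
    qed
    moreover have "hop q k ?g a = step_weight q (a k) (a (Suc k)) * ?g a"
    proof -
      have "a k \<noteq> a (Suc k) \<Longrightarrow> ?g (a \<circ> transpose k (Suc k)) = 0"
        by (rule step(3)[THEN conjunct2, rule_format, of k]) auto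
      then show ?thesis by (auto simp: hop_def step_weight_def)
    qed
    moreover have "{k..m} = insert k {Suc k..m}" using step by auto
    ultimately show ?case unfolding e using step(3) by auto
  qed
  from this[of 1] show ?thesis unfolding hop_word_upt by simp
qed

text \<open>Cyclic shifts lead to the standard Coxeter word. The comparison of powers is made for an
  indeterminate and then evaluated, where composition with \<open>monom 1 p\<close> becomes
  evaluation at \<open>x ^ p\<close>.\<close>

theorem op_trace_coxeter_power:
  fixes x :: "'k::comm_ring_1"
  assumes fin: "finite \<Omega>" and closed: "place_closed m \<Omega>"
    and p: "p \<ge> 1" "coprime p (Suc m)" and "is": "distinct is" "set is = {1..m}"
  shows "op_trace \<Omega> (hop_word x is ^ p) = (\<Sum>a\<in>\<Omega>. \<Prod>i\<in>{1..m}. step_weight (x ^ p) (a i) (a (Suc i)))"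
proof -
  have ev: "poly (of_int_poly (coxeter_trace m \<Omega> r)) y = op_trace \<Omega> (coxeter_op y m ^ r)" for r and y :: 'k
  proof -
    interpret \<phi>: comm_ring_hom "\<lambda>P. poly (of_int_poly P) y" by (rule comm_ring_hom_poly_of_int)
    have "transports (\<lambda>P. poly (of_int_poly P) y) (coxeter_op [:0, 1:] m) (coxeter_op y m)"
      using \<phi>.transports_coxeter_op[of "[:0, 1:]" m] by simp
    then show ?thesis unfolding coxeter_trace_def by (intro \<phi>.transports_op_trace \<phi>.transports_power)
  qed
  have "op_trace \<Omega> (hop_word x is ^ p) = op_trace \<Omega> (coxeter_op x m ^ p)"
    using cyclic_shift_op_trace[OF fin closed cyclic_shift_coxeter[OF "is"], of x p] "is"
    unfolding hop_word_upt by simp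
  also have "\<dots> = poly (of_int_poly (coxeter_trace m \<Omega> 1)) (x ^ p)"
    unfolding ev[symmetric] coxeter_trace_power[OF fin closed p]
    by (simp add: of_int_hom.map_poly_pcompose poly_pcompose poly_monom)
  also have "\<dots> = (\<Sum>a\<in>\<Omega>. \<Prod>i\<in>{1..m}. step_weight (x ^ p) (a i) (a (Suc i)))"
    unfolding ev by (simp add: op_trace_def coxeter_op_diagonal)
  finally show ?thesis .
qed

section \<open>Distinguished subwords\<close>

abbreviation adj :: "nat \<Rightarrow> nat \<Rightarrow> nat" where
  "adj i \<equiv> transpose i (Suc i)"

definition inversions :: "nat \<Rightarrow> (nat \<Rightarrow> nat) \<Rightarrow> (nat \<times> nat) set" where
  "inversions n w = {(a, b). 1 \<le> a \<and> a < b \<and> b \<le> n \<and> w b < w a}"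

lemma finite_inversions [simp]: "finite (inversions n w)"
  by (rule finite_subset[of _ "{..n} \<times> {..n}"]) (auto simp: inversions_def)

lemma inversions_id [simp]: "inversions n id = {}"
  by (auto simp: inversions_def)

lemma adj_permutes: "i \<in> {1..<n} \<Longrightarrow> adj i permutes {1..n}"
  by (rule permutes_swap_id) auto

text \<open>Apart from the new inversion \<open>(i, Suc i)\<close>, applying \<open>adj i\<close> to
  both positions matches the inversions before and after.\<close>

lemma card_inversions_ascent:
  assumes i: "i \<in> {1..<n}" and asc: "w i < w (Suc i)"
  shows "card (inversions n (w \<circ> adj i)) = Suc (card (inversions n w))"
proof -
  let ?f = "map_prod (adj i) (adj i)"
  have "inversions n (w \<circ> adj i) = insert (i, Suc i) (?f ` inversions n w)"
  proof (intro equalityI subsetI)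
    fix x assume "x \<in> inversions n (w \<circ> adj i)"
    then obtain a b where x: "x = (a, b)" "1 \<le> a" "a < b" "b \<le> n" "w (adj i b) < w (adj i a)"
      by (auto simp: inversions_def)
    show "x \<in> insert (i, Suc i) (?f ` inversions n w)"
    proof (cases "x = (i, Suc i)")
      case False
      then have "1 \<le> adj i a \<and> adj i a < adj i b \<and> adj i b \<le> n"
        using x i by (auto simp: transpose_def)
      then have "(adj i a, adj i b) \<in> inversions n w" using x by (auto simp: inversions_def)
      then have "?f (adj i a, adj i b) \<in> ?f ` inversions n w" by (rule imageI)
      then show ?thesis using x by simp
    qed simp
  next
    fix x assume "x \<in> insert (i, Suc i) (?f ` inversions n w)"
    then show "x \<in> inversions n (w \<circ> adj i)"
    proof
      assume "x = (i, Suc i)"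
      then show ?thesis using i asc by (simp add: inversions_def)
    next
      assume "x \<in> ?f ` inversions n w"
      then obtain a b where x: "x = (adj i a, adj i b)" "1 \<le> a" "a < b" "b \<le> n" "w b < w a"
        by (auto simp: inversions_def)
      then have "\<not> (a = i \<and> b = Suc i)" using asc by auto
      then have "1 \<le> adj i a \<and> adj i a < adj i b \<and> adj i b \<le> n"
        using x i by (auto simp: transpose_def)
      then show ?thesis using x by (simp add: inversions_def)
    qed
  qed
  moreover have "(i, Suc i) \<notin> ?f ` inversions n w"
  proof
    assume "(i, Suc i) \<in> ?f ` inversions n w"
    then obtain a b where ab: "i = adj i a" "Suc i = adj i b" "a < b" by (auto simp: inversions_def)
    then have "a = Suc i" "b = i" by (metis transpose_involutory transpose_apply_first transpose_apply_second)+
    with ab show False by simp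
  qed
  moreover have "inj ?f" by (intro prod.inj_map) auto
  ultimately show ?thesis by (simp add: card_image inj_on_subset)
qed

lemma card_inversions_adj_le:
  assumes i: "i \<in> {1..<n}" and "w i \<noteq> w (Suc i)"
  shows "card (inversions n (w \<circ> adj i)) \<le> Suc (card (inversions n w))"
proof (cases "w i < w (Suc i)")
  case False
  then have "(w \<circ> adj i) i < (w \<circ> adj i) (Suc i)" using assms by simp
  from card_inversions_ascent[of i n "w \<circ> adj i", OF i this]
  have "card (inversions n w) = Suc (card (inversions n (w \<circ> adj i)))" by (simp add: comp_assoc)
  then show ?thesis by simp
qed (use card_inversions_ascent[OF i] in simp)

lemma word_prod_simps [simp]:
  "word_prod [] = id" "word_prod (u # us) = u \<circ> word_prod us"
  "word_prod (us @ vs) = word_prod us \<circ> word_prod vs"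
proof -
  show "word_prod (us @ vs) = word_prod us \<circ> word_prod vs"
    by (induction us) (simp_all add: word_prod_def comp_assoc)
qed (simp_all add: word_prod_def)

lemma word_prod_permutes: "set us \<subseteq> simple_reflections n \<Longrightarrow> word_prod us permutes {1..n}"
proof (induction us)
  case (Cons u us)
  then obtain i where "i \<in> {1..<n}" "u = adj i" by (auto simp: simple_reflections_def)
  moreover have "word_prod us permutes {1..n}" using Cons by simp
  ultimately show ?case by (simp only: word_prod_simps permutes_compose adj_permutes)
qed (simp add: permutes_id)

lemma card_inversions_le_length:
  "set us \<subseteq> simple_reflections n \<Longrightarrow> card (inversions n (word_prod us)) \<le> length us"
proof (induction us rule: rev_induct)
  case Nil
  show ?case by (simp only: word_prod_simps inversions_id card.empty zero_le)
next
  case (snoc u us)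
  then obtain i where i: "i \<in> {1..<n}" "u = adj i" by (auto simp: simple_reflections_def)
  have "word_prod us permutes {1..n}" using snoc.prems by (intro word_prod_permutes) auto
  then have "word_prod us i \<noteq> word_prod us (Suc i)"
    by (metis n_not_Suc_n permutes_inj injD)
  from card_inversions_adj_le[where w = "word_prod us", OF i(1) this] snoc i
  have "card (inversions n (word_prod us \<circ> adj i)) \<le> Suc (length us)" by simp
  moreover have "word_prod (us @ [u]) = word_prod us \<circ> adj i"
    unfolding word_prod_simps i(2) by (simp only: comp_id)
  ultimately show ?case by (simp only: length_append_singleton)
qed

lemma inversions_descent:
  assumes "inversions n w \<noteq> {}"
  shows "\<exists>i\<in>{1..<n}. w (Suc i) < w i"
proof (rule ccontr)
  assume "\<not> ?thesis"
  then have le: "w i \<le> w (Suc i)" if "1 \<le> i" "i < n" for i using that by (meson atLeastLessThan_iff not_le)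
  have mono: "b \<le> n \<longrightarrow> 1 \<le> a \<longrightarrow> w a \<le> w b" if "a \<le> b" for a b
    using that
  proof (induction rule: dec_induct)
    case (step b)
    then show ?case using le[of b] by (meson Suc_le_lessD le_trans less_imp_le)
  qed simp
  from assms obtain a b where "1 \<le> a" "a < b" "b \<le> n" "w b < w a" by (auto simp: inversions_def)
  then show False using mono[of a b] by simp
qed

text \<open>Each step undoes a descent, as in bubble sort; a permutation without inversions is
  increasing and thus the identity.\<close>

lemma exists_reduced_word:
  "w permutes {1..n} \<Longrightarrow> \<exists>us. length us = card (inversions n w) \<and> set us \<subseteq> simple_reflections n \<and> word_prod us = w"
proof (induction "card (inversions n w)" arbitrary: w)
  case 0
  have "\<not> w (Suc i) < w i" if "i \<in> {1..<n}" for i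
  proof
    assume "w (Suc i) < w i"
    then have "(i, Suc i) \<in> inversions n w" using that by (simp add: inversions_def)
    then show False using 0 by auto
  qed
  have mono: "a < b \<Longrightarrow> 1 \<le> a \<Longrightarrow> b \<le> n \<Longrightarrow> w a < w b" for a b
  proof -
    assume ab: "a < b" "1 \<le> a" "b \<le> n"
    then have "(a, b) \<notin> inversions n w" using 0 by auto
    then have "w a \<le> w b" using ab by (auto simp: inversions_def)
    moreover have "w a \<noteq> w b" using ab permutes_inj[OF 0(2)] by (metis injD less_irrefl)
    ultimately show "w a < w b" by simp
  qed
  have "i \<le> n \<Longrightarrow> 1 \<le> i \<longrightarrow> i \<le> w i" for i
  proof (induction i)
    case (Suc i)
    show ?case
    proof (cases "i = 0")
      case True
      then have "w 1 \<in> {1..n}" using Suc.prems permutes_in_image[OF 0(2), of 1] by auto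
      then show ?thesis using True by simp
    next
      case False
      then have "w i < w (Suc i)" using mono[of i "Suc i"] Suc.prems by simp
      then show ?thesis using Suc False by simp
    qed
  qed simp
  then have "w = id" using permutes_natset_ge[OF 0(2)] by auto
  then show ?case using 0 by (intro exI[of _ "[]"]) simp
next
  case (Suc k)
  have "inversions n w \<noteq> {}" using Suc.hyps(2) by force
  then have "\<exists>i\<in>{1..<n}. w (Suc i) < w i" by (rule inversions_descent)
  then obtain i where i: "i \<in> {1..<n}" "w (Suc i) < w i" by blast
  let ?v = "w \<circ> adj i"
  have v: "?v permutes {1..n}" using i Suc.prems by (intro permutes_compose adj_permutes)
  have "card (inversions n (?v \<circ> adj i)) = Suc (card (inversions n ?v))"
    using i by (intro card_inversions_ascent) auto
  then have "k = card (inversions n ?v)" using Suc.hyps(2) by (simp add: comp_assoc)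
  then obtain us where us: "length us = k" "set us \<subseteq> simple_reflections n" "word_prod us = ?v"
    using Suc.hyps(1)[of ?v] v by metis
  then show ?case using i Suc.hyps(2)
    by (intro exI[of _ "us @ [adj i]"]) (auto simp: simple_reflections_def comp_assoc)
qed

lemma coxeter_length_eq:
  assumes "w permutes {1..n}"
  shows "coxeter_length n w = card (inversions n w)"
  unfolding coxeter_length_def
proof (rule Least_equality)
  fix k assume "\<exists>us. length us = k \<and> set us \<subseteq> simple_reflections n \<and> word_prod us = w"
  then show "card (inversions n w) \<le> k" using card_inversions_le_length by blast
qed (rule exists_reduced_word[OF assms])

lemma coxeter_length_ascent:
  assumes "w permutes {1..n}" "i \<in> {1..<n}"
  shows "coxeter_length n (w \<circ> adj i) = Suc (coxeter_length n w) \<longleftrightarrow> w i < w (Suc i)"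
    and "coxeter_length n w = Suc (coxeter_length n (w \<circ> adj i)) \<longleftrightarrow> w (Suc i) < w i"
proof -
  have ws: "w \<circ> adj i permutes {1..n}" using assms by (intro permutes_compose adj_permutes)
  have asc: "w i < w (Suc i) \<Longrightarrow> coxeter_length n (w \<circ> adj i) = Suc (coxeter_length n w)"
    using card_inversions_ascent[OF assms(2)] assms ws by (simp add: coxeter_length_eq)
  have desc: "w (Suc i) < w i \<Longrightarrow> coxeter_length n w = Suc (coxeter_length n (w \<circ> adj i))"
    using card_inversions_ascent[OF assms(2), of "w \<circ> adj i"] assms ws
    by (simp add: coxeter_length_eq comp_assoc)
  have "w i \<noteq> w (Suc i)" using permutes_inj[OF assms(1)] by (metis injD n_not_Suc_n)
  then consider "w i < w (Suc i)" | "w (Suc i) < w i" by linarith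
  then have "(coxeter_length n (w \<circ> adj i) = Suc (coxeter_length n w) \<longleftrightarrow> w i < w (Suc i))
    \<and> (coxeter_length n w = Suc (coxeter_length n (w \<circ> adj i)) \<longleftrightarrow> w (Suc i) < w i)"
  proof cases
    case 1
    with asc[OF 1] show ?thesis by simp
  next
    case 2
    with desc[OF 2] show ?thesis by simp
  qed
  then show "coxeter_length n (w \<circ> adj i) = Suc (coxeter_length n w) \<longleftrightarrow> w i < w (Suc i)"
    and "coxeter_length n w = Suc (coxeter_length n (w \<circ> adj i)) \<longleftrightarrow> w (Suc i) < w i"
    by blast+
qed

lemma coxeter_length_id [simp]: "coxeter_length n id = 0"
  by (simp only: coxeter_length_eq permutes_id inversions_id card.empty)

lemma coxeter_length_adj: "i \<in> {1..<n} \<Longrightarrow> coxeter_length n (adj i) = 1"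
  using coxeter_length_ascent(1)[OF permutes_id, of i n] by simp

text \<open>Translates the weak-order conditions on subwords into comparisons of adjacent values,
  the form in which \<open>hop\<close> is stated.\<close>

lemma weak_le_adj:
  assumes v: "v permutes {1..n}" and i: "i \<in> {1..<n}"
  shows "weak_le n v v" "weak_le n v (v \<circ> adj i) \<longleftrightarrow> v i < v (Suc i)"
    "weak_le n (v \<circ> adj i) v \<longleftrightarrow> v (Suc i) < v i"
proof -
  have 1: "inv_into UNIV v \<circ> v = id" using v by (rule permutes_inv_o)
  then have 2: "inv_into UNIV v \<circ> (v \<circ> adj i) = adj i" by (simp flip: comp_assoc)
  have "inv_into UNIV (v \<circ> adj i) = adj i \<circ> inv_into UNIV v"
    using v by (subst o_inv_distrib) (auto simp: permutes_bij)
  then have 3: "inv_into UNIV (v \<circ> adj i) \<circ> v = adj i" using 1 by (simp add: comp_assoc)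
  show "weak_le n v v" by (simp add: weak_le_def 1)
  show "weak_le n v (v \<circ> adj i) \<longleftrightarrow> v i < v (Suc i)"
    using coxeter_length_ascent(1)[OF v i] by (simp add: weak_le_def 2 coxeter_length_adj[OF i, unfolded One_nat_def])
  show "weak_le n (v \<circ> adj i) v \<longleftrightarrow> v (Suc i) < v i"
    using coxeter_length_ascent(2)[OF v i] by (simp add: weak_le_def 3 coxeter_length_adj[OF i, unfolded One_nat_def])
qed

section \<open>Sums over distinguished subwords by recursion on the first letter\<close>

lemma card_index_Cons:
  "card {i. i < Suc m \<and> P i} = (if P 0 then 1 else 0) + card {i. i < m \<and> P (Suc i)}"
proof -
  have "{i. i < Suc m \<and> P i} = (if P 0 then {0} else {}) \<union> Suc ` {i. i < m \<and> P (Suc i)}"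
    by (auto simp: less_Suc_eq_0_disj)
  then show ?thesis by (simp add: card_Un_disjoint card_image)
qed

lemma skip_count_Cons: "skip_count (u # us) = (if u = id then 1 else 0) + skip_count us"
  unfolding skip_count_def length_Cons by (subst card_index_Cons) simp

lemma partial_prod_simps [simp]:
  "partial_prod us 0 = id" "partial_prod (u # us) (Suc i) = u \<circ> partial_prod us i"
  by (simp_all add: partial_prod_def)

lemma descent_count_Cons:
  "descent_count n v (u # us) = (if weak_less n (v \<circ> u) v then 1 else 0) + descent_count n (v \<circ> u) us"
  unfolding descent_count_def length_Cons by (subst card_index_Cons) (simp add: comp_assoc)

lemma distinguished_Cons:
  "distinguished n v (s # w) (u # us) \<longleftrightarrow> weak_le n (v \<circ> u) (v \<circ> s) \<and> distinguished n (v \<circ> u) w us"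
  unfolding distinguished_def by (auto simp: less_Suc_eq_0_disj comp_assoc)

lemma subwords_Cons: "subwords (s # w) = (\<lambda>us. s # us) ` subwords w \<union> (\<lambda>us. id # us) ` subwords w"
proof (intro equalityI subsetI)
  fix us assume us: "us \<in> subwords (s # w)"
  then obtain u vs where *: "us = u # vs" by (cases us) (auto simp: subwords_def)
  have "u = s \<or> u = id" using us * by (auto simp: subwords_def)
  moreover have "vs \<in> subwords w" using us * by (fastforce simp: subwords_def)
  ultimately show "us \<in> (\<lambda>us. s # us) ` subwords w \<union> (\<lambda>us. id # us) ` subwords w" using * by auto
qed (auto simp: subwords_def less_Suc_eq_0_disj)

lemma finite_subwords: "finite (subwords w)"
proof (induction w)
  case Nil
  have "subwords [] = {[]}" by (auto simp: subwords_def)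
  then show ?case by simp
qed (simp add: subwords_Cons)

text \<open>The endpoint \<open>x\<close> of the walk from \<open>v\<close> is fixed instead of the
  product of the subword. Then removing the first letter changes only the start \<open>v\<close>,
  and the sum is a function of \<open>v\<close> on which the generators act.\<close>

definition subword_sum :: "nat \<Rightarrow> (nat \<Rightarrow> nat) \<Rightarrow> (nat \<Rightarrow> nat) \<Rightarrow> (nat \<Rightarrow> nat) list \<Rightarrow> int poly" where
  "subword_sum n v x w = (\<Sum>us\<in>{us \<in> subwords w. v \<circ> word_prod us = x \<and> distinguished n v w us}.
     ([:0, 1:] - 1) ^ skip_count us * [:0, 1:] ^ descent_count n v us)"

lemma R_poly_eq_subword_sum:
  assumes "v permutes {1..n}"
  shows "R_poly n v id w = subword_sum n v v w"
proof -
  have "v \<circ> f = v \<longleftrightarrow> f = id" for f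
    using permutes_inj[OF assms] by (auto simp: fun_eq_iff inj_eq)
  then show ?thesis by (simp add: R_poly_def subword_sum_def distinguished_subwords_def)
qed

text \<open>The first letter is either taken, with a factor \<open>q\<close> if this descends, or
  skipped, with a factor \<open>q - 1\<close>, which distinguishedness permits only at an ascent.
  These are the coefficients of \<open>hop\<close>.\<close>

lemma subword_sum_Cons:
  assumes v: "v permutes {1..n}" and i: "i \<in> {1..<n}"
  shows "subword_sum n v x (adj i # w) = hop [:0, 1:] i (\<lambda>v. subword_sum n v x w) v"
proof -
  let ?wt = "\<lambda>v us. ([:0, 1:] - 1) ^ skip_count us * [:0, 1 :: int:] ^ descent_count n v us"
  let ?S = "\<lambda>v. {us \<in> subwords w. v \<circ> word_prod us = x \<and> distinguished n v w us}"
  have vs: "v \<circ> adj i permutes {1..n}" using v i by (intro permutes_compose adj_permutes)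
  have ne: "v i \<noteq> v (Suc i)" using permutes_inj[OF v] by (metis injD n_not_Suc_n)
  have s_id: "adj i \<noteq> id" by (metis id_apply n_not_Suc_n transpose_apply_first)
  have vvs: "v \<circ> adj i \<noteq> v" using ne by (metis comp_apply transpose_apply_first)
  define A where "A = (#) (adj i) ` ?S (v \<circ> adj i)"
  define B where "B = (if v i < v (Suc i) then (#) id ` ?S v else {})"
  have refl: "weak_le n (v \<circ> adj i) (v \<circ> adj i)" using weak_le_adj(1)[OF vs i] .
  have "{us \<in> subwords (adj i # w). v \<circ> word_prod us = x \<and> distinguished n v (adj i # w) us} = A \<union> B"
    using weak_le_adj(2)[OF v i] refl
    by (auto simp: subwords_Cons A_def B_def distinguished_Cons comp_assoc)
  moreover have "A \<inter> B = {}" using s_id by (auto simp: A_def B_def)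
  moreover have "finite A" "finite B" by (auto simp: A_def B_def finite_subwords)
  ultimately have "subword_sum n v x (adj i # w) = (\<Sum>us\<in>A. ?wt v us) + (\<Sum>us\<in>B. ?wt v us)"
    by (simp add: subword_sum_def sum.union_disjoint)
  moreover have "(\<Sum>us\<in>A. ?wt v us) = (if v (Suc i) < v i then [:0, 1:] else 1) * subword_sum n (v \<circ> adj i) x w"
    using weak_le_adj(3)[OF v i] vvs s_id unfolding A_def subword_sum_def
    by (subst sum.reindex)
       (auto simp: skip_count_Cons descent_count_Cons weak_less_def sum_distrib_left mult.assoc mult.left_commute
             simp del: mult_pCons_left mult_pCons_right intro!: sum.cong)
  moreover have "(\<Sum>us\<in>B. ?wt v us) = (if v i < v (Suc i) then ([:0, 1:] - 1) * subword_sum n v x w else 0)"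
    unfolding B_def subword_sum_def
    by (auto simp: sum.reindex skip_count_Cons descent_count_Cons weak_less_def sum_distrib_left mult.assoc
             simp del: mult_pCons_left mult_pCons_right intro!: sum.cong)
  ultimately show ?thesis using ne by (auto simp: hop_def simp del: mult_pCons_left mult_pCons_right)
qed

lemma subword_sum_hop_word:
  "set is \<subseteq> {1..<n} \<Longrightarrow> v permutes {1..n} \<Longrightarrow>
   subword_sum n v x (map adj is) = app (hop_word [:0, 1:] is) (kron x) v"
proof (induction "is" arbitrary: v)
  case Nil
  have "us \<in> subwords [] \<and> v \<circ> word_prod us = x \<and> distinguished n v [] us \<longleftrightarrow> us = [] \<and> v = x" for us
  proof (cases us)
    case Nil
    have "v \<circ> word_prod [] = v" by (simp only: word_prod_simps comp_id)
    with Nil show ?thesis by (simp add: subwords_def distinguished_def)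
  qed (simp add: subwords_def)
  then have "subword_sum n v x [] = (\<Sum>us | us = [] \<and> v = x.
      ([:0, 1:] - 1) ^ skip_count us * [:0, 1:] ^ descent_count n v us)"
    unfolding subword_sum_def by presburger
  then show ?case by (cases "v = x") (simp_all add: kron_def skip_count_def descent_count_def)
next
  case (Cons i "is")
  then have i: "i \<in> {1..<n}" by auto
  have "v \<circ> adj i permutes {1..n}" using Cons.prems i by (intro permutes_compose adj_permutes)
  then show ?case using Cons subword_sum_Cons[OF Cons.prems(2) i, of x "map adj is"]
    by (simp add: hop_def)
qed

text \<open>Hence the sum over all \<open>v\<close> is a trace on permutations, and the case
  \<open>v = id\<close> is a single diagonal entry.\<close>

lemma R_poly_hop_word:
  "set is \<subseteq> {1..<n} \<Longrightarrow> v permutes {1..n} \<Longrightarrow>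
   R_poly n v id (map adj is) = app (hop_word [:0, 1:] is) (kron v) v"
  by (simp add: R_poly_eq_subword_sum subword_sum_hop_word)

lemma coxeter_word_obtain:
  assumes "coxeter_word n c"
  obtains "is" where "c = map adj is" "distinct is" "set is = {1..<n}"
proof -
  have adj_inj: "inj adj"
  proof (rule injI)
    fix i j assume "adj i = adj j"
    then have "adj j i = Suc i" by (metis transpose_apply_first)
    then show "i = j" unfolding transpose_def by (cases "i = j"; cases "i = Suc j") simp_all
  qed
  from assms have c: "distinct c" "set c = adj ` {1..<n}"
    by (auto simp: coxeter_word_def simple_reflections_def)
  define "is" where "is = map (inv_into UNIV adj) c"
  have "map adj is = map id c" unfolding is_def map_map o_def
    by (rule map_cong) (use c(2) in \<open>auto simp: inv_f_f[OF adj_inj]\<close>)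
  then have e: "c = map adj is" by simp
  then have "distinct is" using c(1) distinct_map by blast
  moreover have "adj ` set is = adj ` {1..<n}" using c(2) e by (metis set_map)
  then have "set is = {1..<n}" using inj_image_eq_iff[OF adj_inj] by blast
  ultimately show thesis using that e by blast
qed

lemma hop_word_power: "hop_word q (concat (replicate p is)) = hop_word q is ^ p"
  by (induction p) simp_all

lemma word_power_map: "word_power (map f c) p = map f (concat (replicate p c))"
  by (simp add: word_power_def map_concat)

section \<open>The weighted trace on words\<close>

context hecke_relations
begin

inductive parabolic :: "nat \<Rightarrow> 'r \<Rightarrow> bool" for m where
  one: "parabolic m 1"
| scalar: "parabolic m q"
| gen: "1 \<le> i \<Longrightarrow> i \<le> m \<Longrightarrow> parabolic m (T i)"
| uminus: "parabolic m A \<Longrightarrow> parabolic m (- A)"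
| add: "parabolic m A \<Longrightarrow> parabolic m B \<Longrightarrow> parabolic m (A + B)"
| mult: "parabolic m A \<Longrightarrow> parabolic m B \<Longrightarrow> parabolic m (A * B)"

text \<open>Sums of terms with at most one factor \<open>T (Suc m)\<close>. Such sums exhaust level
  \<open>Suc m\<close>, by \<open>parabolic_Suc_bimodule\<close>, so the limit theorem for traces
  has to be checked on two kinds of terms only.\<close>

inductive bimodule :: "nat \<Rightarrow> 'r \<Rightarrow> bool" for m where
  base: "parabolic m g \<Longrightarrow> bimodule m g"
| middle: "parabolic m g \<Longrightarrow> parabolic m h \<Longrightarrow> bimodule m (g * T (Suc m) * h)"
| add: "bimodule m A \<Longrightarrow> bimodule m B \<Longrightarrow> bimodule m (A + B)"

lemma parabolic_mono: "parabolic m A \<Longrightarrow> m \<le> k \<Longrightarrow> parabolic k A"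
  by (induction rule: parabolic.induct) (auto intro: parabolic.intros order_trans)

lemma parabolic_commute:
  assumes "\<And>j. 1 \<le> j \<Longrightarrow> j \<le> m \<Longrightarrow> x * T j = T j * x"
  shows "parabolic m A \<Longrightarrow> x * A = A * x"
proof (induction rule: parabolic.induct)
  case (mult A B)
  then show ?case by (metis mult.assoc)
qed (simp_all add: assms central distrib_left distrib_right)

lemma bimodule_parabolic_left: "bimodule m A \<Longrightarrow> parabolic m g \<Longrightarrow> bimodule m (g * A)"
proof (induction rule: bimodule.induct)
  case (middle g' h)
  then have "bimodule m ((g * g') * T (Suc m) * h)"
    by (intro bimodule.middle parabolic.mult)
  then show ?case by (simp add: mult.assoc)
qed (auto simp: distrib_left intro: bimodule.intros parabolic.intros)

text \<open>A \<open>g\<close> free of \<open>T m\<close> commutes with \<open>T (Suc m)\<close>,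
  and the quadratic relation removes the square. A \<open>g\<close> with one factor
  \<open>T m\<close> is treated by the braid relation, which turns
  \<open>T (Suc m) * T m * T (Suc m)\<close> into a term with one \<open>T (Suc m)\<close>.\<close>

lemma gen_mult_parabolic:
  assumes g: "m = 0 \<or> bimodule (m - 1) g" "parabolic m g" and h: "parabolic m h"
  shows "bimodule m (T (Suc m) * g) \<and> bimodule m (T (Suc m) * g * T (Suc m) * h)"
proof -
  let ?t = "T (Suc m)"
  have commuting: "bimodule m (?t * g) \<and> bimodule m (?t * g * ?t * h)"
    if tg: "?t * g = g * ?t" and g: "parabolic m g" for g
  proof -
    have "?t * g = g * ?t * 1" using tg by simp
    moreover have "?t * g * ?t * h = g * (q - 1) * ?t * h + g * q * h"
    proof -
      have "?t * g * ?t * h = g * (?t * ?t) * h" by (simp add: tg mult.assoc)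
      then show ?thesis by (simp add: quadratic distrib_left distrib_right mult.assoc)
    qed
    moreover have "parabolic m (q - 1)"
      using parabolic.add[OF parabolic.scalar parabolic.uminus[OF parabolic.one], of m] by simp
    ultimately show ?thesis
      using g h by (metis bimodule.add bimodule.base bimodule.middle parabolic.mult parabolic.one parabolic.scalar)
  qed
  show ?thesis
  proof (cases m)
    case 0
    show ?thesis
      by (rule commuting[OF parabolic_commute[OF _ g(2)] g(2)]) (simp add: 0)
  next
    case (Suc k)
    let ?s = "T m"
    from g Suc have "bimodule k g" by simp
    then show ?thesis
    proof (induction rule: bimodule.induct)
      case (base g)
      have "?t * g = g * ?t"
        by (rule parabolic_commute[OF _ base]) (use far[of _ "Suc m"] Suc in auto)
      then show ?case by (rule commuting) (use base parabolic_mono Suc in auto)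
    next
      case (middle g1 g2)
      have c: "?t * g1 = g1 * ?t" "?t * g2 = g2 * ?t"
        by (rule parabolic_commute[OF _ middle(1)], use far[of _ "Suc m"] Suc in auto)
           (rule parabolic_commute[OF _ middle(2)], use far[of _ "Suc m"] Suc in auto)
      have par: "parabolic m g1" "parabolic m g2" "parabolic m ?s"
        using middle parabolic_mono[of k _ m] Suc by (auto intro: parabolic.gen)
      have 1: "?t * (g1 * ?s * g2) = g1 * ?t * (?s * g2)" by (simp add: c(1) flip: mult.assoc)
      have "?t * (g1 * ?s * g2) * ?t * h = g1 * (?t * ?s * ?t) * g2 * h"
        unfolding 1 by (simp add: mult.assoc) (metis c(2) mult.assoc)
      also have "\<dots> = g1 * (?s * ?t * ?s) * g2 * h" by (simp only: braid[of m])
      finally have 2: "?t * (g1 * ?s * g2) * ?t * h = (g1 * ?s) * ?t * (?s * g2 * h)" by (simp add: mult.assoc)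
      have "bimodule m (?t * (g1 * ?s * g2))" unfolding 1
        using par by (intro bimodule.middle parabolic.mult)
      moreover have "bimodule m (?t * (g1 * ?s * g2) * ?t * h)" unfolding 2
        using par h by (intro bimodule.middle parabolic.mult)
      ultimately show ?case unfolding Suc by blast
    next
      case (add A B)
      then show ?case by (simp add: distrib_left distrib_right bimodule.add)
    qed
  qed
qed

lemma bimodule_gen_left:
  assumes "bimodule m A" and "\<And>g. parabolic m g \<Longrightarrow> m = 0 \<or> bimodule (m - 1) g"
  shows "bimodule m (T (Suc m) * A)"
  using assms(1)
proof (induction rule: bimodule.induct)
  case (base g)
  then show ?case using gen_mult_parabolic[OF assms(2)] parabolic.one by blast
next
  case (middle g h)
  then have "bimodule m (T (Suc m) * g * T (Suc m) * h)" using gen_mult_parabolic[OF assms(2)] by blast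
  then show ?case by (simp add: mult.assoc)
qed (simp add: distrib_left bimodule.add)

text \<open>The set \<open>bimodule m\<close> contains 1 and is closed under left multiplication by
  the generators up to \<open>Suc m\<close>; for the last generator this uses the decomposition one
  level lower.\<close>

lemma parabolic_Suc_bimodule: "parabolic (Suc m) A \<Longrightarrow> bimodule m A"
proof (induction m arbitrary: A rule: less_induct)
  case (less m)
  have dec: "m = 0 \<or> bimodule (m - 1) g" if "parabolic m g" for g
    using less.IH[of "m - 1" g] that by (cases m) auto
  have "bimodule m X \<longrightarrow> bimodule m (A * X)" for X
    using less.prems
  proof (induction arbitrary: X rule: parabolic.induct)
    case scalar
    then show ?case using bimodule_parabolic_left parabolic.scalar by blast
  next
    case (gen i)
    then show ?case
      using bimodule_gen_left[OF _ dec] bimodule_parabolic_left parabolic.gen[of i m] by (cases "i = Suc m") auto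
  next
    case (uminus A)
    have "bimodule m X \<Longrightarrow> bimodule m (- 1 * X)"
      by (rule bimodule_parabolic_left) (auto intro: parabolic.intros)
    then show ?case using uminus.IH[of "- X"] by simp
  next
    case (mult A B)
    then show ?case by (metis mult.assoc)
  qed (auto simp: distrib_right intro: bimodule.add)
  from this[of 1] show ?case by (auto intro: bimodule.base parabolic.one)
qed

end

abbreviation parabolic_op :: "'k::comm_ring_1 \<Rightarrow> nat \<Rightarrow> 'k lin_op \<Rightarrow> bool" where
  "parabolic_op q \<equiv> hecke_relations.parabolic (scalar_op q) (hop_op q)"

lemma parabolic_hop_word: "set is \<subseteq> {1..m} \<Longrightarrow> parabolic_op q m (hop_word q is)"
proof (induction "is")
  case (Cons i "is")
  then show ?case by (auto intro!: hops.parabolic.mult hops.parabolic.gen)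
qed (simp add: hops.parabolic.one)

lemma parabolic_power: "parabolic_op q m A \<Longrightarrow> parabolic_op q m (A ^ p)"
  by (induction p) (auto intro: hops.parabolic.mult hops.parabolic.one)

lemma parabolic_restricts:
  assumes "place_closed m \<Omega>"
  shows "parabolic_op q m A \<Longrightarrow> restricts \<Omega> A"
proof (induction rule: hops.parabolic.induct)
  case (gen i)
  then show ?case using restricts_hop_closed[OF assms] by simp
qed auto

text \<open>Places beyond \<open>Suc m\<close> are not touched, so the letter there is merely a
  parameter.\<close>

lemma parabolic_local:
  assumes "Suc m < j"
  shows "parabolic_op q m A \<Longrightarrow> app A f (a(j := y)) = app A (\<lambda>b. f (b(j := y))) a"
proof (induction arbitrary: f a rule: hops.parabolic.induct)
  case (gen i)
  have "a(j := y) \<circ> transpose i (Suc i) = (a \<circ> transpose i (Suc i))(j := y)"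
    using gen assms by (auto simp: fun_eq_iff transpose_def)
  moreover have "(a(j := y)) i = a i" "(a(j := y)) (Suc i) = a (Suc i)" using gen assms by auto
  ultimately show ?case by (simp only: app_hop_op hop_def)
next
  case (mult A B)
  then show ?case by (simp only: app_mult)
qed simp_all

section \<open>Weighted traces on words and the Markov property\<close>

definition words :: "nat \<Rightarrow> nat \<Rightarrow> (nat \<Rightarrow> nat) set" where
  "words n N = {a. (\<forall>i\<in>{1..n}. a i < N) \<and> (\<forall>i. i \<notin> {1..n} \<longrightarrow> a i = 0)}"

lemma words_0: "words 0 N = {\<lambda>_. 0}"
  by (auto simp: words_def)

lemma words_Suc: "words (Suc n) N = (\<lambda>(a, y). a(Suc n := y)) ` (words n N \<times> {..<N})"
proof (intro equalityI subsetI)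
  fix a assume a: "a \<in> words (Suc n) N"
  then have "(a(Suc n := 0), a (Suc n)) \<in> words n N \<times> {..<N}" by (auto simp: words_def)
  then have "(\<lambda>(a, y). a(Suc n := y)) (a(Suc n := 0), a (Suc n)) \<in> (\<lambda>(a, y). a(Suc n := y)) ` (words n N \<times> {..<N})"
    by (rule imageI)
  then show "a \<in> (\<lambda>(a, y). a(Suc n := y)) ` (words n N \<times> {..<N})" by simp
qed (auto simp: words_def)

lemma upd_inj: "a \<in> words n N \<Longrightarrow> b \<in> words n N \<Longrightarrow> a(Suc n := y) = b(Suc n := z) \<longleftrightarrow> a = b \<and> y = z"
  by (auto simp: words_def fun_eq_iff split: if_splits)

lemma sum_words_Suc:
  "(\<Sum>a\<in>words (Suc n) N. f a) = (\<Sum>a\<in>words n N. \<Sum>y<N. f (a(Suc n := y)))"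
  unfolding words_Suc
  by (subst sum.reindex) (auto simp: inj_on_def upd_inj sum.cartesian_product case_prod_beta)

lemma finite_words [simp]: "finite (words n N)"
  by (induction n) (simp_all add: words_0 words_Suc)

lemma place_closed_words: "place_closed m (words (Suc m) N)"
proof -
  have "transpose i (Suc i) j \<in> {1..Suc m} \<longleftrightarrow> j \<in> {1..Suc m}" if "i \<in> {1..m}" for i j
    using that by (auto simp: transpose_def)
  then show ?thesis unfolding place_closed_def words_def by (auto simp del: atLeastAtMost_iff)
qed

text \<open>A quantum trace: the trace on the \<open>n\<close>-th tensor power of an
  \<open>N\<close>-dimensional space, twisted in each factor by the diagonal matrix with entries
  \<open>1, x, ..., x ^ (N - 1)\<close>.\<close>

definition word_trace :: "'k::comm_ring_1 \<Rightarrow> nat \<Rightarrow> nat \<Rightarrow> 'k lin_op \<Rightarrow> 'k" where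
  "word_trace x n N A = (\<Sum>a\<in>words n N. x ^ (\<Sum>i\<in>{1..n}. a i) * app A (kron a) a)"

lemma sum_upd: "(\<Sum>i\<in>{1..Suc n}. (a(Suc n := y)) i) = (\<Sum>i\<in>{1..n}. a i) + (y :: nat)"
  by simp

lemma app_zero_fun [simp]: "app A (\<lambda>_. 0) a = 0"
  using app_scale[of A 0 "\<lambda>_. 0" a] by simp

lemma app_kron_upd:
  assumes "restricts (words n N) A"
    and "\<And>f b z. app A f (b(Suc n := z)) = app A (\<lambda>c. f (c(Suc n := z))) b"
    and "a \<in> words n N" "b \<in> words n N"
  shows "app A (kron (a(Suc n := y))) (b(Suc n := z)) = (if z = y then app A (kron a) b else 0)"
proof (cases "z = y")
  case True
  have "app A (\<lambda>c. kron (a(Suc n := y)) (c(Suc n := z))) b = app A (kron a) b"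
    by (rule restrictsD[OF assms(1) _ assms(4)]) (use assms(3) True in \<open>simp add: kron_def upd_inj\<close>)
  then show ?thesis using True by (simp add: assms(2))
next
  case False
  have "app A (\<lambda>c. kron (a(Suc n := y)) (c(Suc n := z))) b = app A (\<lambda>_. 0) b"
    by (rule restrictsD[OF assms(1) _ assms(4)]) (use assms(3) False in \<open>simp add: kron_def upd_inj\<close>)
  then show ?thesis using False by (simp add: assms(2))
qed

text \<open>An operator that ignores the last letter is the identity in that tensor factor, whose
  twisted trace is the geometric sum.\<close>

lemma word_trace_Suc:
  assumes "restricts (words n N) A"
    and "\<And>f b z. app A f (b(Suc n := z)) = app A (\<lambda>c. f (c(Suc n := z))) b"
  shows "word_trace x (Suc n) N A = (\<Sum>y<N. x ^ y) * word_trace x n N A"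
proof -
  have "word_trace x (Suc n) N A
    = (\<Sum>a\<in>words n N. \<Sum>y<N. x ^ ((\<Sum>i\<in>{1..n}. a i) + y) * app A (kron a) a)"
    unfolding word_trace_def sum_words_Suc sum_upd
    by (intro sum.cong refl) (simp_all only: app_kron_upd[OF assms] simp_thms if_True)
  then show ?thesis
    by (simp add: word_trace_def sum_product sum_distrib_left sum_distrib_right power_add mult_ac)
qed

text \<open>By telescoping the sum is independent of \<open>u\<close>: tracing out the last letter
  of a generator leaves a scalar. This is the source of the Markov property.\<close>

lemma sum_step_weight:
  "u < N \<Longrightarrow> (\<Sum>y<N. x ^ y * step_weight x u y) = x ^ N"
proof (induction N)
  case (Suc N)
  show ?case
  proof (cases "u = N")
    case True
    have "(\<Sum>y<N. x ^ y * step_weight x u y) = 0"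
      by (intro sum.neutral) (auto simp: step_weight_def True)
    then show ?thesis by (simp add: True step_weight_def mult.commute)
  next
    case False
    then show ?thesis using Suc by (simp add: step_weight_def algebra_simps)
  qed
qed simp

text \<open>Neither \<open>g\<close> nor \<open>h\<close> touches the last place, so only the part
  of the generator that keeps the last letter contributes; summed over that letter it is the scalar
  of \<open>sum_step_weight\<close>.\<close>

lemma word_trace_middle:
  assumes g: "parabolic_op x m g" and h: "parabolic_op x m h"
  shows "word_trace x (Suc (Suc m)) N (g * hop_op x (Suc m) * h) = x ^ N * word_trace x (Suc m) N (g * h)"
proof -
  define n where "n = Suc m"
  have rg: "restricts (words n N) g" and rh: "restricts (words n N) h"
    unfolding n_def using parabolic_restricts place_closed_words g h by blast+
  have lg: "app g f (b(Suc n := z)) = app g (\<lambda>c. f (c(Suc n := z))) b"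
    and lh: "app h f (b(Suc n := z)) = app h (\<lambda>c. f (c(Suc n := z))) b" for f b z
    using parabolic_local[of m "Suc n"] g h by (auto simp: n_def)
  \<comment> \<open>An exchange puts \<open>b n\<close> into the last place. If this differs from
    \<open>y\<close>, the term vanishes, because \<open>h\<close> keeps the last letter.\<close>
  have hop_val: "hop x n (app h (kron (a(Suc n := y)))) (b(Suc n := y)) = step_weight x (b n) y * app h (kron a) b"
    if ab: "a \<in> words n N" "b \<in> words n N" and y: "y < N" for a b y
  proof -
    have e: "b(Suc n := y) \<circ> transpose n (Suc n) = (b(n := y))(Suc n := b n)"
      by (auto simp: fun_eq_iff transpose_def)
    have b': "b(n := y) \<in> words n N" using ab y by (auto simp: words_def n_def)
    have "app h (kron (a(Suc n := y))) (b(Suc n := y) \<circ> transpose n (Suc n)) = 0" if "b n \<noteq> y"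
      unfolding e using app_kron_upd[OF rh lh ab(1) b'] that by simp
    then show ?thesis
      using app_kron_upd[OF rh lh ab, of y y] by (auto simp: hop_def step_weight_def)
  qed
  have "(\<Sum>y<N. x ^ y * app (g * hop_op x n * h) (kron (a(Suc n := y))) (a(Suc n := y)))
      = x ^ N * app (g * h) (kron a) a" if a: "a \<in> words n N" for a
  proof -
    have "app (g * hop_op x n * h) (kron (a(Suc n := y))) (a(Suc n := y))
       = app g (\<lambda>b. step_weight x (b n) y * app h (kron a) b) a" if "y < N" for y
      unfolding app_mult app_hop_op lg
      by (rule restrictsD[OF rg _ a]) (rule hop_val[OF a _ that])
    then have "(\<Sum>y<N. x ^ y * app (g * hop_op x n * h) (kron (a(Suc n := y))) (a(Suc n := y)))
      = (\<Sum>y<N. x ^ y * app g (\<lambda>b. step_weight x (b n) y * app h (kron a) b) a)" by simp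
    also have "\<dots> = app g (\<lambda>b. \<Sum>y<N. x ^ y * (step_weight x (b n) y * app h (kron a) b)) a"
      by (subst app_sum) simp_all
    also have "\<dots> = app g (\<lambda>b. x ^ N * app h (kron a) b) a"
    proof (rule restrictsD[OF rg _ a])
      fix b assume "b \<in> words n N"
      then have "b n < N" by (auto simp: words_def n_def)
      then show "(\<Sum>y<N. x ^ y * (step_weight x (b n) y * app h (kron a) b)) = x ^ N * app h (kron a) b"
        using sum_step_weight[of "b n" N x] by (simp flip: mult.assoc sum_distrib_right)
    qed
    finally show ?thesis by (simp add: app_scale)
  qed
  note inner = this
  have "word_trace x (Suc n) N (g * hop_op x n * h)
     = (\<Sum>a\<in>words n N. x ^ (\<Sum>i\<in>{1..n}. a i) *
         (\<Sum>y<N. x ^ y * app (g * hop_op x n * h) (kron (a(Suc n := y))) (a(Suc n := y))))"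
    unfolding word_trace_def sum_words_Suc sum_upd by (simp only: sum_distrib_left power_add mult.assoc)
  also have "\<dots> = x ^ N * word_trace x n N (g * h)"
    by (simp only: inner word_trace_def sum_distrib_left mult.left_commute cong: sum.cong)
  finally show ?thesis by (simp only: n_def)
qed

lemma place_closed_permutations: "place_closed m {v. v permutes {1..Suc m}}"
  unfolding place_closed_def by (auto intro!: permutes_compose adj_permutes[of _ "Suc m", unfolded One_nat_def])

text \<open>On permutations of \<open>{1..Suc m}\<close> the generator sees an ascent, and once it
  has moved the value \<open>Suc (Suc m)\<close> away from the last place, the other factor cannot
  bring it back. So it acts as \<open>x - 1\<close>, the counterpart of \<open>x ^ N\<close> in
  \<open>word_trace_middle\<close>.\<close>

lemma app_middle_kron_id:
  assumes g: "parabolic_op x m g" and h: "parabolic_op x m h"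
  shows "app (g * hop_op x (Suc m) * h) (kron id) id = (x - 1) * app (g * h) (kron id) id"
proof -
  let ?n = "Suc m"
  let ?\<Omega> = "{v. v permutes {1..?n}}" and ?\<Omega>' = "{v. v (Suc ?n) \<noteq> Suc ?n}"
  have rg: "restricts ?\<Omega> g" by (rule parabolic_restricts[OF place_closed_permutations g])
  have "place_closed m ?\<Omega>'" by (auto simp: place_closed_def transpose_def)
  then have rh: "restricts ?\<Omega>' h" using parabolic_restricts h by blast
  have zero: "app h (kron id) v = 0" if "v \<in> ?\<Omega>'" for v
  proof -
    have "app h (kron id) v = app h (\<lambda>_. 0) v"
      by (rule restrictsD[OF rh _ that]) (auto simp: kron_def)
    then show ?thesis by simp
  qed
  have "app g (hop x ?n (app h (kron id))) id = app g (\<lambda>v. (x - 1) * app h (kron id) v) id"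
  proof (rule restrictsD[OF rg])
    fix v assume "v \<in> ?\<Omega>"
    then have v: "v permutes {1..?n}" by simp
    then have "v (Suc ?n) = Suc ?n" by (auto intro: permutes_not_in)
    moreover have lt: "v ?n < Suc ?n" using permutes_in_image[OF v, of ?n] by auto
    moreover have "app h (kron id) (v \<circ> transpose ?n (Suc ?n)) = 0"
      by (rule zero) (use lt in simp)
    ultimately show "hop x ?n (app h (kron id)) v = (x - 1) * app h (kron id) v"
      by (simp add: hop_def)
  qed (simp add: permutes_id)
  then show ?thesis by (simp add: app_scale)
qed

text \<open>Both sides reduce from level \<open>Suc m\<close> to level \<open>m\<close> alike: a
  middle term yields \<open>x - 1\<close> on either side, and a base term yields on the left the
  factor \<open>1 - (1 / x) ^ N\<close>, which tends to 1.\<close>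

theorem word_trace_limit:
  fixes x :: real
  assumes x: "x > 1"
  shows "parabolic_op x m A \<Longrightarrow>
    (\<lambda>N. (x - 1) ^ Suc m * word_trace x (Suc m) N A / (x ^ N) ^ Suc m) \<longlonglongrightarrow> app A (kron id) id"
proof (induction m arbitrary: A)
  case 0
  \<comment> \<open>At level 0 there are no generators, so \<open>A\<close> is a scalar.\<close>
  have "\<exists>c. \<forall>f a. app A f a = c * f a"
    using 0
  proof (induction rule: hops.parabolic.induct)
    case one
    show ?case by (rule exI[of _ 1]) simp
  next
    case scalar
    show ?case by (rule exI[of _ x]) simp
  next
    case (uminus A)
    then obtain c where "\<forall>f a. app A f a = c * f a" by blast
    then show ?case by (intro exI[of _ "- c"]) simp
  next
    case (add A B)
    then obtain c d where "\<forall>f a. app A f a = c * f a" "\<forall>f a. app B f a = d * f a" by blast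
    then show ?case by (intro exI[of _ "c + d"]) (simp add: distrib_right)
  next
    case (mult A B)
    then obtain c d where "\<forall>f a. app A f a = c * f a" "\<forall>f a. app B f a = d * f a" by blast
    then show ?case by (intro exI[of _ "c * d"]) (simp add: mult.assoc)
  qed simp
  then obtain c where c: "\<And>f a. app A f a = c * f a" by blast
  have "word_trace x (Suc 0) N A = (\<Sum>y<N. x ^ y) * word_trace x 0 N A" for N
    by (rule word_trace_Suc) (auto simp: c restricts_def)
  then have "word_trace x (Suc 0) N A = (x ^ N - 1) / (x - 1) * c" for N
    using x by (simp add: geometric_sum word_trace_def words_0 c kron_def)
  then have "(x - 1) ^ Suc 0 * word_trace x (Suc 0) N A / (x ^ N) ^ Suc 0 = c * (1 - (1 / x) ^ N)" for N
    using x by (simp add: field_simps)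
  moreover have "(\<lambda>N. c * (1 - (1 / x) ^ N)) \<longlonglongrightarrow> c * (1 - 0)"
    using x by (intro tendsto_intros LIMSEQ_power_zero) auto
  ultimately show ?case by (simp add: c kron_def)
next
  case (Suc m)
  from Suc.prems have "hecke_relations.bimodule (scalar_op x) (hop_op x) m A"
    by (rule hops.parabolic_Suc_bimodule)
  then show ?case
  proof (induction rule: hops.bimodule.induct)
    case (base g)
    have "word_trace x (Suc (Suc m)) N g = (\<Sum>y<N. x ^ y) * word_trace x (Suc m) N g" for N
      by (rule word_trace_Suc[OF parabolic_restricts[OF place_closed_words base] parabolic_local[OF _ base]]) simp
    then have 1: "(x - 1) * word_trace x (Suc (Suc m)) N g = (x ^ N - 1) * word_trace x (Suc m) N g" for N
      using x by (simp add: geometric_sum)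
    have "(x - 1) ^ Suc (Suc m) * word_trace x (Suc (Suc m)) N g / (x ^ N) ^ Suc (Suc m)
      = (x - 1) ^ Suc m * word_trace x (Suc m) N g / (x ^ N) ^ Suc m * (1 - (1 / x) ^ N)" for N
    proof -
      have "(x - 1) ^ Suc (Suc m) * word_trace x (Suc (Suc m)) N g
          = (x - 1) ^ Suc m * ((x ^ N - 1) * word_trace x (Suc m) N g)"
        unfolding 1[symmetric] by simp
      moreover have "1 - (1 / x) ^ N = (x ^ N - 1) / x ^ N" using x by (simp add: field_simps)
      ultimately show ?thesis by (simp add: mult_ac)
    qed
    moreover have "(\<lambda>N. (x - 1) ^ Suc m * word_trace x (Suc m) N g / (x ^ N) ^ Suc m * (1 - (1 / x) ^ N))
      \<longlonglongrightarrow> app g (kron id) id * (1 - 0)"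
      using x by (intro tendsto_mult Suc.IH[OF base] tendsto_diff tendsto_const LIMSEQ_power_zero) auto
    ultimately show ?case by (simp only: diff_zero mult_1_right)
  next
    case (middle g h)
    have "(x - 1) ^ Suc (Suc m) * word_trace x (Suc (Suc m)) N (g * hop_op x (Suc m) * h) / (x ^ N) ^ Suc (Suc m)
      = (x - 1) * ((x - 1) ^ Suc m * word_trace x (Suc m) N (g * h) / (x ^ N) ^ Suc m)" for N
      unfolding word_trace_middle[OF middle] using x by (simp add: field_simps)
    then show ?case
      unfolding app_middle_kron_id[OF middle]
      using tendsto_mult_left[OF Suc.IH[OF hops.parabolic.mult[OF middle]], of "x - 1"] by (simp only: simp_thms)
  next
    case (add A B)
    have "word_trace x n N (A + B) = word_trace x n N A + word_trace x n N B" for n N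
      by (simp add: word_trace_def distrib_left sum.distrib)
    then have "(x - 1) ^ Suc (Suc m) * word_trace x (Suc (Suc m)) N (A + B) / (x ^ N) ^ Suc (Suc m)
      = (x - 1) ^ Suc (Suc m) * word_trace x (Suc (Suc m)) N A / (x ^ N) ^ Suc (Suc m)
      + (x - 1) ^ Suc (Suc m) * word_trace x (Suc (Suc m)) N B / (x ^ N) ^ Suc (Suc m)" for N
      by (simp add: distrib_left add_divide_distrib)
    then show ?case using tendsto_add[OF add.IH] by simp
  qed
qed

text \<open>The weight is constant on the words with a given letter sum, and these form a stable
  set, to which the trace formula applies.\<close>

lemma word_trace_coxeter_power:
  assumes p: "p \<ge> 1" "coprime p (Suc m)" and "is": "distinct is" "set is = {1..m}"
  shows "word_trace x (Suc m) N (hop_word x is ^ p)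
    = (\<Sum>a\<in>words (Suc m) N. x ^ (\<Sum>i\<in>{1..Suc m}. a i) * (\<Prod>i\<in>{1..m}. step_weight (x ^ p) (a i) (a (Suc i))))"
proof -
  let ?W = "words (Suc m) N" and ?s = "\<lambda>a. \<Sum>i\<in>{1..Suc m}. a i"
  have W: "(\<Sum>a\<in>?W. x ^ ?s a * f a) = (\<Sum>k\<in>?s ` ?W. x ^ k * (\<Sum>a\<in>{a \<in> ?W. ?s a = k}. f a))" for f
  proof -
    have "(\<Sum>a\<in>?W. x ^ ?s a * f a) = (\<Sum>k\<in>?s ` ?W. \<Sum>a\<in>{a \<in> ?W. ?s a = k}. x ^ ?s a * f a)"
      by (rule sum.image_gen) simp
    also have "\<dots> = (\<Sum>k\<in>?s ` ?W. x ^ k * (\<Sum>a\<in>{a \<in> ?W. ?s a = k}. f a))"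
      unfolding sum_distrib_left by (intro sum.cong) auto
    finally show ?thesis .
  qed
  have "place_closed m {a \<in> ?W. ?s a = k}" for k
    unfolding place_closed_def
  proof (intro ballI)
    fix a i assume a: "a \<in> {a \<in> ?W. ?s a = k}" and i: "i \<in> {1..m}"
    have "transpose i (Suc i) permutes {1..Suc m}" using i by (intro permutes_swap_id) auto
    then have "?s (a \<circ> transpose i (Suc i)) = ?s a" by (rule sum.permute[symmetric])
    then show "a \<circ> transpose i (Suc i) \<in> {a \<in> ?W. ?s a = k}"
      using a i place_closed_words[of m N] unfolding place_closed_def by auto
  qed
  then have "op_trace {a \<in> ?W. ?s a = k} (hop_word x is ^ p)
     = (\<Sum>a\<in>{a \<in> ?W. ?s a = k}. \<Prod>i\<in>{1..m}. step_weight (x ^ p) (a i) (a (Suc i)))" for k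
    by (intro op_trace_coxeter_power p "is") auto
  then show ?thesis
    unfolding word_trace_def W op_trace_def by simp
qed

section \<open>Summation over weakly increasing words\<close>

fun last_letter_sum :: "'k::comm_ring_1 \<Rightarrow> 'k \<Rightarrow> nat \<Rightarrow> nat \<Rightarrow> 'k" where
  "last_letter_sum x y 0 z = x ^ z"
| "last_letter_sum x y (Suc m) z = x ^ z * (\<Sum>u<Suc z. last_letter_sum x y m u * step_weight y u z)"

text \<open>\<open>last_letter_sum x y m z\<close> collects the words of length \<open>Suc m\<close>
  that end in \<open>z\<close>. The function \<open>f\<close> is arbitrary so that the induction can
  insert the step weight towards the next letter.\<close>

lemma sum_words_last_letter:
  "(\<Sum>a\<in>words (Suc m) N. x ^ (\<Sum>i\<in>{1..Suc m}. a i) *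
       (\<Prod>i\<in>{1..m}. step_weight y (a i) (a (Suc i))) * f (a (Suc m)))
   = (\<Sum>z<N. last_letter_sum x y m z * f z)"
proof (induction m arbitrary: f)
  case 0
  show ?case unfolding sum_words_Suc by (simp add: words_0)
next
  case (Suc m)
  let ?n = "Suc m"
  let ?w = "\<lambda>a. x ^ (\<Sum>i\<in>{1..?n}. a i) * (\<Prod>i\<in>{1..m}. step_weight y (a i) (a (Suc i)))"
  have pr: "(\<Prod>i\<in>{1..?n}. step_weight y ((a(Suc ?n := z)) i) ((a(Suc ?n := z)) (Suc i)))
     = (\<Prod>i\<in>{1..m}. step_weight y (a i) (a (Suc i))) * step_weight y (a ?n) z" for a z
    by simp
  have "(\<Sum>a\<in>words (Suc ?n) N. x ^ (\<Sum>i\<in>{1..Suc ?n}. a i) *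
       (\<Prod>i\<in>{1..?n}. step_weight y (a i) (a (Suc i))) * f (a (Suc ?n)))
    = (\<Sum>a\<in>words ?n N. \<Sum>z<N. x ^ z * f z * (?w a * step_weight y (a ?n) z))"
    unfolding sum_words_Suc[where n = ?n] sum_upd
    by (rule sum.cong[OF refl], rule sum.cong[OF refl]) (simp only: pr fun_upd_same power_add mult_ac)
  also have "\<dots> = (\<Sum>z<N. x ^ z * f z * (\<Sum>a\<in>words ?n N. ?w a * step_weight y (a ?n) z))"
    by (subst sum.swap) (simp add: sum_distrib_left)
  also have "\<dots> = (\<Sum>z<N. x ^ z * f z * (\<Sum>u<N. last_letter_sum x y m u * step_weight y u z))"
    by (simp only: Suc.IH[of "\<lambda>u. step_weight y u _"])
  also have "\<dots> = (\<Sum>z<N. last_letter_sum x y ?n z * f z)"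
  proof (intro sum.cong refl)
    fix z assume "z \<in> {..<N}"
    then have "(\<Sum>u<N. last_letter_sum x y m u * step_weight y u z)
       = (\<Sum>u<Suc z. last_letter_sum x y m u * step_weight y u z)"
      by (intro sum.mono_neutral_right) (auto simp: step_weight_def)
    then show "x ^ z * f z * (\<Sum>u<N. last_letter_sum x y m u * step_weight y u z) = last_letter_sum x y ?n z * f z"
      by (simp add: mult_ac)
  qed
  finally show ?case .
qed

text \<open>The limit is the fixed point of \<open>L = r * (L + E)\<close>; deviations from it are
  contracted by \<open>r\<close>, up to errors that tend to zero.\<close>

lemma affine_recursion_tendsto:
  fixes u e :: "nat \<Rightarrow> real"
  assumes rec: "\<And>N. u (Suc N) = r * (u N + e N)" and r: "\<bar>r\<bar> < 1" and e: "e \<longlonglongrightarrow> E"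
  shows "u \<longlonglongrightarrow> r * E / (1 - r)"
proof -
  define L where "L = r * E / (1 - r)"
  define d where "d N = u N - L" for N
  define \<delta> where "\<delta> N = r * (e N - E)" for N
  have "r * E = L * (1 - r)" using r by (simp add: L_def)
  then have d_rec: "d (Suc N) = r * d N + \<delta> N" for N
    unfolding d_def \<delta>_def rec by (simp add: algebra_simps)
  have "\<delta> \<longlonglongrightarrow> r * (E - E)" unfolding \<delta>_def by (intro tendsto_intros e)
  then have \<delta>: "\<delta> \<longlonglongrightarrow> 0" by simp
  have "d \<longlonglongrightarrow> 0"
  proof (rule LIMSEQ_I)
    fix \<epsilon> :: real assume \<epsilon>: "0 < \<epsilon>"
    \<comment> \<open>Chosen so that
      \<open>\<bar>r\<bar> * (\<epsilon> / 2) + \<eta> = \<epsilon> / 2\<close>.\<close>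
    define \<eta> where "\<eta> = \<epsilon> * (1 - \<bar>r\<bar>) / 2"
    have "\<eta> > 0" using \<epsilon> r by (simp add: \<eta>_def)
    then obtain K where K: "\<And>N. N \<ge> K \<Longrightarrow> \<bar>\<delta> N\<bar> < \<eta>"
      using LIMSEQ_D[OF \<delta>, of \<eta>] by auto
    have bound: "\<bar>d (K + N)\<bar> \<le> \<bar>r\<bar> ^ N * \<bar>d K\<bar> + \<epsilon> / 2" for N
    proof (induction N)
      case (Suc N)
      have "\<bar>d (K + Suc N)\<bar> \<le> \<bar>r\<bar> * \<bar>d (K + N)\<bar> + \<eta>"
        using d_rec[of "K + N"] K[of "K + N"] abs_triangle_ineq[of "r * d (K + N)" "\<delta> (K + N)"]
        by (simp add: abs_mult)
      also have "\<dots> \<le> \<bar>r\<bar> * (\<bar>r\<bar> ^ N * \<bar>d K\<bar> + \<epsilon> / 2) + \<eta>"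
        using Suc by (simp add: mult_left_mono)
      also have "\<dots> = \<bar>r\<bar> ^ Suc N * \<bar>d K\<bar> + \<epsilon> / 2" by (simp add: \<eta>_def field_simps)
      finally show ?case .
    qed (use \<epsilon> in simp)
    have "(\<lambda>N. \<bar>r\<bar> ^ N * \<bar>d K\<bar>) \<longlonglongrightarrow> 0 * \<bar>d K\<bar>"
      using r by (intro tendsto_mult LIMSEQ_power_zero tendsto_const) simp
    then obtain M where M: "\<And>N. N \<ge> M \<Longrightarrow> \<bar>r\<bar> ^ N * \<bar>d K\<bar> < \<epsilon> / 2"
      using LIMSEQ_D[of _ 0 "\<epsilon> / 2"] \<epsilon> by (fastforce simp: abs_mult)
    show "\<exists>no. \<forall>n\<ge>no. norm (d n - 0) < \<epsilon>"
    proof (intro exI allI impI)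
      fix n assume n: "K + M \<le> n"
      then have "\<bar>d n\<bar> \<le> \<bar>r\<bar> ^ (n - K) * \<bar>d K\<bar> + \<epsilon> / 2" using bound[of "n - K"] by simp
      moreover have "M \<le> n - K" using n by simp
      from M[OF this] have "\<bar>r\<bar> ^ (n - K) * \<bar>d K\<bar> < \<epsilon> / 2" .
      ultimately show "norm (d n - 0) < \<epsilon>" by (simp del: divide_const_simps)
    qed
  qed
  then have "(\<lambda>N. d N + L) \<longlonglongrightarrow> 0 + L" by (intro tendsto_add tendsto_const)
  then show ?thesis by (simp add: d_def L_def)
qed

text \<open>After division by the growth \<open>(x ^ N) ^ Suc m\<close>, the passage from
  \<open>N\<close> to \<open>Suc N\<close> is an affine recursion whose inhomogeneous term comes
  from the level below; its fixed point supplies one factor of the product.\<close>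

lemma last_letter_sum_limit:
  fixes x y :: real
  assumes x: "x > 1"
  shows "(\<lambda>N. (\<Sum>z<N. last_letter_sum x y m z) / (x ^ N) ^ Suc m)
    \<longlonglongrightarrow> (\<Prod>j\<in>{1..m}. (y * x ^ j - 1) / (x ^ Suc j - 1)) / (x - 1)"
proof (induction m)
  case 0
  have "(\<Sum>z<N. last_letter_sum x y 0 z) / (x ^ N) ^ Suc 0 = (1 - (1 / x) ^ N) / (x - 1)" for N
    using x by (simp add: geometric_sum field_simps)
  moreover have "(\<lambda>N. (1 - (1 / x) ^ N) / (x - 1)) \<longlonglongrightarrow> (1 - 0) / (x - 1)"
    using x by (intro tendsto_intros LIMSEQ_power_zero) auto
  ultimately show ?case by simp
next
  case (Suc m)
  let ?S = "\<lambda>m N. \<Sum>z<N. last_letter_sum x y m z"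
  let ?t = "\<lambda>m N. ?S m N / (x ^ N) ^ Suc m"
  define r where "r = 1 / x ^ Suc (Suc m)"
  define \<Lambda> where "\<Lambda> = (\<Prod>j\<in>{1..m}. (y * x ^ j - 1) / (x ^ Suc j - 1)) / (x - 1)"
  define e where "e N = y * x ^ Suc m * ?t m (Suc N) - ?t m N" for N
  have "?t (Suc m) (Suc N) = r * (?t (Suc m) N + e N)" for N
  proof -
    \<comment> \<open>All \<open>u < N\<close> are strict ascents to \<open>N\<close> with the same
      weight; only \<open>u = N\<close> carries the weight \<open>y\<close>.\<close>
    have "(\<Sum>u<N. last_letter_sum x y m u * step_weight y u N) = (y - 1) * ?S m N"
      by (simp add: step_weight_def sum_distrib_left mult.commute)
    then have "last_letter_sum x y (Suc m) N = x ^ N * ((y - 1) * ?S m N + last_letter_sum x y m N * y)"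
      by (simp only: last_letter_sum.simps sum.lessThan_Suc) (simp add: step_weight_def)
    also have "\<dots> = x ^ N * (y * ?S m (Suc N) - ?S m N)" by (simp add: algebra_simps)
    finally have "last_letter_sum x y (Suc m) N = x ^ N * (y * ?S m (Suc N) - ?S m N)" .
    then have S: "?S (Suc m) (Suc N) = ?S (Suc m) N + x ^ N * (y * ?S m (Suc N) - ?S m N)"
      by (simp del: last_letter_sum.simps)
    define X where "X = x ^ N"
    have X: "X > 0" "x > 0" using x by (simp_all add: X_def)
    have e: "e N = (y * ?S m (Suc N) - ?S m N) / X ^ Suc m"
      using X unfolding e_def power_Suc[of x N] X_def[symmetric] power_mult_distrib
      by (simp add: diff_divide_distrib)
    show ?thesis
      unfolding S e r_def power_Suc[of x N] X_def[symmetric] power_mult_distrib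
      using X by (simp add: field_simps)
  qed
  moreover have "\<bar>r\<bar> < 1" unfolding r_def using x one_less_power[OF x, of "Suc (Suc m)"] by simp
  moreover have "e \<longlonglongrightarrow> y * x ^ Suc m * \<Lambda> - \<Lambda>"
    unfolding e_def \<Lambda>_def by (intro tendsto_intros Suc LIMSEQ_Suc[OF Suc])
  ultimately have "?t (Suc m) \<longlonglongrightarrow> r * (y * x ^ Suc m * \<Lambda> - \<Lambda>) / (1 - r)"
    by (rule affine_recursion_tendsto)
  moreover have "r * (y * x ^ Suc m * \<Lambda> - \<Lambda>) / (1 - r) = (y * x ^ Suc m - 1) / (x ^ Suc (Suc m) - 1) * \<Lambda>"
  proof -
    define Y where "Y = x ^ Suc (Suc m)"
    have "Y > 1" unfolding Y_def using x by (intro one_less_power) auto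
    then show ?thesis unfolding r_def Y_def[symmetric] by (simp add: field_simps)
  qed
  ultimately show ?case by (simp add: \<Lambda>_def mult_ac del: power_Suc)
qed

lemma (in comm_ring_hom) transports_hop_word: "transports hom (hop_word c is) (hop_word (hom c) is)"
  unfolding hop_word_def by (intro transports_prod_list transports_hop)

text \<open>Both sides are limits of the same normalised trace: \<open>word_trace_limit\<close>
  gives the entry at the identity, and the sum over weakly increasing words with
  \<open>y = x ^ p\<close> gives the product.\<close>

lemma coxeter_power_identity_coefficient:
  fixes x :: real
  assumes x: "x > 1" and p: "p \<ge> 1" "coprime p (Suc m)" and "is": "distinct is" "set is = {1..m}"
  shows "app (hop_word x is ^ p) (kron id) id = (x - 1) ^ m * (\<Prod>j\<in>{1..m}. (x ^ (p + j) - 1) / (x ^ Suc j - 1))"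
proof -
  let ?P = "\<Prod>j\<in>{1..m}. (x ^ p * x ^ j - 1) / (x ^ Suc j - 1)"
  have "word_trace x (Suc m) N (hop_word x is ^ p) = (\<Sum>z<N. last_letter_sum x (x ^ p) m z)" for N
    unfolding word_trace_coxeter_power[OF p "is"]
    using sum_words_last_letter[where f = "\<lambda>_. 1" and m = m and N = N and x = x and y = "x ^ p"] by simp
  then have "(\<lambda>N. (x - 1) ^ Suc m * word_trace x (Suc m) N (hop_word x is ^ p) / (x ^ N) ^ Suc m)
     \<longlonglongrightarrow> (x - 1) ^ Suc m * (?P / (x - 1))"
    using tendsto_mult_left[OF last_letter_sum_limit[OF x, of "x ^ p" m], of "(x - 1) ^ Suc m"]
    by (simp only: times_divide_eq_right)
  moreover have "parabolic_op x m (hop_word x is ^ p)"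
    using "is" by (intro parabolic_power parabolic_hop_word) simp
  ultimately have "app (hop_word x is ^ p) (kron id) id = (x - 1) ^ Suc m * (?P / (x - 1))"
    using LIMSEQ_unique[OF word_trace_limit[OF x]] by blast
  also have "\<dots> = (x - 1) ^ m * ?P" using x by simp
  finally show ?thesis by (simp only: power_add)
qed

section \<open>From real values of \<open>q\<close> to the two formulas\<close>

lemma int_poly_eqI_real:
  fixes P Q :: "int poly"
  assumes "\<And>x :: real. x > 1 \<Longrightarrow> poly (of_int_poly P) x = poly (of_int_poly Q) x"
  shows "P = Q"
proof -
  have "{1 :: real<..} \<subseteq> {x. poly (of_int_poly P - of_int_poly Q) x = 0}" using assms by auto
  moreover have "infinite {1 :: real<..}" by (rule infinite_Ioi)
  ultimately have "infinite {x :: real. poly (of_int_poly P - of_int_poly Q) x = 0}" using finite_subset by blast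
  then have "of_int_poly P - of_int_poly Q = (0 :: real poly)" using poly_roots_finite by blast
  then have "of_int_poly P = (of_int_poly Q :: real poly)" by simp
  then show ?thesis by (simp add: poly_eq_iff)
qed

lemma (in comm_ring_hom) hom_q_int: "hom (q_int x a) = q_int (hom x) a"
  by (simp add: q_int_def hom_sum hom_power)

lemma q_fact_Suc: "q_fact q (Suc m) = q_fact q m * q_int q (Suc m)"
  by (simp add: q_fact_def)

lemma q_fact_eq_prod_Suc: "q_fact q (Suc m) = (\<Prod>j\<in>{1..m}. q_int q (Suc j))"
proof (induction m)
  case 0
  show ?case by (simp add: q_fact_def q_int_def)
next
  case (Suc m)
  then show ?case by (simp add: q_fact_Suc[of q "Suc m"])
qed

lemma q_fact_add: "q_fact q (p + m) = q_fact q p * (\<Prod>j\<in>{1..m}. q_int q (p + j))"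
  by (induction m) (simp_all add: q_fact_Suc mult.assoc)

lemma q_int_X_nonzero:
  assumes "a \<ge> 1"
  shows "q_int [:0, 1 :: int:] a \<noteq> 0"
proof
  assume "q_int [:0, 1 :: int:] a = 0"
  then have "poly (q_int [:0, 1 :: int:] a) 0 = 0" by simp
  moreover have "poly (q_int [:0, 1 :: int:] a) 0 = (\<Sum>i<a. 0 ^ i)" by (simp add: q_int_def poly_sum)
  moreover have "\<dots> = (\<Sum>i\<in>{0}. 0 ^ i)" using assms by (intro sum.mono_neutral_right) auto
  ultimately show False by simp
qed

text \<open>With denominators cleared this is an identity of integer polynomials, so it suffices to
  compare values at real \<open>x > 1\<close>, where the limit computation applies.\<close>

lemma R_poly_coxeter_power:
  assumes p: "p \<ge> 1" "coprime p (Suc m)" and "is": "distinct is" "set is = {1..m}"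
  shows "R_poly (Suc m) id id (word_power (map adj is) p) * (\<Prod>j\<in>{1..m}. q_int [:0, 1:] (Suc j))
    = ([:0, 1:] - 1) ^ m * (\<Prod>j\<in>{1..m}. q_int [:0, 1:] (p + j))" (is "?L = ?R")
proof (rule int_poly_eqI_real)
  fix x :: real assume x: "x > 1"
  interpret \<phi>: comm_ring_hom "\<lambda>P. poly (of_int_poly P) x" by (rule comm_ring_hom_poly_of_int)
  let ?\<phi> = "\<lambda>P. poly (of_int_poly P) x"
  have X: "?\<phi> [:0, 1:] = x" by simp
  have qi: "?\<phi> (q_int [:0, 1:] a) = (x ^ a - 1) / (x - 1)" for a
    unfolding \<phi>.hom_q_int X using x by (simp add: q_int_def geometric_sum)
  have R: "R_poly (Suc m) id id (word_power (map adj is) p) = app (hop_word [:0, 1:] is ^ p) (kron id) id"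
    unfolding word_power_map hop_word_power[symmetric]
    by (rule R_poly_hop_word) (use "is" in \<open>auto simp: permutes_id\<close>)
  have "?\<phi> (R_poly (Suc m) id id (word_power (map adj is) p)) = app (hop_word x is ^ p) (kron id) id"
    unfolding R using \<phi>.transports_kron[OF \<phi>.transports_power[OF \<phi>.transports_hop_word[of "[:0, 1:]" "is"]]]
    unfolding X .
  then have L: "?\<phi> ?L = (x - 1) ^ m * (\<Prod>j\<in>{1..m}. (x ^ (p + j) - 1) / (x ^ Suc j - 1))
      * (\<Prod>j\<in>{1..m}. (x ^ Suc j - 1) / (x - 1))"
    unfolding coxeter_power_identity_coefficient[OF x p "is"] by (simp only: \<phi>.hom_mult \<phi>.hom_prod qi)
  have "?\<phi> ?R = (x - 1) ^ m * (\<Prod>j\<in>{1..m}. (x ^ (p + j) - 1) / (x - 1))"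
    by (simp only: \<phi>.hom_mult \<phi>.hom_prod \<phi>.hom_power \<phi>.hom_minus \<phi>.hom_one X qi)
  also have "(\<Prod>j\<in>{1..m}. (x ^ (p + j) - 1) / (x - 1))
     = (\<Prod>j\<in>{1..m}. (x ^ (p + j) - 1) / (x ^ Suc j - 1) * ((x ^ Suc j - 1) / (x - 1)))"
  proof (intro prod.cong refl)
    fix j
    have "x ^ Suc j > 1" using x by (intro one_less_power) auto
    then have "x ^ Suc j - 1 \<noteq> 0" by linarith
    then show "(x ^ (p + j) - 1) / (x - 1) = (x ^ (p + j) - 1) / (x ^ Suc j - 1) * ((x ^ Suc j - 1) / (x - 1))"
      by (simp del: power_Suc)
  qed
  finally show "?\<phi> ?L = ?\<phi> ?R" unfolding L by (simp only: prod.distrib mult.assoc)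
qed

text \<open>The sum is the trace on permutations. A permutation other than the identity has a
  descent, where the step weight vanishes; the identity contributes \<open>q ^ p - 1\<close> at each
  of its \<open>m\<close> ascents.\<close>

lemma sum_R_poly_coxeter_power:
  assumes p: "p \<ge> 1" "coprime p (Suc m)" and "is": "distinct is" "set is = {1..m}"
  shows "(\<Sum>v | v permutes {1..Suc m}. R_poly (Suc m) v id (word_power (map adj is) p))
    = (([:0, 1:] - 1) * q_int [:0, 1:] p) ^ m"
proof -
  let ?\<Omega> = "{v. v permutes {1..Suc m}}" and ?X = "[:0, 1 :: int:]"
  have fin: "finite ?\<Omega>" by (rule finite_permutations) simp
  have "(\<Sum>v\<in>?\<Omega>. R_poly (Suc m) v id (word_power (map adj is) p)) = op_trace ?\<Omega> (hop_word ?X is ^ p)"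
    unfolding op_trace_def word_power_map hop_word_power[symmetric]
    by (intro sum.cong[OF HOL.refl] R_poly_hop_word) (use "is" in auto)
  also have "\<dots> = (\<Sum>v\<in>?\<Omega>. \<Prod>i\<in>{1..m}. step_weight (?X ^ p) (v i) (v (Suc i)))"
    by (rule op_trace_coxeter_power[OF fin place_closed_permutations p "is"])
  also have "\<dots> = (\<Sum>v\<in>?\<Omega>. if v = id then (?X ^ p - 1) ^ m else 0)"
  proof (rule sum.cong[OF HOL.refl])
    fix v assume "v \<in> ?\<Omega>"
    then have v: "v permutes {1..Suc m}" by simp
    show "(\<Prod>i\<in>{1..m}. step_weight (?X ^ p) (v i) (v (Suc i))) = (if v = id then (?X ^ p - 1) ^ m else 0)"
    proof (cases "v = id")
      case True
      then show ?thesis by (simp add: step_weight_def)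
    next
      case False
      \<comment> \<open>Without inversions \<open>v\<close> would have an empty reduced
        word.\<close>
      have "inversions (Suc m) v \<noteq> {}"
        using exists_reduced_word[OF v] False by (metis card.empty length_0_conv word_prod_simps(1))
      then obtain i where i: "i \<in> {1..<Suc m}" "v (Suc i) < v i" using inversions_descent by blast
      then have "step_weight (?X ^ p) (v i) (v (Suc i)) = 0" by (simp add: step_weight_def)
      moreover have "i \<in> {1..m}" using i by auto
      ultimately have "(\<Prod>i\<in>{1..m}. step_weight (?X ^ p) (v i) (v (Suc i))) = 0"
        by (intro prod_zero) auto
      then show ?thesis using False by simp
    qed
  qed
  also have "\<dots> = (?X ^ p - 1) ^ m" using fin permutes_id[of "{1..Suc m}"] by (simp only: sum.delta mem_Collect_eq if_True)
  also have "?X ^ p - 1 = (?X - 1) * q_int ?X p" unfolding q_int_def by (rule power_diff_1_eq)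
  finally show ?thesis .
qed

lemma comm_ring_hom_to_fract: "comm_ring_hom (to_fract :: 'a::idom \<Rightarrow> 'a fract)"
  by unfold_locales simp_all

theorem theorem6p17:
  fixes n p :: nat and c :: "(nat \<Rightarrow> nat) list"
  assumes "n \<ge> 1"
    and "p \<ge> 1"
    and "coprime p n"
    and "coxeter_word n c"
  shows "to_fract (R_poly n id id (word_power c p))
           = (qvar - 1) ^ (n - 1) * (1 / q_int qvar (n + p)) * q_binomial qvar (n + p) n
       \<and> to_fract (\<Sum>v | v permutes {1..n}. R_poly n v id (word_power c p))
           = (qvar - 1) ^ (n - 1) * q_int qvar p ^ (n - 1)"
proof -
  obtain m where n: "n = Suc m" using assms(1) by (metis Suc_le_D One_nat_def)
  obtain "is" where c: "c = map adj is" and "is": "distinct is" "set is = {1..<n}"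
    using coxeter_word_obtain[OF assms(4)] by blast
  have set_is: "set is = {1..m}" unfolding "is"(2) n by auto
  have p: "coprime p (Suc m)" using assms(3) n by simp
  interpret \<phi>: comm_ring_hom "to_fract :: int poly \<Rightarrow> int poly fract" by (rule comm_ring_hom_to_fract)
  have X: "to_fract [:0, 1:] = qvar" by (simp only: qvar_def)
  have nz: "q_int qvar a \<noteq> 0" if "a \<ge> 1" for a
    using q_int_X_nonzero[OF that] unfolding X[symmetric] \<phi>.hom_q_int[symmetric] by simp
  have fact_nz: "q_fact qvar a \<noteq> 0" for a
    unfolding q_fact_def by (subst prod_zero_iff) (use nz in auto)
  let ?R = "to_fract (R_poly n id id (word_power c p))"
  \<comment> \<open>The first factor of \<open>q_fact qvar n\<close> is 1, so the cleared
    denominator is the whole factorial.\<close>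
  have "?R * q_fact qvar n = (qvar - 1) ^ m * (\<Prod>j\<in>{1..m}. q_int qvar (p + j))"
    using arg_cong[OF R_poly_coxeter_power[OF assms(2) p "is"(1) set_is], of to_fract]
    unfolding n c q_fact_eq_prod_Suc
    by (simp only: \<phi>.hom_mult \<phi>.hom_prod \<phi>.hom_power \<phi>.hom_minus \<phi>.hom_one \<phi>.hom_q_int X)
  then have "?R * q_fact qvar n * q_fact qvar p = (qvar - 1) ^ m * q_fact qvar (p + m)"
    by (simp add: q_fact_add mult_ac)
  \<comment> \<open>Since \<open>n + p = Suc (p + m)\<close>, one more \<open>q\<close>-integer
    completes the factorial; it is the one in the denominator of the claim.\<close>
  then have "?R * (q_fact qvar n * q_fact qvar p) * q_int qvar (n + p) = (qvar - 1) ^ m * q_fact qvar (n + p)"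
    unfolding n by (simp add: q_fact_Suc[of qvar "m + p"] add.commute mult_ac)
  then have "?R = (qvar - 1) ^ m * q_fact qvar (n + p) / (q_fact qvar n * q_fact qvar p * q_int qvar (n + p))"
    using nz[of "n + p"] fact_nz n by (simp add: eq_divide_eq mult_ac)
  then have "?R = (qvar - 1) ^ (n - 1) * (1 / q_int qvar (n + p)) * q_binomial qvar (n + p) n"
    unfolding q_binomial_def by (simp add: n mult_ac)
  moreover have "to_fract (\<Sum>v | v permutes {1..n}. R_poly n v id (word_power c p))
      = (qvar - 1) ^ (n - 1) * q_int qvar p ^ (n - 1)"
    using arg_cong[OF sum_R_poly_coxeter_power[OF assms(2) p "is"(1) set_is], of to_fract]
    unfolding n c
    by (simp only: \<phi>.hom_mult \<phi>.hom_power \<phi>.hom_minus \<phi>.hom_one \<phi>.hom_q_int X power_mult_distrib diff_Suc_1)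
  ultimately show ?thesis by blast
qed

end
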